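(* Suppose $w:A$ is a proof term of $\mathsf{LC}$ whose free proof variables are among $x_1^{A_1},\dots,x_n^{A_n}$. Let $\alpha_1,\dots,\alpha_k$ be individual variables and $r_1,\dots,r_k$ terms of $\mathcal L$, and for any formula $C$ write $\overline C:=C[r_1/\alpha_1\cdots r_k/\alpha_k]$. If $t_1,\dots,t_n$ are terms of $\mathsf{LC}^\star$ with $t_i\Vdash\overline{A_i}$ for $i=1,\dots,n$, then $$w[r_1/\alpha_1\cdots r_k/\alpha_k][t_1/x_1^{\overline{A_1}}\cdots t_n/x_n^{\overline{A_n}}]\Vdash\overline A.$$
   Context: Formulas. Terms of the first-order language $\mathcal{L}$ are individual variables, constants, and $f(m_1,\dots,m_n)$; atomic formulas are $P(m_1,\dots,m_n)$ including $0$-ary $\bot$; formulas are built with $\wedge,\vee,\to,\forall\alpha,\exists\alpha$. Proof terms of $\mathsf{LC}$ (Church-typed): $x^A:A$; $\langle u,t\rangle:A\wedge B$ from $u:A,t:B$; $u\pi_0:A$, $u\pi_1:B$ from $u:A\wedge B$; $tu:B$ from $t:A\to B,u:A$; $\lambda x^Au:A\to B$ from $u:B$; $\iota_0(u):A\vee B$ from $u:A$, $\iota_1(u):A\vee B$ from $u:B$; $u[x^A.w_1,y^B.w_2]:C$ from $u:A\vee B$, $w_1,w_2:C$; $um:A[m/\alpha]$ from $u:\forall\alpha A$; $\lambda\alpha u:\forall\alpha A$ from $u:A$ ($\alpha$ not free in types of free proof variables of $u$); $(m,u):\exists\alpha A$ from $u:A[m/\alpha]$; $u[(\alpha,x^A).t]:C$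 from $u:\exists\alpha A$, $t:C$ (usual eigenvariable condition); $u\parallel_a v:C$ from $u:C$, $v:C$, where $a$ occurs in $u$ with type $A\to B$ and in $v$ with type $B\to A$, $\parallel_a$ binding $a$; $\mathsf{efq}_P(u):P$ from $u:\bot$, $P$ atomic. $\mathsf{LC}^\star$ adds constants $\mathcal A^{A\to B}:A\to B$ for all $A,B$. Stacks: finite sequences $\sigma=\sigma_1\cdot\ldots\cdot\sigma_n$ with components proof terms, terms of $\mathcal L$, $\pi_0,\pi_1$, $[x.u,y.v]$, $[(\alpha,x).v]$; $\epsilon$ empty; $t\sigma=((t\sigma_1)\ldots)\sigma_n$. Parallel context: $u_1\parallel_{a_1}\cdots[\,]\cdots\parallel_{a_n}u_n$. Basic reductions: $(\lambda xu)t\mapsto u[t/x]$; $(\lambda\alpha u)m\mapsto u[m/\alpha]$; $\langle u_0,u_1\rangle\pi_i\mapsto u_i$; $\iota_i(u)[x_0.t_0,x_1.t_1]\mapsto t_i[u/x_i]$; $(m,u)[(\alpha,x).v]\mapsto v[m/\alpha][u/x]$; $(u\parallel_a v)\xi\mapsto u\xi\parallel_a v\xi$ for $\xi$ a stack element that is a proof term, $\pi_i$, $[x.w_1,y.w_2]$ or $[(\alpha,x).w]$ in which $a$ is not free; $\mathcal C[a^{A\to B}u\sigma]\parallel_a v\mapsto\mathcal C[v[\lambda y^Bu/a^{B\to A}]]\parallel_a v$ and $v\parallel_a\mathcal C[a^{A\to B}u\sigma]\mapsto v\parallel_a\mathcal C[v[\lambda y^Bu/a^{B\to A}]]$ ($\mathcal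 C$ parallel context, $a$ free in $\mathcal C[au\sigma]$, $y$ dummy); $\mathcal Au\sigma\mapsto u$ when $\mathcal Au\sigma$ and $u$ have the same type. Head reduction $\succ$: writing $t=t_1\parallel_{a_1}\cdots\parallel_{a_n}t_{n+1}$, the $t_i$ are the parallel processes (elementary if not of the form $u\parallel_a v$). The head redex of $t$ is $h$ where $t=h\sigma$ and $h=r\xi$ with $\xi$ one stack element and $r$ one of $\lambda xu,\lambda\alpha u,\langle u,v\rangle,\iota_i(u),(m,u),u\parallel_a v$ (with $h$ a redex), or $h=t$ if $t=u\parallel_a v$ is a redex, or $h=t=\mathcal Au\sigma$ if $u$ and $t$ have the same type. The starting symbol of a redex $r\xi$ is its opening parenthesis; of a redex $u\parallel_a v$ it is the leftmost occurrence of $a$ heading an elementary process $a\,s\,\rho$. $t\succ t'$ iff $t'$ is obtained by contracting the head redex whose starting symbol is leftmost among the head redexes of the parallel processes of $t$. $\mathsf{HN}^\star$ is the set of terms of $\mathsf{LC}^\star$ with no infinite sequence $t=u_1\succ u_2\succ\cdots$. Realizability: $t\Vdash C$ iff $t:C$ and $t\sigma\in\mathsf{HN}^\star$ for all $\sigma\in\|C\|$, where: $\|P\|=\{\epsilon\}$ for $P$ atomic; $\|A\to B\|=\{u\cdot\sigma:u\Vdash A,\sigma\in\|B\|\}\cup\{\epsilon\}$; $\|A\wedge B\|=\{\pi_0\cdot\sigma:\sigma\in\|A\|\}\cup\{\pi_1\cdot\sigma:\sigma\in\|B\|\}\cup\{\epsilon\}$; $\|A\vee B\|=\{[x.u,y.v]\cdot\sigma:\forall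 t\,((t\Vdash A\Rightarrow u[t/x]\sigma\in\mathsf{HN}^\star)\wedge(t\Vdash B\Rightarrow v[t/y]\sigma\in\mathsf{HN}^\star))\}\cup\{\epsilon\}$; $\|\forall\alpha A\|=\{m\cdot\sigma:m\in\mathcal L,\sigma\in\|A[m/\alpha]\|\}\cup\{\epsilon\}$; $\|\exists\alpha A\|=\{[(\alpha,x).v]\cdot\sigma:\forall m\in\mathcal L\,\forall t\,(t\Vdash A[m/\alpha]\Rightarrow v[m/\alpha][t/x]\sigma\in\mathsf{HN}^\star)\}\cup\{\epsilon\}$. *)

theory Defs
  imports Main
begin

text \<open>
  Syntax is locally nameless: free variables carry names, bound ones are de Bruijn indices, so
  syntactic equality is equality up to renaming of bound variables.  There are two index spaces, one
  for individual variables (bound by \<open>All\<close>, \<open>Ex\<close>, \<open>TLam\<close>, \<open>EEx\<close>) and one for proof variables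
  (bound by \<open>Lam\<close>, \<open>Par\<close>, \<open>ECase\<close>, \<open>EEx\<close>).
\<close>

section \<open>The first-order language\<close>

text \<open>Signatures are pairs of types in this class; constants are the function symbols of arity 0.\<close>

class symbol =
  fixes arity :: "'a \<Rightarrow> nat"

type_synonym name = nat

datatype 'f tm = Var name | Bnd nat | Fn 'f "'f tm list"

datatype ('f, 'p) fm =
    Bot
  | Atom 'p "'f tm list"
  | And "('f, 'p) fm" "('f, 'p) fm"
  | Or "('f, 'p) fm" "('f, 'p) fm"
  | Imp "('f, 'p) fm" "('f, 'p) fm"
  | All "('f, 'p) fm"
  | Ex "('f, 'p) fm"

text \<open>
  \<open>wf_tm n\<close> and \<open>wf_fm n\<close>: arities are respected and all dangling indices are below \<open>n\<close>.  The terms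
  and formulas of the language are those with \<open>n = 0\<close>.
\<close>

fun wf_tm :: "nat \<Rightarrow> ('f::symbol) tm \<Rightarrow> bool" where
  "wf_tm n (Var \<alpha>) = True"
| "wf_tm n (Bnd i) = (i < n)"
| "wf_tm n (Fn f ms) = (length ms = arity f \<and> (\<forall>m\<in>set ms. wf_tm n m))"

primrec wf_fm :: "nat \<Rightarrow> ('f::symbol, 'p::symbol) fm \<Rightarrow> bool" where
  "wf_fm n Bot = True"
| "wf_fm n (Atom P ms) = (length ms = arity P \<and> (\<forall>m\<in>set ms. wf_tm n m))"
| "wf_fm n (And A B) = (wf_fm n A \<and> wf_fm n B)"
| "wf_fm n (Or A B) = (wf_fm n A \<and> wf_fm n B)"
| "wf_fm n (Imp A B) = (wf_fm n A \<and> wf_fm n B)"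
| "wf_fm n (All A) = wf_fm (Suc n) A"
| "wf_fm n (Ex A) = wf_fm (Suc n) A"

fun atomic :: "('f, 'p) fm \<Rightarrow> bool" where
  "atomic Bot = True"
| "atomic (Atom P ms) = True"
| "atomic _ = False"

text \<open>Substitution for indices; \<open>up_i \<rho>\<close> is \<open>\<rho>\<close> moved under a binder of an individual variable.\<close>

primrec tsub :: "(nat \<Rightarrow> 'f tm) \<Rightarrow> 'f tm \<Rightarrow> 'f tm" where
  "tsub \<rho> (Var \<alpha>) = Var \<alpha>"
| "tsub \<rho> (Bnd i) = \<rho> i"
| "tsub \<rho> (Fn f ms) = Fn f (map (tsub \<rho>) ms)"

definition shift :: "nat \<Rightarrow> 'f tm" where
  "shift i = Bnd (Suc i)"

definition up_i :: "(nat \<Rightarrow> 'f tm) \<Rightarrow> nat \<Rightarrow> 'f tm" where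
  "up_i \<rho> = case_nat (Bnd 0) (\<lambda>i. tsub shift (\<rho> i))"

primrec fsub :: "(nat \<Rightarrow> 'f tm) \<Rightarrow> ('f, 'p) fm \<Rightarrow> ('f, 'p) fm" where
  "fsub \<rho> Bot = Bot"
| "fsub \<rho> (Atom P ms) = Atom P (map (tsub \<rho>) ms)"
| "fsub \<rho> (And A B) = And (fsub \<rho> A) (fsub \<rho> B)"
| "fsub \<rho> (Or A B) = Or (fsub \<rho> A) (fsub \<rho> B)"
| "fsub \<rho> (Imp A B) = Imp (fsub \<rho> A) (fsub \<rho> B)"
| "fsub \<rho> (All A) = All (fsub (up_i \<rho>) A)"
| "fsub \<rho> (Ex A) = Ex (fsub (up_i \<rho>) A)"

text \<open>\<open>fsub1 m A\<close> is \<open>A[m/\<alpha>]\<close> for the variable \<open>\<alpha>\<close> bound just outside \<open>A\<close>.\<close>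

abbreviation fsub1 :: "'f tm \<Rightarrow> ('f, 'p) fm \<Rightarrow> ('f, 'p) fm" where
  "fsub1 m \<equiv> fsub (case_nat m Bnd)"

text \<open>
  Simultaneous substitution for named individual variables.  The range is not shifted under binders:
  it is meant to consist of terms without dangling indices.
\<close>

primrec tinst :: "(name \<rightharpoonup> 'f tm) \<Rightarrow> 'f tm \<Rightarrow> 'f tm" where
  "tinst \<rho> (Var \<alpha>) = (case \<rho> \<alpha> of None \<Rightarrow> Var \<alpha> | Some r \<Rightarrow> r)"
| "tinst \<rho> (Bnd i) = Bnd i"
| "tinst \<rho> (Fn f ms) = Fn f (map (tinst \<rho>) ms)"

primrec finst :: "(name \<rightharpoonup> 'f tm) \<Rightarrow> ('f, 'p) fm \<Rightarrow> ('f, 'p) fm" where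
  "finst \<rho> Bot = Bot"
| "finst \<rho> (Atom P ms) = Atom P (map (tinst \<rho>) ms)"
| "finst \<rho> (And A B) = And (finst \<rho> A) (finst \<rho> B)"
| "finst \<rho> (Or A B) = Or (finst \<rho> A) (finst \<rho> B)"
| "finst \<rho> (Imp A B) = Imp (finst \<rho> A) (finst \<rho> B)"
| "finst \<rho> (All A) = All (finst \<rho> A)"
| "finst \<rho> (Ex A) = Ex (finst \<rho> A)"

section \<open>Proof terms\<close>

text \<open>
  \<open>Elim t \<xi>\<close> is \<open>t \<xi>\<close>, the application of \<open>t\<close> to a stack element.  In keeping with Church typing, a
  term determines its type, so injections, existential pairs and binders of proof variables record
  the formulas that cannot be read off their subterms: \<open>Inl B u : A \<or> B\<close>, \<open>Inr A u : A \<or> B\<close>,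
  \<open>Wit A m u : \<exists>\<alpha> A\<close> (with \<open>\<alpha>\<close> index 0 in \<open>A\<close>).  A free proof variable is a name together with its
  type.  \<open>Par A B u v\<close> is \<open>u \<parallel>\<^sub>a v\<close>, where \<open>a\<close> is index 0 in both \<open>u\<close> and \<open>v\<close> and has type
  \<open>A \<rightarrow> B\<close> in \<open>u\<close> and \<open>B \<rightarrow> A\<close> in \<open>v\<close>.  \<open>Abort A B\<close> is the constant of type \<open>A \<rightarrow> B\<close> of
  the extended calculus.
\<close>

datatype ('f, 'p) pt =
    PFree name "('f, 'p) fm"
  | PBnd nat
  | Abort "('f, 'p) fm" "('f, 'p) fm"
  | Pair "('f, 'p) pt" "('f, 'p) pt"
  | Lam "('f, 'p) fm" "('f, 'p) pt"
  | TLam "('f, 'p) pt"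
  | Inl "('f, 'p) fm" "('f, 'p) pt"
  | Inr "('f, 'p) fm" "('f, 'p) pt"
  | Wit "('f, 'p) fm" "'f tm" "('f, 'p) pt"
  | Par "('f, 'p) fm" "('f, 'p) fm" "('f, 'p) pt" "('f, 'p) pt"
  | Efq "('f, 'p) fm" "('f, 'p) pt"
  | Elim "('f, 'p) pt" "('f, 'p) elem"
and ('f, 'p) elem =
    EArg "('f, 'p) pt"
  | EInd "'f tm"
  | EFst
  | ESnd
  | ECase "('f, 'p) fm" "('f, 'p) pt" "('f, 'p) fm" "('f, 'p) pt"
      \<comment> \<open>\<open>[x\<^sup>A.u, y\<^sup>B.v]\<close> is \<open>ECase A u B v\<close>\<close>
  | EEx "('f, 'p) fm" "('f, 'p) pt"
      \<comment> \<open>\<open>[(\<alpha>, x\<^sup>A).u]\<close> is \<open>EEx A u\<close>; \<open>\<alpha>\<close> is bound in \<open>A\<close> and \<open>u\<close>\<close>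

type_synonym ('f, 'p) stack = "('f, 'p) elem list"

abbreviation app_stack :: "('f, 'p) pt \<Rightarrow> ('f, 'p) stack \<Rightarrow> ('f, 'p) pt" (infixl "\<bullet>" 80) where
  "t \<bullet> \<sigma> \<equiv> foldl Elim t \<sigma>"

subsection \<open>Substitution\<close>

text \<open>
  \<open>isub\<close> substitutes for individual indices.  It leaves the type of a free proof variable alone, since
  such a type has no dangling index (see \<open>typed\<close>).
\<close>

primrec isub :: "(nat \<Rightarrow> 'f tm) \<Rightarrow> ('f, 'p) pt \<Rightarrow> ('f, 'p) pt"
  and isub_e :: "(nat \<Rightarrow> 'f tm) \<Rightarrow> ('f, 'p) elem \<Rightarrow> ('f, 'p) elem" where
  "isub \<rho> (PFree x A) = PFree x A"
| "isub \<rho> (PBnd i) = PBnd i"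
| "isub \<rho> (Abort A B) = Abort (fsub \<rho> A) (fsub \<rho> B)"
| "isub \<rho> (Pair u v) = Pair (isub \<rho> u) (isub \<rho> v)"
| "isub \<rho> (Lam A u) = Lam (fsub \<rho> A) (isub \<rho> u)"
| "isub \<rho> (TLam u) = TLam (isub (up_i \<rho>) u)"
| "isub \<rho> (Inl B u) = Inl (fsub \<rho> B) (isub \<rho> u)"
| "isub \<rho> (Inr A u) = Inr (fsub \<rho> A) (isub \<rho> u)"
| "isub \<rho> (Wit A m u) = Wit (fsub (up_i \<rho>) A) (tsub \<rho> m) (isub \<rho> u)"
| "isub \<rho> (Par A B u v) = Par (fsub \<rho> A) (fsub \<rho> B) (isub \<rho> u) (isub \<rho> v)"
| "isub \<rho> (Efq P u) = Efq (fsub \<rho> P) (isub \<rho> u)"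
| "isub \<rho> (Elim u \<xi>) = Elim (isub \<rho> u) (isub_e \<rho> \<xi>)"
| "isub_e \<rho> (EArg u) = EArg (isub \<rho> u)"
| "isub_e \<rho> (EInd m) = EInd (tsub \<rho> m)"
| "isub_e \<rho> EFst = EFst"
| "isub_e \<rho> ESnd = ESnd"
| "isub_e \<rho> (ECase A u B v) = ECase (fsub \<rho> A) (isub \<rho> u) (fsub \<rho> B) (isub \<rho> v)"
| "isub_e \<rho> (EEx A u) = EEx (fsub (up_i \<rho>) A) (isub (up_i \<rho>) u)"

definition up_r :: "(nat \<Rightarrow> nat) \<Rightarrow> nat \<Rightarrow> nat" where
  "up_r f = case_nat 0 (\<lambda>i. Suc (f i))"

primrec pren :: "(nat \<Rightarrow> nat) \<Rightarrow> ('f, 'p) pt \<Rightarrow> ('f, 'p) pt"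
  and pren_e :: "(nat \<Rightarrow> nat) \<Rightarrow> ('f, 'p) elem \<Rightarrow> ('f, 'p) elem" where
  "pren f (PFree x A) = PFree x A"
| "pren f (PBnd i) = PBnd (f i)"
| "pren f (Abort A B) = Abort A B"
| "pren f (Pair u v) = Pair (pren f u) (pren f v)"
| "pren f (Lam A u) = Lam A (pren (up_r f) u)"
| "pren f (TLam u) = TLam (pren f u)"
| "pren f (Inl B u) = Inl B (pren f u)"
| "pren f (Inr A u) = Inr A (pren f u)"
| "pren f (Wit A m u) = Wit A m (pren f u)"
| "pren f (Par A B u v) = Par A B (pren (up_r f) u) (pren (up_r f) v)"
| "pren f (Efq P u) = Efq P (pren f u)"
| "pren f (Elim u \<xi>) = Elim (pren f u) (pren_e f \<xi>)"
| "pren_e f (EArg u) = EArg (pren f u)"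
| "pren_e f (EInd m) = EInd m"
| "pren_e f EFst = EFst"
| "pren_e f ESnd = ESnd"
| "pren_e f (ECase A u B v) = ECase A (pren (up_r f) u) B (pren (up_r f) v)"
| "pren_e f (EEx A u) = EEx A (pren (up_r f) u)"

definition up_p :: "(nat \<Rightarrow> ('f, 'p) pt) \<Rightarrow> nat \<Rightarrow> ('f, 'p) pt" where
  "up_p \<theta> = case_nat (PBnd 0) (\<lambda>i. pren Suc (\<theta> i))"

definition up_pi :: "(nat \<Rightarrow> ('f, 'p) pt) \<Rightarrow> nat \<Rightarrow> ('f, 'p) pt" where
  "up_pi \<theta> = (\<lambda>i. isub shift (\<theta> i))"

primrec psub :: "(nat \<Rightarrow> ('f, 'p) pt) \<Rightarrow> ('f, 'p) pt \<Rightarrow> ('f, 'p) pt"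
  and psub_e :: "(nat \<Rightarrow> ('f, 'p) pt) \<Rightarrow> ('f, 'p) elem \<Rightarrow> ('f, 'p) elem" where
  "psub \<theta> (PFree x A) = PFree x A"
| "psub \<theta> (PBnd i) = \<theta> i"
| "psub \<theta> (Abort A B) = Abort A B"
| "psub \<theta> (Pair u v) = Pair (psub \<theta> u) (psub \<theta> v)"
| "psub \<theta> (Lam A u) = Lam A (psub (up_p \<theta>) u)"
| "psub \<theta> (TLam u) = TLam (psub (up_pi \<theta>) u)"
| "psub \<theta> (Inl B u) = Inl B (psub \<theta> u)"
| "psub \<theta> (Inr A u) = Inr A (psub \<theta> u)"
| "psub \<theta> (Wit A m u) = Wit A m (psub \<theta> u)"
| "psub \<theta> (Par A B u v) = Par A B (psub (up_p \<theta>) u) (psub (up_p \<theta>) v)"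
| "psub \<theta> (Efq P u) = Efq P (psub \<theta> u)"
| "psub \<theta> (Elim u \<xi>) = Elim (psub \<theta> u) (psub_e \<theta> \<xi>)"
| "psub_e \<theta> (EArg u) = EArg (psub \<theta> u)"
| "psub_e \<theta> (EInd m) = EInd m"
| "psub_e \<theta> EFst = EFst"
| "psub_e \<theta> ESnd = ESnd"
| "psub_e \<theta> (ECase A u B v) = ECase A (psub (up_p \<theta>) u) B (psub (up_p \<theta>) v)"
| "psub_e \<theta> (EEx A u) = EEx A (psub (up_p (up_pi \<theta>)) u)"

text \<open>
  \<open>isub1 m u\<close> and \<open>psub1 t u\<close> are \<open>u[m/\<alpha>]\<close> and \<open>u[t/x]\<close> for the innermost bound variable
  \<open>\<alpha>\<close>, respectively \<open>x\<close>, in whose scope \<open>u\<close> lies.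
\<close>

abbreviation isub1 :: "'f tm \<Rightarrow> ('f, 'p) pt \<Rightarrow> ('f, 'p) pt" where
  "isub1 m \<equiv> isub (case_nat m Bnd)"

abbreviation psub1 :: "('f, 'p) pt \<Rightarrow> ('f, 'p) pt \<Rightarrow> ('f, 'p) pt" where
  "psub1 t \<equiv> psub (case_nat t PBnd)"

text \<open>
  Simultaneous substitution for named individual variables; it also acts on the types of proof
  variables, turning \<open>x\<^sup>A\<close> into \<open>x\<close> with the instantiated type.
\<close>

primrec inst :: "(name \<rightharpoonup> 'f tm) \<Rightarrow> ('f, 'p) pt \<Rightarrow> ('f, 'p) pt"
  and inst_e :: "(name \<rightharpoonup> 'f tm) \<Rightarrow> ('f, 'p) elem \<Rightarrow> ('f, 'p) elem" where
  "inst \<rho> (PFree x A) = PFree x (finst \<rho> A)"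
| "inst \<rho> (PBnd i) = PBnd i"
| "inst \<rho> (Abort A B) = Abort (finst \<rho> A) (finst \<rho> B)"
| "inst \<rho> (Pair u v) = Pair (inst \<rho> u) (inst \<rho> v)"
| "inst \<rho> (Lam A u) = Lam (finst \<rho> A) (inst \<rho> u)"
| "inst \<rho> (TLam u) = TLam (inst \<rho> u)"
| "inst \<rho> (Inl B u) = Inl (finst \<rho> B) (inst \<rho> u)"
| "inst \<rho> (Inr A u) = Inr (finst \<rho> A) (inst \<rho> u)"
| "inst \<rho> (Wit A m u) = Wit (finst \<rho> A) (tinst \<rho> m) (inst \<rho> u)"
| "inst \<rho> (Par A B u v) = Par (finst \<rho> A) (finst \<rho> B) (inst \<rho> u) (inst \<rho> v)"
| "inst \<rho> (Efq P u) = Efq (finst \<rho> P) (inst \<rho> u)"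
| "inst \<rho> (Elim u \<xi>) = Elim (inst \<rho> u) (inst_e \<rho> \<xi>)"
| "inst_e \<rho> (EArg u) = EArg (inst \<rho> u)"
| "inst_e \<rho> (EInd m) = EInd (tinst \<rho> m)"
| "inst_e \<rho> EFst = EFst"
| "inst_e \<rho> ESnd = ESnd"
| "inst_e \<rho> (ECase A u B v) = ECase (finst \<rho> A) (inst \<rho> u) (finst \<rho> B) (inst \<rho> v)"
| "inst_e \<rho> (EEx A u) = EEx (finst \<rho> A) (inst \<rho> u)"

text \<open>
  Simultaneous substitution for free proof variables, where a variable is a pair of a name and a
  type.  Its range is meant to consist of terms without dangling indices.
\<close>

primrec pinst :: "(name \<times> ('f, 'p) fm \<rightharpoonup> ('f, 'p) pt) \<Rightarrow> ('f, 'p) pt \<Rightarrow> ('f, 'p) pt"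
  and pinst_e :: "(name \<times> ('f, 'p) fm \<rightharpoonup> ('f, 'p) pt) \<Rightarrow> ('f, 'p) elem \<Rightarrow> ('f, 'p) elem" where
  "pinst \<theta> (PFree x A) = (case \<theta> (x, A) of None \<Rightarrow> PFree x A | Some t \<Rightarrow> t)"
| "pinst \<theta> (PBnd i) = PBnd i"
| "pinst \<theta> (Abort A B) = Abort A B"
| "pinst \<theta> (Pair u v) = Pair (pinst \<theta> u) (pinst \<theta> v)"
| "pinst \<theta> (Lam A u) = Lam A (pinst \<theta> u)"
| "pinst \<theta> (TLam u) = TLam (pinst \<theta> u)"
| "pinst \<theta> (Inl B u) = Inl B (pinst \<theta> u)"
| "pinst \<theta> (Inr A u) = Inr A (pinst \<theta> u)"
| "pinst \<theta> (Wit A m u) = Wit A m (pinst \<theta> u)"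
| "pinst \<theta> (Par A B u v) = Par A B (pinst \<theta> u) (pinst \<theta> v)"
| "pinst \<theta> (Efq P u) = Efq P (pinst \<theta> u)"
| "pinst \<theta> (Elim u \<xi>) = Elim (pinst \<theta> u) (pinst_e \<theta> \<xi>)"
| "pinst_e \<theta> (EArg u) = EArg (pinst \<theta> u)"
| "pinst_e \<theta> (EInd m) = EInd m"
| "pinst_e \<theta> EFst = EFst"
| "pinst_e \<theta> ESnd = ESnd"
| "pinst_e \<theta> (ECase A u B v) = ECase A (pinst \<theta> u) B (pinst \<theta> v)"
| "pinst_e \<theta> (EEx A u) = EEx A (pinst \<theta> u)"

primrec free_vars :: "('f, 'p) pt \<Rightarrow> (name \<times> ('f, 'p) fm) set"
  and free_vars_e :: "('f, 'p) elem \<Rightarrow> (name \<times> ('f, 'p) fm) set" where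
  "free_vars (PFree x A) = {(x, A)}"
| "free_vars (PBnd i) = {}"
| "free_vars (Abort A B) = {}"
| "free_vars (Pair u v) = free_vars u \<union> free_vars v"
| "free_vars (Lam A u) = free_vars u"
| "free_vars (TLam u) = free_vars u"
| "free_vars (Inl B u) = free_vars u"
| "free_vars (Inr A u) = free_vars u"
| "free_vars (Wit A m u) = free_vars u"
| "free_vars (Par A B u v) = free_vars u \<union> free_vars v"
| "free_vars (Efq P u) = free_vars u"
| "free_vars (Elim u \<xi>) = free_vars u \<union> free_vars_e \<xi>"
| "free_vars_e (EArg u) = free_vars u"
| "free_vars_e (EInd m) = {}"
| "free_vars_e EFst = {}"
| "free_vars_e ESnd = {}"
| "free_vars_e (ECase A u B v) = free_vars u \<union> free_vars v"
| "free_vars_e (EEx A u) = free_vars u"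

primrec abort_free :: "('f, 'p) pt \<Rightarrow> bool"
  and abort_free_e :: "('f, 'p) elem \<Rightarrow> bool" where
  "abort_free (PFree x A) = True"
| "abort_free (PBnd i) = True"
| "abort_free (Abort A B) = False"
| "abort_free (Pair u v) = (abort_free u \<and> abort_free v)"
| "abort_free (Lam A u) = abort_free u"
| "abort_free (TLam u) = abort_free u"
| "abort_free (Inl B u) = abort_free u"
| "abort_free (Inr A u) = abort_free u"
| "abort_free (Wit A m u) = abort_free u"
| "abort_free (Par A B u v) = (abort_free u \<and> abort_free v)"
| "abort_free (Efq P u) = abort_free u"
| "abort_free (Elim u \<xi>) = (abort_free u \<and> abort_free_e \<xi>)"
| "abort_free_e (EArg u) = abort_free u"
| "abort_free_e (EInd m) = True"
| "abort_free_e EFst = True"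
| "abort_free_e ESnd = True"
| "abort_free_e (ECase A u B v) = (abort_free u \<and> abort_free v)"
| "abort_free_e (EEx A u) = abort_free u"

subsection \<open>Typing\<close>

text \<open>
  \<open>typed n \<Gamma> t A\<close>: the term \<open>t\<close> has type \<open>A\<close> when the \<open>n\<close> innermost individual variables and the
  proof variables listed in \<open>\<Gamma>\<close> are bound around it.  \<open>elem_typed n \<Gamma> A \<xi> C\<close>: applying a term of
  type \<open>A\<close> to \<open>\<xi>\<close> yields a term of type \<open>C\<close>.

  The eigenvariable conditions are built in: the type of a free proof variable has no dangling
  index, and the types of the enclosing bound proof variables (in the rule for \<open>EEx\<close> also the type
  of the result) are shifted, so that the newly bound individual variable cannot occur in them.
\<close>

inductive typed ::
    "nat \<Rightarrow> ('f::symbol, 'p::symbol) fm list \<Rightarrow> ('f, 'p) pt \<Rightarrow> ('f, 'p) fm \<Rightarrow> bool"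
  and elem_typed ::
    "nat \<Rightarrow> ('f, 'p) fm list \<Rightarrow> ('f, 'p) fm \<Rightarrow> ('f, 'p) elem \<Rightarrow> ('f, 'p) fm \<Rightarrow> bool" where
  "wf_fm 0 A \<Longrightarrow> typed n \<Gamma> (PFree x A) A"
| "i < length \<Gamma> \<Longrightarrow> typed n \<Gamma> (PBnd i) (\<Gamma> ! i)"
| "wf_fm n A \<Longrightarrow> wf_fm n B \<Longrightarrow> typed n \<Gamma> (Abort A B) (Imp A B)"
| "typed n \<Gamma> u A \<Longrightarrow> typed n \<Gamma> v B \<Longrightarrow> typed n \<Gamma> (Pair u v) (And A B)"
| "wf_fm n A \<Longrightarrow> typed n (A # \<Gamma>) u B \<Longrightarrow> typed n \<Gamma> (Lam A u) (Imp A B)"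
| "typed (Suc n) (map (fsub shift) \<Gamma>) u A \<Longrightarrow> typed n \<Gamma> (TLam u) (All A)"
| "typed n \<Gamma> u A \<Longrightarrow> wf_fm n B \<Longrightarrow> typed n \<Gamma> (Inl B u) (Or A B)"
| "typed n \<Gamma> u B \<Longrightarrow> wf_fm n A \<Longrightarrow> typed n \<Gamma> (Inr A u) (Or A B)"
| "wf_fm (Suc n) A \<Longrightarrow> wf_tm n m \<Longrightarrow> typed n \<Gamma> u (fsub1 m A) \<Longrightarrow> typed n \<Gamma> (Wit A m u) (Ex A)"
| "wf_fm n A \<Longrightarrow> wf_fm n B \<Longrightarrow> typed n (Imp A B # \<Gamma>) u C \<Longrightarrow> typed n (Imp B A # \<Gamma>) v C \<Longrightarrow>
    typed n \<Gamma> (Par A B u v) C"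
| "atomic P \<Longrightarrow> wf_fm n P \<Longrightarrow> typed n \<Gamma> u Bot \<Longrightarrow> typed n \<Gamma> (Efq P u) P"
| "typed n \<Gamma> u A \<Longrightarrow> elem_typed n \<Gamma> A \<xi> C \<Longrightarrow> typed n \<Gamma> (Elim u \<xi>) C"
| "typed n \<Gamma> u A \<Longrightarrow> elem_typed n \<Gamma> (Imp A B) (EArg u) B"
| "wf_tm n m \<Longrightarrow> elem_typed n \<Gamma> (All A) (EInd m) (fsub1 m A)"
| "elem_typed n \<Gamma> (And A B) EFst A"
| "elem_typed n \<Gamma> (And A B) ESnd B"
| "wf_fm n A \<Longrightarrow> wf_fm n B \<Longrightarrow> typed n (A # \<Gamma>) u C \<Longrightarrow> typed n (B # \<Gamma>) v C \<Longrightarrow>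
    elem_typed n \<Gamma> (Or A B) (ECase A u B v) C"
| "wf_fm (Suc n) A \<Longrightarrow> wf_fm n C \<Longrightarrow> typed (Suc n) (A # map (fsub shift) \<Gamma>) u (fsub shift C) \<Longrightarrow>
    elem_typed n \<Gamma> (Ex A) (EEx A u) C"

definition LC_star :: "('f::symbol, 'p::symbol) pt \<Rightarrow> ('f, 'p) fm \<Rightarrow> bool" where
  "LC_star t A \<longleftrightarrow> typed 0 [] t A"

definition LC :: "('f::symbol, 'p::symbol) pt \<Rightarrow> ('f, 'p) fm \<Rightarrow> bool" where
  "LC t A \<longleftrightarrow> typed 0 [] t A \<and> abort_free t"

primrec stack_typed ::
    "('f::symbol, 'p::symbol) fm \<Rightarrow> ('f, 'p) stack \<Rightarrow> ('f, 'p) fm \<Rightarrow> bool" where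
  "stack_typed A [] D \<longleftrightarrow> A = D"
| "stack_typed A (\<xi> # \<sigma>) D \<longleftrightarrow> (\<exists>C. elem_typed 0 [] A \<xi> C \<and> stack_typed C \<sigma> D)"

section \<open>Head reduction\<close>

text \<open>Basic reductions of the form \<open>r \<xi> \<mapsto> h\<close>.  Shifting \<open>\<xi>\<close> ensures that \<open>a\<close> is not free in it.\<close>

inductive basic :: "('f, 'p) pt \<Rightarrow> ('f, 'p) pt \<Rightarrow> bool" where
  "basic (Elim (Lam A u) (EArg t)) (psub1 t u)"
| "basic (Elim (TLam u) (EInd m)) (isub1 m u)"
| "basic (Elim (Pair u v) EFst) u"
| "basic (Elim (Pair u v) ESnd) v"
| "basic (Elim (Inl B u) (ECase C t D s)) (psub1 u t)"
| "basic (Elim (Inr A u) (ECase C t D s)) (psub1 u s)"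
| "basic (Elim (Wit A m u) (EEx B v)) (psub1 u (isub1 m v))"
| "(\<nexists>m. \<xi> = EInd m) \<Longrightarrow>
    basic (Elim (Par A B u v) \<xi>) (Par A B (Elim u (pren_e Suc \<xi>)) (Elim v (pren_e Suc \<xi>)))"

text \<open>
  If \<open>t = fill K p\<close>, then \<open>p\<close> is a parallel process of \<open>t\<close>; the types of the
  communication variables bound around it are \<open>binders K\<close>, innermost first.
\<close>

datatype ('f, 'p) pctx =
    Hole
  | ParL "('f, 'p) fm" "('f, 'p) fm" "('f, 'p) pctx" "('f, 'p) pt"
  | ParR "('f, 'p) fm" "('f, 'p) fm" "('f, 'p) pt" "('f, 'p) pctx"

primrec fill :: "('f, 'p) pctx \<Rightarrow> ('f, 'p) pt \<Rightarrow> ('f, 'p) pt" where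
  "fill Hole t = t"
| "fill (ParL A B K v) t = Par A B (fill K t) v"
| "fill (ParR A B u K) t = Par A B u (fill K t)"

primrec binders :: "('f, 'p) pctx \<Rightarrow> ('f, 'p) fm list" where
  "binders Hole = []"
| "binders (ParL A B K v) = binders K @ [Imp A B]"
| "binders (ParR A B u K) = binders K @ [Imp B A]"

text \<open>
  The place of a starting symbol is recorded as the number of elementary processes to the left of
  the elementary process in which it lies.  This is enough to compare starting symbols, because at
  most one symbol of an elementary process (its head, or the opening parenthesis of its head redex)
  is a starting symbol.
\<close>

fun procs :: "('f, 'p) pt \<Rightarrow> nat" where
  "procs (Par A B u v) = procs u + procs v"
| "procs t = 1"

primrec offset :: "('f, 'p) pctx \<Rightarrow> nat" where
  "offset Hole = 0"
| "offset (ParL A B K v) = offset K"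
| "offset (ParR A B u K) = procs u + offset K"

text \<open>
  Let \<open>a\<close> be index 0 in \<open>u\<close>.  Then \<open>comm_occ u K s \<sigma>\<close> says that \<open>u\<close> is \<open>K[a s \<sigma>]\<close>.
\<close>

definition comm_occ ::
    "('f, 'p) pt \<Rightarrow> ('f, 'p) pctx \<Rightarrow> ('f, 'p) pt \<Rightarrow> ('f, 'p) stack \<Rightarrow> bool" where
  "comm_occ u K s \<sigma> \<longleftrightarrow> u = fill K (PBnd (length (binders K)) \<bullet> (EArg s # \<sigma>))"

definition leftmost_comm ::
    "('f, 'p) pt \<Rightarrow> ('f, 'p) pctx \<Rightarrow> ('f, 'p) pt \<Rightarrow> ('f, 'p) stack \<Rightarrow> bool" where
  "leftmost_comm u K s \<sigma> \<longleftrightarrow> comm_occ u K s \<sigma> \<and>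
    (\<forall>K' s' \<sigma>'. comm_occ u K' s' \<sigma>' \<longrightarrow> offset K \<le> offset K')"

text \<open>
  The term \<open>v[\<lambda>y\<^sup>B s/a]\<close>, with \<open>a\<close> index 0 in \<open>v\<close>, moved to a place with \<open>d\<close> further
  binders inside the scope of \<open>a\<close>, where \<open>s\<close> lives.
\<close>

definition transmit ::
    "nat \<Rightarrow> ('f, 'p) fm \<Rightarrow> ('f, 'p) pt \<Rightarrow> ('f, 'p) pt \<Rightarrow> ('f, 'p) pt" where
  "transmit d B s v = psub (case_nat (Lam B (pren Suc s)) (\<lambda>i. PBnd (Suc (d + i)))) v"

text \<open>
  \<open>head_redex \<Gamma> p k p'\<close>: the parallel process \<open>p\<close> has a head redex with starting symbol at place \<open>k\<close>
  and contracting it yields \<open>p'\<close>; \<open>\<Gamma>\<close> lists the types of the communication variables bound around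
  \<open>p\<close>.  A communication redex is contracted at its starting symbol.
\<close>

inductive head_redex ::
    "('f::symbol, 'p::symbol) fm list \<Rightarrow> ('f, 'p) pt \<Rightarrow> nat \<Rightarrow> ('f, 'p) pt \<Rightarrow> bool" where
  "basic h h' \<Longrightarrow> head_redex \<Gamma> (h \<bullet> \<sigma>) 0 (h' \<bullet> \<sigma>)"
| "typed 0 \<Gamma> (Abort A B \<bullet> (EArg u # \<sigma>)) D \<Longrightarrow> typed 0 \<Gamma> u D \<Longrightarrow>
    head_redex \<Gamma> (Abort A B \<bullet> (EArg u # \<sigma>)) 0 u"
| "leftmost_comm u K s \<sigma> \<Longrightarrow>
    head_redex \<Gamma> (Par A B u v) (offset K)
      (Par A B (fill K (transmit (length (binders K)) B s v)) v)"
| "(\<nexists>K s \<sigma>. comm_occ u K s \<sigma>) \<Longrightarrow> leftmost_comm v K s \<sigma> \<Longrightarrow>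
    head_redex \<Gamma> (Par A B u v) (procs u + offset K)
      (Par A B u (fill K (transmit (length (binders K)) A s u)))"

definition head_step :: "('f::symbol, 'p::symbol) pt \<Rightarrow> ('f, 'p) pt \<Rightarrow> bool" (infix "\<succ>" 50) where
  "t \<succ> t' \<longleftrightarrow> (\<exists>K p k p'.
     t = fill K p \<and> head_redex (binders K) p k p' \<and> t' = fill K p' \<and>
     (\<forall>K\<^sub>1 p\<^sub>1 k\<^sub>1 p\<^sub>1'. t = fill K\<^sub>1 p\<^sub>1 \<and> head_redex (binders K\<^sub>1) p\<^sub>1 k\<^sub>1 p\<^sub>1' \<longrightarrow>
        offset K + k \<le> offset K\<^sub>1 + k\<^sub>1))"

definition HN_star :: "('f::symbol, 'p::symbol) pt set" where
  "HN_star = {t. (\<exists>A. LC_star t A) \<and> \<not> (\<exists>s. s 0 = t \<and> (\<forall>i::nat. s i \<succ> s (Suc i)))}"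

section \<open>Realizability\<close>

primrec fsize :: "('f, 'p) fm \<Rightarrow> nat" where
  "fsize Bot = 0"
| "fsize (Atom P ms) = 0"
| "fsize (And A B) = Suc (fsize A + fsize B)"
| "fsize (Or A B) = Suc (fsize A + fsize B)"
| "fsize (Imp A B) = Suc (fsize A + fsize B)"
| "fsize (All A) = Suc (fsize A)"
| "fsize (Ex A) = Suc (fsize A)"

lemma fsize_fsub [simp]: "fsize (fsub \<rho> A) = fsize A"
  by (induction A arbitrary: \<rho>) auto

text \<open>
  \<open>stacks A\<close> is the set \<open>\<parallel>A\<parallel>\<close>.  Only well-typed expressions are considered, so a stack
  \<open>[x.u, y.v] \<cdot> \<sigma>\<close> or \<open>[(\<alpha>, x).v] \<cdot> \<sigma>\<close> must be applicable to terms of the given type, which is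
  expressed by \<open>stack_typed\<close>; for the other stacks this follows from the definition.
\<close>

function realizes :: "('f::symbol, 'p::symbol) pt \<Rightarrow> ('f, 'p) fm \<Rightarrow> bool" (infix "\<tturnstile>" 50)
  and stacks :: "('f, 'p) fm \<Rightarrow> ('f, 'p) stack set" where
  "t \<tturnstile> C \<longleftrightarrow> LC_star t C \<and> (\<forall>\<sigma>\<in>stacks C. t \<bullet> \<sigma> \<in> HN_star)"
| "stacks Bot = {[]}"
| "stacks (Atom P ms) = {[]}"
| "stacks (Imp A B) = {EArg u # \<sigma> |u \<sigma>. u \<tturnstile> A \<and> \<sigma> \<in> stacks B} \<union> {[]}"
| "stacks (And A B) = {EFst # \<sigma> |\<sigma>. \<sigma> \<in> stacks A} \<union> {ESnd # \<sigma> |\<sigma>. \<sigma> \<in> stacks B} \<union> {[]}"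
| "stacks (Or A B) =
    {ECase A u B v # \<sigma> |u v \<sigma>. (\<exists>D. stack_typed (Or A B) (ECase A u B v # \<sigma>) D) \<and>
       (\<forall>t. (t \<tturnstile> A \<longrightarrow> psub1 t u \<bullet> \<sigma> \<in> HN_star) \<and> (t \<tturnstile> B \<longrightarrow> psub1 t v \<bullet> \<sigma> \<in> HN_star))} \<union> {[]}"
| "stacks (All A) = {EInd m # \<sigma> |m \<sigma>. wf_tm 0 m \<and> \<sigma> \<in> stacks (fsub1 m A)} \<union> {[]}"
| "stacks (Ex A) =
    {EEx A v # \<sigma> |v \<sigma>. (\<exists>D. stack_typed (Ex A) (EEx A v # \<sigma>) D) \<and>
       (\<forall>m t. wf_tm 0 m \<longrightarrow> t \<tturnstile> fsub1 m A \<longrightarrow> psub1 t (isub1 m v) \<bullet> \<sigma> \<in> HN_star)} \<union> {[]}"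
  by pat_completeness auto
termination
  by (relation "measure (case_sum (\<lambda>(t, A). 2 * fsize A + 1) (\<lambda>A. 2 * fsize A))") auto

end

theory Submission
  imports Defs
begin

text \<open>
  Adequacy is proved by induction on typing derivations, for all closing substitutions by realizers.
  The case that matters is \<open>u \<parallel>\<^sub>a v\<close>.  After its stack has been distributed it becomes
  \<open>X \<parallel>\<^sub>a Y\<close> with \<open>X\<close> and \<open>Y\<close> of some type \<open>D\<close>.  Instead of a communication variable, give
  \<open>X\<close> the realizer \<open>t = \<lambda>x. \<A> (Y[\<lambda>y. x/a])\<close> of \<open>A \<rightarrow> B\<close>, where \<open>\<A> : D \<rightarrow> B\<close>.  A communication
  from \<open>X\<close> to \<open>Y\<close> is then simulated in \<open>X[t/a]\<close> by two head steps: the process \<open>t s \<sigma>\<close> has type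
  \<open>D\<close>, so \<open>\<A>\<close> discards \<open>\<sigma>\<close> and leaves \<open>Y[\<lambda>y. s/a]\<close>.  As \<open>X[t/a]\<close> halts, the left side of
  \<open>X \<parallel>\<^sub>a Y\<close> eventually becomes a normal \<open>X'\<close> without processes headed by \<open>a\<close>.  Since
  \<open>X'[s/a]\<close> is then normal for every abstraction \<open>s\<close>, the term \<open>\<lambda>x. \<A> (X'[\<lambda>y. x/a])\<close> realizes
  \<open>B \<rightarrow> A\<close>, and the same simulation in \<open>Y\<close> shows that the right side halts as well.
\<close>

section \<open>Substitution\<close>

text \<open>A communication rewrites only the side that sends: \<open>X\<close> takes in a copy of
  \<open>Y\<close>, and \<open>Y\<close> itself stays. Head reduction is leftmost, so the left side
  evolves against a fixed \<open>Y\<close> until it is exhausted, and then the right side evolves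
  against a fixed \<open>X'\<close>; each phase involves a single relay. The relay of
  \<open>Y\<close> realizes \<open>A \<rightarrow> B\<close> because for a realizer \<open>s\<close>
  of \<open>A\<close> the constant function \<lambda>y. s realizes \<open>B \<rightarrow> A\<close>,
  so the induction hypothesis for \<open>v\<close> makes the body halt, and a constant applied to a
  halting term halts on every stack. For \<open>X'\<close>, a mere reduct, normality takes the place
  of this argument. The constant fires only if the process has type \<open>D\<close>; this is why
  the stack is distributed before the relay is built, since \<open>D\<close> is then the type of
  every process. Leftmost redexes are awkward to follow through a substitution, so head reduction is
  recast as contraction at the least element of a set of places, and this set does not change when
  an abstraction replaces \<open>a\<close>.\<close>

lemma tsub_tsub: "tsub \<rho> (tsub \<rho>' m) = tsub (\<lambda>i. tsub \<rho> (\<rho>' i)) m"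
  by (induction m) auto

lemma tsub_Bnd [simp]: "tsub Bnd m = m"
  by (induction m) (auto intro: map_idI)

lemma up_i_simps [simp]: "up_i \<rho> 0 = Bnd 0" "up_i \<rho> (Suc i) = tsub shift (\<rho> i)"
  by (simp_all add: up_i_def)

lemma up_i_Bnd [simp]: "up_i Bnd = Bnd"
  by (auto simp: fun_eq_iff up_i_def shift_def split: nat.split)

lemma up_i_comp: "up_i (\<lambda>i. tsub \<rho> (\<rho>' i)) = (\<lambda>i. tsub (up_i \<rho>) (up_i \<rho>' i))"
proof
  fix i show "up_i (\<lambda>i. tsub \<rho> (\<rho>' i)) i = tsub (up_i \<rho>) (up_i \<rho>' i)"
    by (cases i) (simp_all add: tsub_tsub shift_def)
qed

lemma fsub_fsub: "fsub \<rho> (fsub \<rho>' A) = fsub (\<lambda>i. tsub \<rho> (\<rho>' i)) A"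
  by (induction A arbitrary: \<rho> \<rho>') (simp_all add: tsub_tsub up_i_comp)

lemma fsub_Bnd [simp]: "fsub Bnd A = A"
  by (induction A) (auto intro: map_idI)

section \<open>Composition laws for substitutions in proof terms\<close>

lemma isub_isub:
  fixes t :: "('f, 'p) pt" and \<xi> :: "('f, 'p) elem"
  shows "isub \<rho> (isub \<rho>' t) = isub (\<lambda>i. tsub \<rho> (\<rho>' i)) t"
    and "isub_e \<rho> (isub_e \<rho>' \<xi>) = isub_e (\<lambda>i. tsub \<rho> (\<rho>' i)) \<xi>"
  by (induction t and \<xi> arbitrary: \<rho> \<rho>' and \<rho> \<rho>' rule: pt.induct elem.induct)
     (simp_all add: tsub_tsub fsub_fsub up_i_comp)

lemma isub_Bnd [simp]:
  fixes t :: "('f, 'p) pt" and \<xi> :: "('f, 'p) elem"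
  shows "isub Bnd t = t"
    and "isub_e Bnd \<xi> = \<xi>"
  by (induction t and \<xi> rule: pt.induct elem.induct) simp_all

lemma up_r_simps [simp]: "up_r f 0 = 0" "up_r f (Suc i) = Suc (f i)"
  by (simp_all add: up_r_def)

lemma up_r_comp: "up_r (\<lambda>i. f (g i)) = (\<lambda>i. up_r f (up_r g i))"
  by (auto simp: fun_eq_iff up_r_def split: nat.split)

lemma up_p_simps [simp]: "up_p \<theta> 0 = PBnd 0" "up_p \<theta> (Suc i) = pren Suc (\<theta> i)"
  by (simp_all add: up_p_def)

lemma pren_pren:
  fixes t :: "('f, 'p) pt" and \<xi> :: "('f, 'p) elem"
  shows "pren f (pren g t) = pren (\<lambda>i. f (g i)) t"
    and "pren_e f (pren_e g \<xi>) = pren_e (\<lambda>i. f (g i)) \<xi>"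
  by (induction t and \<xi> arbitrary: f g and f g rule: pt.induct elem.induct)
     (simp_all add: up_r_comp)

lemma isub_pren:
  fixes t :: "('f, 'p) pt" and \<xi> :: "('f, 'p) elem"
  shows "isub \<rho> (pren f t) = pren f (isub \<rho> t)"
    and "isub_e \<rho> (pren_e f \<xi>) = pren_e f (isub_e \<rho> \<xi>)"
  by (induction t and \<xi> arbitrary: \<rho> f and \<rho> f rule: pt.induct elem.induct) simp_all

lemma up_p_comp_up_r: "up_p (\<lambda>i. \<theta> (f i)) = (\<lambda>i. up_p \<theta> (up_r f i))"
  by (auto simp: fun_eq_iff up_p_def up_r_def split: nat.split)

lemma psub_pren:
  fixes t :: "('f, 'p) pt" and \<xi> :: "('f, 'p) elem"
  shows "psub \<theta> (pren f t) = psub (\<lambda>i. \<theta> (f i)) t"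
    and "psub_e \<theta> (pren_e f \<xi>) = psub_e (\<lambda>i. \<theta> (f i)) \<xi>"
  by (induction t and \<xi> arbitrary: \<theta> f and \<theta> f rule: pt.induct elem.induct)
     (simp_all add: up_p_comp_up_r[symmetric] up_pi_def)

lemma up_p_pren: "up_p (\<lambda>i. pren f (\<theta> i)) = (\<lambda>i. pren (up_r f) (up_p \<theta> i))"
  by (auto simp: fun_eq_iff up_p_def pren_pren split: nat.split)

lemma pren_psub:
  fixes t :: "('f, 'p) pt" and \<xi> :: "('f, 'p) elem"
  shows "pren f (psub \<theta> t) = psub (\<lambda>i. pren f (\<theta> i)) t"
    and "pren_e f (psub_e \<theta> \<xi>) = psub_e (\<lambda>i. pren f (\<theta> i)) \<xi>"
  by (induction t and \<xi> arbitrary: \<theta> f and \<theta> f rule: pt.induct elem.induct)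
     (simp_all add: up_p_pren up_pi_def isub_pren)

lemma up_p_isub: "up_p (\<lambda>i. isub \<rho> (\<theta> i)) = (\<lambda>i. isub \<rho> (up_p \<theta> i))"
  by (auto simp: fun_eq_iff up_p_def isub_pren split: nat.split)

lemma up_pi_isub: "up_pi (\<lambda>i. isub \<rho> (\<theta> i)) = (\<lambda>i. isub (up_i \<rho>) (up_pi \<theta> i))"
  by (auto simp: fun_eq_iff up_pi_def isub_isub tsub_tsub shift_def)

text \<open>The range of \<open>\<theta>\<close> may itself mention individual indices, so
  \<open>\<rho>\<close> has to act on it as well. Under a binder of an individual variable both
  substitutions are lifted, and \<open>up_pi_isub\<close> exchanges the lifts.\<close>

lemma isub_psub:
  fixes t :: "('f, 'p) pt" and \<xi> :: "('f, 'p) elem"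
  shows "isub \<rho> (psub \<theta> t) = psub (\<lambda>i. isub \<rho> (\<theta> i)) (isub \<rho> t)"
    and "isub_e \<rho> (psub_e \<theta> \<xi>) = psub_e (\<lambda>i. isub \<rho> (\<theta> i)) (isub_e \<rho> \<xi>)"
  by (induction t and \<xi> arbitrary: \<theta> \<rho> and \<theta> \<rho> rule: pt.induct elem.induct)
     (simp_all add: up_p_isub up_pi_isub)

lemma up_p_psub: "up_p (\<lambda>i. psub \<theta> (\<theta>' i)) = (\<lambda>i. psub (up_p \<theta>) (up_p \<theta>' i))"
  by (auto simp: fun_eq_iff up_p_def psub_pren pren_psub split: nat.split)

lemma up_pi_psub: "up_pi (\<lambda>i. psub \<theta> (\<theta>' i)) = (\<lambda>i. psub (up_pi \<theta>) (up_pi \<theta>' i))"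
  by (auto simp: fun_eq_iff up_pi_def isub_psub)

lemma psub_psub:
  fixes t :: "('f, 'p) pt" and \<xi> :: "('f, 'p) elem"
  shows "psub \<theta> (psub \<theta>' t) = psub (\<lambda>i. psub \<theta> (\<theta>' i)) t"
    and "psub_e \<theta> (psub_e \<theta>' \<xi>) = psub_e (\<lambda>i. psub \<theta> (\<theta>' i)) \<xi>"
  by (induction t and \<xi> arbitrary: \<theta> \<theta>' and \<theta> \<theta>' rule: pt.induct elem.induct)
     (simp_all add: up_p_psub up_pi_psub)

lemma up_p_PBnd [simp]: "up_p PBnd = PBnd"
  by (auto simp: fun_eq_iff up_p_def split: nat.split)

lemma up_pi_PBnd [simp]: "up_pi PBnd = PBnd"
  by (simp add: fun_eq_iff up_pi_def)

lemma psub_PBnd [simp]: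
  fixes t :: "('f, 'p) pt" and \<xi> :: "('f, 'p) elem"
  shows "psub PBnd t = t"
    and "psub_e PBnd \<xi> = \<xi>"
  by (induction t and \<xi> rule: pt.induct elem.induct) simp_all

lemma pren_eq_psub: "pren f t = psub (\<lambda>i. PBnd (f i)) t" "pren_e f \<xi> = psub_e (\<lambda>i. PBnd (f i)) \<xi>"
  using pren_psub[of f PBnd] by simp_all

section \<open>Typing\<close>

lemmas typed_induct = typed_elem_typed.inducts

section \<open>Well-formedness of first-order expressions under substitution\<close>

lemma wf_tm_mono: "wf_tm n m \<Longrightarrow> n \<le> n' \<Longrightarrow> wf_tm n' m"
  by (induction m) auto

lemma wf_fm_mono: "wf_fm n A \<Longrightarrow> n \<le> n' \<Longrightarrow> wf_fm n' A"
  by (induction A arbitrary: n n') (auto intro: wf_tm_mono)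

lemma wf_tm_tsub: "wf_tm n m \<Longrightarrow> (\<And>i. i < n \<Longrightarrow> wf_tm n' (\<rho> i)) \<Longrightarrow> wf_tm n' (tsub \<rho> m)"
  by (induction m) auto

lemma wf_tm_shift: "wf_tm n m \<Longrightarrow> wf_tm (Suc n) (tsub shift m)"
  by (erule wf_tm_tsub) (simp add: shift_def)

lemma wf_up_i: "(\<And>i. i < n \<Longrightarrow> wf_tm n' (\<rho> i)) \<Longrightarrow> i < Suc n \<Longrightarrow> wf_tm (Suc n') (up_i \<rho> i)"
  by (cases i) (auto intro: wf_tm_shift)

lemma wf_fm_fsub: "wf_fm n A \<Longrightarrow> (\<And>i. i < n \<Longrightarrow> wf_tm n' (\<rho> i)) \<Longrightarrow> wf_fm n' (fsub \<rho> A)"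
proof (induction A arbitrary: n n' \<rho>)
  case (All A)
  then show ?case using wf_up_i[of n n' \<rho>] by simp
next
  case (Ex A)
  then show ?case using wf_up_i[of n n' \<rho>] by simp
qed (auto intro: wf_tm_tsub)

lemma wf_fm_shift: "wf_fm n A \<Longrightarrow> wf_fm (Suc n) (fsub shift A)"
  by (erule wf_fm_fsub) (simp add: shift_def)

lemma tsub_cong: "wf_tm n m \<Longrightarrow> \<forall>i<n. \<rho> i = \<rho>' i \<Longrightarrow> tsub \<rho> m = tsub \<rho>' m"
  by (induction m) auto

lemma up_i_cong: "\<forall>i<n. \<rho> i = \<rho>' i \<Longrightarrow> \<forall>i<Suc n. up_i \<rho> i = up_i \<rho>' i"
  by (auto simp: up_i_def split: nat.split)

lemma fsub_cong: "wf_fm n A \<Longrightarrow> \<forall>i<n. \<rho> i = \<rho>' i \<Longrightarrow> fsub \<rho> A = fsub \<rho>' A"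
proof (induction A arbitrary: n \<rho> \<rho>')
  case (All A)
  from All.IH[of "Suc n", OF _ up_i_cong[OF All.prems(2)]] All.prems(1) show ?case by simp
next
  case (Ex A)
  from Ex.IH[of "Suc n", OF _ up_i_cong[OF Ex.prems(2)]] Ex.prems(1) show ?case by simp
next
  case (Atom P ms)
  then show ?case using tsub_cong[of n _ \<rho> \<rho>'] by auto
qed (simp_all, metis+)

lemma tsub_closed: "wf_tm 0 m \<Longrightarrow> tsub \<rho> m = m"
  using tsub_cong[of 0 m \<rho> Bnd] by simp

lemma fsub_closed: "wf_fm 0 A \<Longrightarrow> fsub \<rho> A = A"
  using fsub_cong[of 0 A \<rho> Bnd] by simp

lemma fsub1_shift [simp]: "fsub1 m (fsub shift A) = A"
  by (simp add: fsub_fsub shift_def)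

lemma fsub_up_shift: "fsub (up_i \<rho>) (fsub shift A) = fsub shift (fsub \<rho> A)"
  by (simp add: fsub_fsub shift_def)

lemma fsub_fsub1: "fsub \<rho> (fsub1 m A) = fsub1 (tsub \<rho> m) (fsub (up_i \<rho>) A)"
proof -
  have "(\<lambda>i. tsub \<rho> (case_nat m Bnd i)) = (\<lambda>i. tsub (case_nat (tsub \<rho> m) Bnd) (up_i \<rho> i))"
    by (auto simp: fun_eq_iff tsub_tsub shift_def split: nat.split)
  then show ?thesis by (simp add: fsub_fsub)
qed

lemma atomic_fsub [simp]: "atomic (fsub \<rho> P) = atomic P"
  by (cases P) auto

text \<open>The eigenvariable conditions survive because they are expressed by shifted contexts, and
  \<open>fsub_up_shift\<close> lets a lifted substitution pass through a shift. Taking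
  \<open>Bnd\<close> for \<open>\<rho>\<close> gives weakening in the number of individual
  variables.\<close>

lemma typed_isub:
  "typed n \<Gamma> t A \<Longrightarrow> (\<And>i. i < n \<Longrightarrow> wf_tm n' (\<rho> i)) \<Longrightarrow>
     typed n' (map (fsub \<rho>) \<Gamma>) (isub \<rho> t) (fsub \<rho> A)"
  "elem_typed n \<Gamma> A \<xi> C \<Longrightarrow> (\<And>i. i < n \<Longrightarrow> wf_tm n' (\<rho> i)) \<Longrightarrow>
     elem_typed n' (map (fsub \<rho>) \<Gamma>) (fsub \<rho> A) (isub_e \<rho> \<xi>) (fsub \<rho> C)"
proof (induction arbitrary: n' \<rho> and n' \<rho> rule: typed_induct)
  case (2 i \<Gamma> n)
  then show ?case by (metis isub.simps(2) length_map nth_map typed_elem_typed.intros(2))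
next
  case (6 n \<Gamma> u A)
  have "typed (Suc n') (map (fsub (up_i \<rho>)) (map (fsub shift) \<Gamma>)) (isub (up_i \<rho>) u) (fsub (up_i \<rho>) A)"
    using 6 by (metis wf_up_i)
  then show ?case by (auto intro: typed_elem_typed.intros simp: fsub_up_shift comp_def)
next
  case (9 n A m \<Gamma> u)
  have "wf_fm (Suc n') (fsub (up_i \<rho>) A)" by (metis 9 wf_fm_fsub wf_up_i)
  with 9 show ?case by (auto intro!: typed_elem_typed.intros intro: wf_tm_tsub simp: fsub_fsub1)
next
  case (14 n m \<Gamma> A)
  then show ?case by (auto intro!: typed_elem_typed.intros intro: wf_tm_tsub simp: fsub_fsub1)
next
  case (18 n A C \<Gamma> u)
  have "typed (Suc n') (map (fsub (up_i \<rho>)) (A # map (fsub shift) \<Gamma>)) (isub (up_i \<rho>) u)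
     (fsub (up_i \<rho>) (fsub shift C))"
    using 18 by (metis wf_up_i)
  moreover have "wf_fm (Suc n') (fsub (up_i \<rho>) A)" by (metis 18 wf_fm_fsub wf_up_i)
  moreover have "wf_fm n' (fsub \<rho> C)" by (metis 18 wf_fm_fsub)
  ultimately show ?case by (auto intro!: typed_elem_typed.intros simp: fsub_up_shift comp_def)
qed (auto intro!: typed_elem_typed.intros intro: wf_fm_fsub simp: fsub_closed)

lemma typed_mono: "typed n \<Gamma> t A \<Longrightarrow> n \<le> n' \<Longrightarrow> typed n' \<Gamma> t A"
  using typed_isub(1)[of n \<Gamma> t A n' Bnd] by (simp add: map_idI)

definition ren_ok :: "(nat \<Rightarrow> nat) \<Rightarrow> 'a list \<Rightarrow> 'a list \<Rightarrow> bool" where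
  "ren_ok f \<Gamma> \<Delta> \<longleftrightarrow> (\<forall>i<length \<Gamma>. f i < length \<Delta> \<and> \<Delta> ! f i = \<Gamma> ! i)"

lemma ren_ok_up_r: "ren_ok f \<Gamma> \<Delta> \<Longrightarrow> ren_ok (up_r f) (A # \<Gamma>) (A # \<Delta>)"
  unfolding ren_ok_def using less_Suc_eq_0_disj by auto

lemma ren_ok_map: "ren_ok f \<Gamma> \<Delta> \<Longrightarrow> ren_ok f (map g \<Gamma>) (map g \<Delta>)"
  unfolding ren_ok_def by auto

lemma typed_pren:
  "typed n \<Gamma> t A \<Longrightarrow> ren_ok f \<Gamma> \<Delta> \<Longrightarrow> typed n \<Delta> (pren f t) A"
  "elem_typed n \<Gamma> A \<xi> C \<Longrightarrow> ren_ok f \<Gamma> \<Delta> \<Longrightarrow> elem_typed n \<Delta> A (pren_e f \<xi>) C"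
proof (induction arbitrary: f \<Delta> and f \<Delta> rule: typed_induct)
  case (2 i \<Gamma> n)
  then show ?case by (metis pren.simps(2) ren_ok_def typed_elem_typed.intros(2))
next
  case (18 n A C \<Gamma> u)
  then show ?case
    by (simp add: typed_elem_typed.intros(18) ren_ok_up_r ren_ok_map)
next
  case (10 n A B \<Gamma> u C v)
  then show ?case by (simp add: typed_elem_typed.intros(10) ren_ok_up_r)
next
  case (17 n A B \<Gamma> u C v)
  then show ?case by (simp add: typed_elem_typed.intros(17) ren_ok_up_r)
qed (auto intro!: typed_elem_typed.intros intro: ren_ok_up_r ren_ok_map)

lemma typed_weaken: "typed n \<Gamma> t A \<Longrightarrow> typed n (B # \<Gamma>) (pren Suc t) A"
  by (erule typed_pren) (simp add: ren_ok_def)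

lemma elem_typed_weaken: "elem_typed n \<Gamma> A \<xi> C \<Longrightarrow> elem_typed n (B # \<Gamma>) A (pren_e Suc \<xi>) C"
  by (erule typed_pren) (simp add: ren_ok_def)

definition sub_ok ::
    "nat \<Rightarrow> (nat \<Rightarrow> ('f::symbol, 'p::symbol) pt) \<Rightarrow> ('f, 'p) fm list \<Rightarrow> ('f, 'p) fm list \<Rightarrow> bool" where
  "sub_ok n \<theta> \<Gamma> \<Delta> \<longleftrightarrow> (\<forall>i<length \<Gamma>. typed n \<Delta> (\<theta> i) (\<Gamma> ! i))"

lemma sub_ok_up_p: "sub_ok n \<theta> \<Gamma> \<Delta> \<Longrightarrow> sub_ok n (up_p \<theta>) (A # \<Gamma>) (A # \<Delta>)"
  unfolding sub_ok_def
  using typed_elem_typed.intros(2)[of 0 "A # \<Delta>" n] by (auto simp: less_Suc_eq_0_disj typed_weaken)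

lemma sub_ok_up_pi:
  "sub_ok n \<theta> \<Gamma> \<Delta> \<Longrightarrow> sub_ok (Suc n) (up_pi \<theta>) (map (fsub shift) \<Gamma>) (map (fsub shift) \<Delta>)"
  unfolding sub_ok_def up_pi_def by (auto intro!: typed_isub simp: shift_def)

lemma typed_psub:
  "typed n \<Gamma> t A \<Longrightarrow> sub_ok n \<theta> \<Gamma> \<Delta> \<Longrightarrow> typed n \<Delta> (psub \<theta> t) A"
  "elem_typed n \<Gamma> A \<xi> C \<Longrightarrow> sub_ok n \<theta> \<Gamma> \<Delta> \<Longrightarrow> elem_typed n \<Delta> A (psub_e \<theta> \<xi>) C"
proof (induction arbitrary: \<theta> \<Delta> and \<theta> \<Delta> rule: typed_induct)
  case (2 i \<Gamma> n)
  then show ?case by (simp add: sub_ok_def)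
next
  case (18 n A C \<Gamma> u)
  then show ?case
    by (simp add: typed_elem_typed.intros(18) sub_ok_up_p sub_ok_up_pi)
next
  case (10 n A B \<Gamma> u C v)
  then show ?case by (simp add: typed_elem_typed.intros(10) sub_ok_up_p)
next
  case (17 n A B \<Gamma> u C v)
  then show ?case by (simp add: typed_elem_typed.intros(17) sub_ok_up_p)
qed (auto intro!: typed_elem_typed.intros intro: sub_ok_up_p sub_ok_up_pi)

lemma typed_psub1: "typed n (B # \<Gamma>) u A \<Longrightarrow> typed n \<Gamma> t B \<Longrightarrow> typed n \<Gamma> (psub1 t u) A"
  by (erule typed_psub)
     (auto simp: sub_ok_def less_Suc_eq_0_disj intro: typed_elem_typed.intros(2))

lemma typed_isub1:
  assumes "typed (Suc n) (map (fsub shift) \<Gamma>) u A" and "wf_tm n m"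
  shows "typed n \<Gamma> (isub1 m u) (fsub1 m A)"
proof -
  have "wf_tm n (case_nat m Bnd i)" if "i < Suc n" for i
    using that assms(2) by (cases i) simp_all
  from typed_isub(1)[where \<rho> = "case_nat m Bnd" and n' = n, OF assms(1) this] show ?thesis by (simp add: comp_def)
qed

section \<open>Substitutions act only through the indices that are in scope\<close>

lemma up_p_cong: "\<forall>i<k. \<theta> i = \<theta>' i \<Longrightarrow> \<forall>i<Suc k. up_p \<theta> i = up_p \<theta>' i"
  by (auto simp: up_p_def split: nat.split)

text \<open>The induction follows the typing derivation, since this records how many proof indices
  are in scope at each subterm. Two uses matter: closed terms are fixed by every substitution, and
  in a term whose only index is the communication variable, the value at index 0 determines the
  result.\<close>

lemma psub_cong:
  "typed n \<Gamma> t A \<Longrightarrow> \<forall>i<length \<Gamma>. \<theta> i = \<theta>' i \<Longrightarrow> psub \<theta> t = psub \<theta>' t"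
  "elem_typed n \<Gamma> A \<xi> C \<Longrightarrow> \<forall>i<length \<Gamma>. \<theta> i = \<theta>' i \<Longrightarrow> psub_e \<theta> \<xi> = psub_e \<theta>' \<xi>"
proof (induction arbitrary: \<theta> \<theta>' and \<theta> \<theta>' rule: typed_induct)
  case (5 n A \<Gamma> u B)
  have "psub (up_p \<theta>) u = psub (up_p \<theta>') u"
    by (rule "5.IH"(1), simp, rule up_p_cong, use "5.prems" in \<open>simp add: up_pi_def\<close>)
  then show ?case by simp
next
  case (6 n \<Gamma> u A)
  have "psub (up_pi \<theta>) u = psub (up_pi \<theta>') u"
    by (rule "6.IH"(1)) (use "6.prems" in \<open>simp add: up_pi_def\<close>)
  then show ?case by simp
next
  case (10 n A B \<Gamma> u C v)
  have "psub (up_p \<theta>) u = psub (up_p \<theta>') u"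
    by (rule "10.IH"(1), simp, rule up_p_cong, use "10.prems" in \<open>simp add: up_pi_def\<close>)
  moreover
  have "psub (up_p \<theta>) v = psub (up_p \<theta>') v"
    by (rule "10.IH"(2), simp, rule up_p_cong, use "10.prems" in \<open>simp add: up_pi_def\<close>)
  ultimately show ?case by simp
next
  case (17 n A B \<Gamma> u C v)
  have "psub (up_p \<theta>) u = psub (up_p \<theta>') u"
    by (rule "17.IH"(1), simp, rule up_p_cong, use "17.prems" in \<open>simp add: up_pi_def\<close>)
  moreover
  have "psub (up_p \<theta>) v = psub (up_p \<theta>') v"
    by (rule "17.IH"(2), simp, rule up_p_cong, use "17.prems" in \<open>simp add: up_pi_def\<close>)
  ultimately show ?case by simp
next
  case (18 n A C \<Gamma> u)
  have "psub (up_p (up_pi \<theta>)) u = psub (up_p (up_pi \<theta>')) u"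
    by (rule "18.IH"(1), simp, rule up_p_cong, use "18.prems" in \<open>simp add: up_pi_def\<close>)
  then show ?case by simp
qed (metis psub.simps psub_e.simps)+

lemma psub_closed:
  "typed n [] t A \<Longrightarrow> psub \<theta> t = t"
  "elem_typed n [] B \<xi> C \<Longrightarrow> psub_e \<theta> \<xi> = \<xi>"
  using psub_cong(1)[of n "[]" t A \<theta> PBnd] psub_cong(2)[of n "[]" B \<xi> C \<theta> PBnd] by simp_all

lemma pren_closed:
  "typed n [] t A \<Longrightarrow> pren f t = t"
  "elem_typed n [] B \<xi> C \<Longrightarrow> pren_e f \<xi> = \<xi>"
  by (simp_all only: pren_eq_psub) (erule psub_closed)+

lemma isub_cong:
  "typed n \<Gamma> t A \<Longrightarrow> \<forall>i<n. \<rho> i = \<rho>' i \<Longrightarrow> isub \<rho> t = isub \<rho>' t"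
  "elem_typed n \<Gamma> A \<xi> C \<Longrightarrow> \<forall>i<n. \<rho> i = \<rho>' i \<Longrightarrow> isub_e \<rho> \<xi> = isub_e \<rho>' \<xi>"
proof (induction arbitrary: \<rho> \<rho>' and \<rho> \<rho>' rule: typed_induct)
  case (6 n \<Gamma> u A)
  have "isub (up_i \<rho>) u = isub (up_i \<rho>') u"
    by (rule "6.IH"(1), rule up_i_cong, rule "6.prems")
  then show ?case by simp
next
  case (9 n A m \<Gamma> u)
  have "fsub (up_i \<rho>) A = fsub (up_i \<rho>') A"
    by (rule fsub_cong[OF 9(1)], rule up_i_cong, rule "9.prems")
  moreover have "tsub \<rho> m = tsub \<rho>' m"
    by (rule tsub_cong[OF 9(2) "9.prems"])
  moreover have "isub \<rho> u = isub \<rho>' u" by (rule "9.IH", rule "9.prems")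
  ultimately show ?case by simp
next
  case (18 n A C \<Gamma> u)
  have "fsub (up_i \<rho>) A = fsub (up_i \<rho>') A"
    by (rule fsub_cong[OF 18(1)], rule up_i_cong, rule "18.prems")
  moreover have "isub (up_i \<rho>) u = isub (up_i \<rho>') u"
    by (rule "18.IH"(1), rule up_i_cong, rule "18.prems")
  ultimately show ?case by simp
next
  case (14 n m \<Gamma> A)
  have "tsub \<rho> m = tsub \<rho>' m"
    by (rule tsub_cong[OF 14(1) "14.prems"])
  then show ?case by simp
next
  case (3 n A B \<Gamma>)
  then show ?case by (simp add: fsub_cong[OF _ "3.prems"])
next
  case (5 n A \<Gamma> u B)
  have "isub \<rho> u = isub \<rho>' u" by (rule "5.IH"(1), rule "5.prems")
  with 5 show ?case by (simp add: fsub_cong[OF _ "5.prems"])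
next
  case (7 n \<Gamma> u A B)
  have "isub \<rho> u = isub \<rho>' u" by (rule "7.IH"(1), rule "7.prems")
  with 7 show ?case by (simp add: fsub_cong[OF _ "7.prems"])
next
  case (8 n \<Gamma> u B A)
  have "isub \<rho> u = isub \<rho>' u" by (rule "8.IH"(1), rule "8.prems")
  with 8 show ?case by (simp add: fsub_cong[OF _ "8.prems"])
next
  case (10 n A B \<Gamma> u C v)
  have "isub \<rho> u = isub \<rho>' u" by (rule "10.IH"(1), rule "10.prems")
  moreover have "isub \<rho> v = isub \<rho>' v" by (rule "10.IH"(2), rule "10.prems")
  ultimately show ?case using 10 by (simp add: fsub_cong[OF _ "10.prems"])
next
  case (11 P n \<Gamma> u)
  have "isub \<rho> u = isub \<rho>' u" by (rule "11.IH"(1), rule "11.prems")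
  with 11 show ?case by (simp add: fsub_cong[OF _ "11.prems"])
next
  case (17 n A B \<Gamma> u C v)
  have "isub \<rho> u = isub \<rho>' u" by (rule "17.IH"(1), rule "17.prems")
  moreover have "isub \<rho> v = isub \<rho>' v" by (rule "17.IH"(2), rule "17.prems")
  ultimately show ?case using 17 by (simp add: fsub_cong[OF _ "17.prems"])
next
  case (4 n \<Gamma> u A v B)
  have "isub \<rho> u = isub \<rho>' u" by (rule "4.IH"(1), rule "4.prems")
  moreover have "isub \<rho> v = isub \<rho>' v" by (rule "4.IH"(2), rule "4.prems")
  ultimately show ?case by simp
next
  case (12 n \<Gamma> u A \<xi> C)
  have "isub \<rho> u = isub \<rho>' u" by (rule "12.IH"(1), rule "12.prems")
  moreover have "isub_e \<rho> \<xi> = isub_e \<rho>' \<xi>" by (rule "12.IH"(2), rule "12.prems")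
  ultimately show ?case by simp
next
  case (13 n \<Gamma> u A B)
  have "isub \<rho> u = isub \<rho>' u" by (rule "13.IH"(1), rule "13.prems")
  then show ?case by simp
qed simp_all

lemma isub_closed:
  "typed 0 \<Gamma> t A \<Longrightarrow> isub \<rho> t = t"
  using isub_cong(1)[of 0 \<Gamma> t A \<rho> Bnd] by simp

lemma wf_fm_fsub1: "wf_fm (Suc n) A \<Longrightarrow> wf_tm n m \<Longrightarrow> wf_fm n (fsub1 m A)"
  by (erule wf_fm_fsub) (auto simp: less_Suc_eq_0_disj)

text \<open>Needed for the type \<open>D\<close> of the composed processes: the constant
  \<open>Abort D B\<close> is typable only if \<open>D\<close> is a formula.\<close>

lemma typed_wf:
  "typed n \<Gamma> t A \<Longrightarrow> \<forall>B\<in>set \<Gamma>. wf_fm n B \<Longrightarrow> wf_fm n A"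
  "elem_typed n \<Gamma> A \<xi> C \<Longrightarrow> \<forall>B\<in>set \<Gamma>. wf_fm n B \<Longrightarrow> wf_fm n A \<Longrightarrow> wf_fm n C"
  by (induction rule: typed_induct) (auto intro: wf_fm_mono wf_fm_shift wf_fm_fsub1)

section \<open>Inversion and uniqueness of types\<close>

inductive_cases typed_PFreeE: "typed n \<Gamma> (PFree x B) A"
inductive_cases typed_PBndE: "typed n \<Gamma> (PBnd i) A"
inductive_cases typed_AbortE: "typed n \<Gamma> (Abort B C) A"
inductive_cases typed_PairE: "typed n \<Gamma> (Pair u v) A"
inductive_cases typed_LamE: "typed n \<Gamma> (Lam B u) A"
inductive_cases typed_TLamE: "typed n \<Gamma> (TLam u) A"
inductive_cases typed_InlE: "typed n \<Gamma> (Inl B u) A"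
inductive_cases typed_InrE: "typed n \<Gamma> (Inr B u) A"
inductive_cases typed_WitE: "typed n \<Gamma> (Wit B m u) A"
inductive_cases typed_ParE: "typed n \<Gamma> (Par B C u v) A"
inductive_cases typed_EfqE: "typed n \<Gamma> (Efq P u) A"
inductive_cases typed_ElimE: "typed n \<Gamma> (Elim u \<xi>) A"
inductive_cases elem_typed_EArgE: "elem_typed n \<Gamma> A (EArg u) C"
inductive_cases elem_typed_EIndE: "elem_typed n \<Gamma> A (EInd m) C"
inductive_cases elem_typed_EFstE: "elem_typed n \<Gamma> A EFst C"
inductive_cases elem_typed_ESndE: "elem_typed n \<Gamma> A ESnd C"
inductive_cases elem_typed_ECaseE: "elem_typed n \<Gamma> A (ECase B u C v) D"
inductive_cases elem_typed_EExE: "elem_typed n \<Gamma> A (EEx B u) D"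

lemma fsub_shift_inj: "fsub shift A = fsub shift B \<Longrightarrow> A = B"
  using fsub1_shift by metis

text \<open>A constant fires according to a comparison of types. Uniqueness makes this comparison
  meaningful, both for subject reduction and for showing that substitution neither creates nor
  destroys such a redex.\<close>

lemma typed_unique:
  "typed n \<Gamma> t A \<Longrightarrow> typed n \<Gamma> t B \<Longrightarrow> A = B"
  "elem_typed n \<Gamma> A \<xi> C \<Longrightarrow> elem_typed n \<Gamma> A \<xi> D \<Longrightarrow> C = D"
proof (induction arbitrary: B and D rule: typed_induct)
  case 1
  from "1.prems" show ?case by (rule typed_PFreeE) simp
next
  case 2
  from "2.prems" show ?case by (rule typed_PBndE) simp
next
  case 3
  from "3.prems" show ?case by (rule typed_AbortE) simp
next
  case 4
  from "4.prems" show ?case by (rule typed_PairE) (blast dest: "4.IH")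
next
  case 5
  from "5.prems" show ?case by (rule typed_LamE) (blast dest: "5.IH")
next
  case 6
  from "6.prems" show ?case by (rule typed_TLamE) (blast dest: "6.IH")
next
  case 7
  from "7.prems" show ?case by (rule typed_InlE) (blast dest: "7.IH")
next
  case 8
  from "8.prems" show ?case by (rule typed_InrE) (blast dest: "8.IH")
next
  case 9
  from "9.prems" show ?case by (rule typed_WitE) simp
next
  case 10
  from "10.prems" show ?case by (rule typed_ParE) (blast dest: "10.IH")
next
  case 11
  from "11.prems" show ?case by (rule typed_EfqE) simp
next
  case 12
  from "12.prems" show ?case by (rule typed_ElimE) (blast dest: "12.IH")
next
  case 13
  from "13.prems" show ?case by (rule elem_typed_EArgE) simp
next
  case 14
  from "14.prems" show ?case by (rule elem_typed_EIndE) simp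
next
  case 15
  from "15.prems" show ?case by (rule elem_typed_EFstE) simp
next
  case 16
  from "16.prems" show ?case by (rule elem_typed_ESndE) simp
next
  case 17
  from "17.prems" show ?case by (rule elem_typed_ECaseE) (blast dest: "17.IH")
next
  case 18
  from "18.prems" show ?case by (rule elem_typed_EExE) (blast dest: "18.IH" intro: fsub_shift_inj)
qed

section \<open>Instantiation of named variables\<close>

lemma tinst_closed: "\<forall>r\<in>ran \<mu>. wf_tm 0 r \<Longrightarrow> wf_tm n m \<Longrightarrow> wf_tm n (tinst \<mu> m)"
  by (induction m) (auto split: option.split simp: ran_def intro: wf_tm_mono[of 0])

lemma wf_fm_finst: "\<forall>r\<in>ran \<mu>. wf_tm 0 r \<Longrightarrow> wf_fm n A \<Longrightarrow> wf_fm n (finst \<mu> A)"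
  by (induction A arbitrary: n) (auto simp: tinst_closed)

lemma tinst_tsub:
  "\<forall>r\<in>ran \<mu>. wf_tm 0 r \<Longrightarrow> tinst \<mu> (tsub \<rho> m) = tsub (\<lambda>i. tinst \<mu> (\<rho> i)) (tinst \<mu> m)"
  by (induction m) (auto split: option.split simp: ran_def tsub_closed)

lemma tinst_shift [simp]: "tinst \<mu> (shift i) = shift i"
  by (simp add: shift_def)

lemma up_i_tinst:
  assumes "\<forall>r\<in>ran \<mu>. wf_tm 0 r"
  shows "(\<lambda>i. tinst \<mu> (up_i \<rho> i)) = up_i (\<lambda>i. tinst \<mu> (\<rho> i))"
proof
  fix i show "tinst \<mu> (up_i \<rho> i) = up_i (\<lambda>i. tinst \<mu> (\<rho> i)) i"
    by (cases i) (simp_all add: tinst_tsub[OF assms])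
qed

lemma finst_fsub:
  "\<forall>r\<in>ran \<mu>. wf_tm 0 r \<Longrightarrow> finst \<mu> (fsub \<rho> A) = fsub (\<lambda>i. tinst \<mu> (\<rho> i)) (finst \<mu> A)"
  by (induction A arbitrary: \<rho>) (auto simp: tinst_tsub up_i_tinst)

lemma finst_fsub1:
  assumes "\<forall>r\<in>ran \<mu>. wf_tm 0 r"
  shows "finst \<mu> (fsub1 m A) = fsub1 (tinst \<mu> m) (finst \<mu> A)"
proof -
  have "(\<lambda>i. tinst \<mu> (case_nat m Bnd i)) = case_nat (tinst \<mu> m) Bnd"
    by (auto split: nat.split)
  then show ?thesis by (simp add: finst_fsub[OF assms])
qed

lemma atomic_finst [simp]: "atomic (finst \<mu> P) = atomic P"
  by (cases P) auto

lemma typed_inst: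
  assumes "\<forall>r\<in>ran \<mu>. wf_tm 0 r"
  shows "typed n \<Gamma> t A \<Longrightarrow> typed n (map (finst \<mu>) \<Gamma>) (inst \<mu> t) (finst \<mu> A)"
    and "elem_typed n \<Gamma> A \<xi> C \<Longrightarrow>
      elem_typed n (map (finst \<mu>) \<Gamma>) (finst \<mu> A) (inst_e \<mu> \<xi>) (finst \<mu> C)"
proof (induction rule: typed_induct)
  case (2 i \<Gamma> n)
  then show ?case by (metis inst.simps(2) length_map nth_map typed_elem_typed.intros(2))
next
  case (6 n \<Gamma> u A)
  then show ?case by (auto intro!: typed_elem_typed.intros simp: finst_fsub[OF assms] comp_def)
next
  case (18 n A C \<Gamma> u)
  then show ?case
    by (auto intro!: typed_elem_typed.intros wf_fm_finst assms simp: finst_fsub[OF assms] comp_def)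
qed (auto intro!: typed_elem_typed.intros
       simp: finst_fsub1[OF assms] wf_fm_finst[OF assms] tinst_closed[OF assms])

lemma free_vars_inst:
  "free_vars (inst \<mu> t) = map_prod id (finst \<mu>) ` free_vars t"
  "free_vars_e (inst_e \<mu> \<xi>) = map_prod id (finst \<mu>) ` free_vars_e \<xi>" for t :: "('f, 'p) pt" and \<xi> :: "('f, 'p) elem"
  by (induction t and \<xi> rule: pt.induct elem.induct) auto

lemma typed_pinst:
  assumes "\<And>x A t. \<eta> (x, A) = Some t \<Longrightarrow> typed 0 [] t A"
  shows "typed n \<Gamma> t A \<Longrightarrow> typed n \<Gamma> (pinst \<eta> t) A"
    and "elem_typed n \<Gamma> A \<xi> C \<Longrightarrow> elem_typed n \<Gamma> A (pinst_e \<eta> \<xi>) C"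
proof (induction rule: typed_induct)
  case (1 A n \<Gamma> x)
  show ?case
  proof (cases "\<eta> (x, A)")
    case None
    with 1 show ?thesis by (simp add: typed_elem_typed.intros)
  next
    case (Some t)
    then have t: "typed n [] t A" using assms typed_mono by blast
    \<comment> \<open>The identity renaming serves as weakening from the empty context to
      \<open>\<Gamma>\<close>; it vanishes again because \<open>t\<close> is closed.\<close>
    then have "typed n \<Gamma> (pren (\<lambda>i. i) t) A" by (rule typed_pren) (simp add: ren_ok_def)
    with Some t show ?thesis by (simp add: pren_closed)
  qed
qed (auto intro!: typed_elem_typed.intros)

section \<open>Head reduction\<close>

definition nonelim :: "('f, 'p) pt \<Rightarrow> bool" where
  "nonelim t \<longleftrightarrow> (\<forall>u \<xi>. t \<noteq> Elim u \<xi>)"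

definition nonpar :: "('f, 'p) pt \<Rightarrow> bool" where
  "nonpar t \<longleftrightarrow> (\<forall>A B u v. t \<noteq> Par A B u v)"

lemma app_snoc: "t \<bullet> (\<sigma> @ [\<xi>]) = Elim (t \<bullet> \<sigma>) \<xi>"
  by simp

text \<open>Stripping last stack elements in parallel must end on both sides at the same time, since
  neither head is an \<open>Elim\<close>. Hence the kind of head redex is determined by the head and
  the first stack element, and the different kinds exclude each other.\<close>

lemma spine_unique:
  "nonelim r \<Longrightarrow> nonelim r' \<Longrightarrow> r \<bullet> \<sigma> = r' \<bullet> \<sigma>' \<Longrightarrow> r = r' \<and> \<sigma> = \<sigma>'"
proof (induction \<sigma> arbitrary: \<sigma>' rule: rev_induct)
  case Nil
  then show ?case by (cases \<sigma>' rule: rev_cases) (auto simp: nonelim_def)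
next
  case (snoc \<xi> \<sigma>)
  then show ?case by (cases \<sigma>' rule: rev_cases) (auto simp: nonelim_def)
qed

lemma spine_exists:
  fixes t :: "('f, 'p) pt"
  obtains r \<sigma> where "nonelim r" "t = r \<bullet> \<sigma>"
proof -
  have "\<exists>r \<sigma>. nonelim r \<and> t = r \<bullet> \<sigma>"
  proof (induction t rule: measure_induct_rule[where f = size])
    case (less t)
    show ?case
    proof (cases "nonelim t")
      case True
      then show ?thesis by (metis foldl_Nil)
    next
      case False
      then obtain u \<xi> where t: "t = Elim u \<xi>" unfolding nonelim_def by blast
      then obtain r \<sigma> where "nonelim r" "u = r \<bullet> \<sigma>" using less[of u] by auto
      with t show ?thesis by (metis app_snoc)
    qed
  qed
  with that show ?thesis by blast
qed

lemma nonpar_app: "nonpar (t \<bullet> (\<xi> # \<sigma>))"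
  by (cases \<sigma> rule: rev_cases) (auto simp: nonpar_def)

lemma basic_ElimE:
  assumes "basic h h'"
  obtains r \<xi> where "h = Elim r \<xi>" "nonelim r" "\<And>i. r \<noteq> PBnd i" "\<And>A B. r \<noteq> Abort A B"
  using assms by cases (auto simp: nonelim_def)

inductive_simps basic_Elim: "basic (Elim r \<xi>) h"

lemma basic_deterministic: "basic h h1 \<Longrightarrow> basic h h2 \<Longrightarrow> h1 = h2"
  by (erule basic.cases; auto simp: basic_Elim)

lemma basic_app_unique:
  assumes "basic h h'" "basic k k'" "h \<bullet> \<sigma> = k \<bullet> \<tau>"
  shows "h = k \<and> h' = k' \<and> \<sigma> = \<tau>"
proof -
  obtain r \<xi> where h: "h = Elim r \<xi>" "nonelim r" using basic_ElimE[OF assms(1)] by metis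
  obtain r' \<xi>' where k: "k = Elim r' \<xi>'" "nonelim r'" using basic_ElimE[OF assms(2)] by metis
  have "r \<bullet> (\<xi> # \<sigma>) = r' \<bullet> (\<xi>' # \<tau>)" using assms(3) h k by simp
  with spine_unique[OF h(2) k(2)] have "r = r'" "\<xi> # \<sigma> = \<xi>' # \<tau>" by blast+
  with h k assms basic_deterministic show ?thesis by auto
qed

section \<open>Places of redexes, and contraction at an arbitrary place\<close>

text \<open>
  The third disjunct counts a process headed by a bound communication variable even when it is not
  the leftmost one for that variable.  This does not change the least place of a redex, but makes
  the set of places compatible with substitution and with changes further to the right.
\<close>

definition active :: "('f::symbol, 'p::symbol) fm list \<Rightarrow> ('f, 'p) pt \<Rightarrow> bool" where
  "active \<Gamma> p \<longleftrightarrow> (\<exists>h h' \<sigma>. basic h h' \<and> p = h \<bullet> \<sigma>) \<or>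
     (\<exists>A B u \<sigma> D. p = Abort A B \<bullet> (EArg u # \<sigma>) \<and> typed 0 \<Gamma> p D \<and> typed 0 \<Gamma> u D) \<or>
     (\<exists>i s \<sigma>. i < length \<Gamma> \<and> p = PBnd i \<bullet> (EArg s # \<sigma>))"

fun places :: "('f::symbol, 'p::symbol) fm list \<Rightarrow> ('f, 'p) pt \<Rightarrow> nat set" where
  "places \<Gamma> (Par A B u v) = places (Imp A B # \<Gamma>) u \<union> (+) (procs u) ` places (Imp B A # \<Gamma>) v"
| "places \<Gamma> t = (if active \<Gamma> t then {0} else {})"

lemma places_nonpar: "nonpar t \<Longrightarrow> places \<Gamma> t = (if active \<Gamma> t then {0} else {})"
  by (cases t) (simp_all add: nonpar_def)

lemma active_nonpar:
  assumes "active \<Gamma> t"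
  shows "nonpar t"
proof -
  have "\<exists>r \<xi> \<sigma>. t = r \<bullet> (\<xi> # \<sigma>)"
    using assms unfolding active_def by (metis basic_ElimE foldl_Cons)
  then show ?thesis using nonpar_app by blast
qed

text \<open>Closed under parallel contexts by its own rules, and a communication may take place at
  any occurrence headed by the variable. Being leftmost is left to a separate condition on
  \<open>places\<close>; this makes the relation fit for induction and for substitution.\<close>

inductive red :: "('f::symbol, 'p::symbol) fm list \<Rightarrow> ('f, 'p) pt \<Rightarrow> nat \<Rightarrow> ('f, 'p) pt \<Rightarrow> bool" where
  red_basic: "basic h h' \<Longrightarrow> red \<Gamma> (h \<bullet> \<sigma>) 0 (h' \<bullet> \<sigma>)"
| red_abort: "typed 0 \<Gamma> (Abort A B \<bullet> (EArg u # \<sigma>)) D \<Longrightarrow> typed 0 \<Gamma> u D \<Longrightarrow>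
    red \<Gamma> (Abort A B \<bullet> (EArg u # \<sigma>)) 0 u"
| red_left: "red (Imp A B # \<Gamma>) u n u' \<Longrightarrow> red \<Gamma> (Par A B u v) n (Par A B u' v)"
| red_right: "red (Imp B A # \<Gamma>) v n v' \<Longrightarrow> red \<Gamma> (Par A B u v) (procs u + n) (Par A B u v')"
| red_comm_left: "comm_occ u K s \<sigma> \<Longrightarrow>
    red \<Gamma> (Par A B u v) (offset K) (Par A B (fill K (transmit (length (binders K)) B s v)) v)"
| red_comm_right: "comm_occ v K s \<sigma> \<Longrightarrow>
    red \<Gamma> (Par A B u v) (procs u + offset K)
      (Par A B u (fill K (transmit (length (binders K)) A s u)))"

lemma procs_pos: "0 < procs t"
  by (induction t rule: procs.induct) auto

lemma offset_less: "offset K < procs (fill K p)"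
  by (induction K) (auto simp: procs_pos trans_less_add1)

lemma places_fill:
  "active (binders K @ \<Gamma>) p \<Longrightarrow> offset K \<in> places \<Gamma> (fill K p)"
  by (induction K arbitrary: \<Gamma>) (auto simp: places_nonpar active_nonpar)

lemma places_comm_occ:
  assumes "comm_occ u K s \<sigma>"
  shows "offset K \<in> places (A # \<Gamma>) u"
proof -
  have "length (binders K) < length (binders K @ A # \<Gamma>)" by simp
  then have "active (binders K @ A # \<Gamma>) (PBnd (length (binders K)) \<bullet> (EArg s # \<sigma>))"
    unfolding active_def by blast
  from places_fill[OF this] show ?thesis using assms unfolding comm_occ_def by simp
qed

lemma red_places: "red \<Gamma> t n t' \<Longrightarrow> n \<in> places \<Gamma> t"
proof (induction rule: red.induct)
  case (red_basic h h' \<Gamma> \<sigma>)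
  then have "active \<Gamma> (h \<bullet> \<sigma>)" by (auto simp: active_def)
  then show ?case by (simp add: places_nonpar active_nonpar)
next
  case (red_abort \<Gamma> A B u \<sigma> D)
  then have "active \<Gamma> (Abort A B \<bullet> (EArg u # \<sigma>))" unfolding active_def by blast
  then show ?case by (simp add: places_nonpar active_nonpar)
qed (auto simp: places_comm_occ)

lemma red_fill:
  "red (binders K @ \<Gamma>) p k p' \<Longrightarrow> red \<Gamma> (fill K p) (offset K + k) (fill K p')"
proof (induction K arbitrary: \<Gamma>)
  case (ParL A B K v)
  then show ?case by (simp add: red_left)
next
  case (ParR A B u K)
  then show ?case by (simp add: red_right add.assoc)
qed simp

lemma head_redex_red: "head_redex \<Gamma> p k p' \<Longrightarrow> red \<Gamma> p k p'"
proof (induction rule: head_redex.induct)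
  case (3 u K s \<sigma> \<Gamma> A B v)
  then have "comm_occ u K s \<sigma>" by (simp add: leftmost_comm_def)
  then show ?case by (rule red_comm_left)
next
  case (4 u v K s \<sigma> \<Gamma> A B)
  then have "comm_occ v K s \<sigma>" by (simp add: leftmost_comm_def)
  then show ?case by (rule red_comm_right)
qed (rule red_basic, assumption, rule red_abort)

section \<open>Head steps as contractions at the least place\<close>

lemma leftmost_comm_exists:
  assumes "comm_occ u K s \<sigma>"
  obtains K' s' \<sigma>' where "leftmost_comm u K' s' \<sigma>'" "offset K' \<le> offset K"
proof -
  define P where "P n \<longleftrightarrow> (\<exists>K s \<sigma>. comm_occ u K s \<sigma> \<and> offset K = n)" for n
  have "P (offset K)" using assms unfolding P_def by blast
  then have "P (Least P)" by (rule LeastI)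
  then obtain K' s' \<sigma>' where *: "comm_occ u K' s' \<sigma>'" "offset K' = Least P"
    unfolding P_def by blast
  have "offset K' \<le> offset K1" if "comm_occ u K1 s1 \<sigma>1" for K1 s1 \<sigma>1
  proof -
    have "P (offset K1)" using that unfolding P_def by blast
    then show ?thesis using *(2) Least_le by metis
  qed
  with * assms that show ?thesis unfolding leftmost_comm_def by blast
qed

text \<open>The bound is an inequality because a communication is contracted at its leftmost
  occurrence, possibly to the left of \<open>m\<close>. The second disjunct covers a process headed
  by a variable bound outside \<open>t\<close>, which becomes a redex only together with the
  enclosing \<open>Par\<close>; for empty \<open>\<Gamma>\<close> it disappears.\<close>

definition redex_below :: "('f::symbol, 'p::symbol) fm list \<Rightarrow> ('f, 'p) pt \<Rightarrow> nat \<Rightarrow> bool" where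
  "redex_below \<Gamma> t m \<longleftrightarrow>
    (\<exists>K p k p'. t = fill K p \<and> head_redex (binders K @ \<Gamma>) p k p' \<and> offset K + k \<le> m) \<or>
    (\<exists>K i s \<sigma>. t = fill K (PBnd (length (binders K) + i) \<bullet> (EArg s # \<sigma>)) \<and> i < length \<Gamma> \<and>
       offset K = m)"

lemma places_redex_nonpar:
  assumes "m \<in> places \<Gamma> t" and "nonpar t"
  shows "redex_below \<Gamma> t m"
proof -
  from assms have m: "m = 0" and "active \<Gamma> t" by (simp_all add: places_nonpar split: if_splits)
  then consider p' where "head_redex \<Gamma> t 0 p'" | i s \<sigma> where "i < length \<Gamma>" "t = PBnd i \<bullet> (EArg s # \<sigma>)"
    unfolding active_def by (metis head_redex.intros(1,2))
  then show ?thesis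
  proof cases
    case 1
    then have "t = fill Hole t \<and> head_redex (binders Hole @ \<Gamma>) t 0 p' \<and> offset Hole + 0 \<le> m" by simp
    then show ?thesis unfolding redex_below_def by blast
  next
    case 2
    then have "t = fill Hole (PBnd (length (binders Hole) + i) \<bullet> (EArg s # \<sigma>)) \<and> i < length \<Gamma> \<and>
       offset Hole = m" using m by simp
    then show ?thesis unfolding redex_below_def by blast
  qed
qed

text \<open>At a \<open>Par\<close>, a process of a component headed by index 0 turns into an
  occurrence of the variable bound there, hence into a communication redex. A process headed by a
  larger index is passed outwards with its index lowered by one.\<close>

lemma places_redex:
  fixes t :: "('f::symbol, 'p::symbol) pt"
  shows "m \<in> places \<Gamma> t \<Longrightarrow> redex_below \<Gamma> t m"
proof (induction t arbitrary: \<Gamma> m rule: procs.induct)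
  case (1 A B u v)
  have left: "\<exists>K' p k p'. Par A B u v = fill K' p \<and> head_redex (binders K' @ \<Gamma>) p k p' \<and>
      offset K' + k \<le> m"
    if "comm_occ u K s \<sigma>" "offset K \<le> m" for K s \<sigma>
  proof -
    from leftmost_comm_exists[OF that(1)] obtain K' s' \<sigma>' where
      "leftmost_comm u K' s' \<sigma>'" "offset K' \<le> offset K" by metis
    with that have "Par A B u v = fill Hole (Par A B u v) \<and>
      head_redex (binders Hole @ \<Gamma>) (Par A B u v) (offset K')
      (Par A B (fill K' (transmit (length (binders K')) B s' v)) v) \<and> offset Hole + offset K' \<le> m"
      by (auto intro: head_redex.intros)
    then show ?thesis unfolding redex_below_def by blast
  qed
  from "1.prems" consider "m \<in> places (Imp A B # \<Gamma>) u"
    | m' where "m = procs u + m'" "m' \<in> places (Imp B A # \<Gamma>) v" by auto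
  then show ?case
  proof cases
    case 1
    from "1.IH"(1)[OF this] show ?thesis unfolding redex_below_def[of _ u]
    proof (elim disjE exE conjE)
      fix K p k p'
      assume "u = fill K p" "head_redex (binders K @ Imp A B # \<Gamma>) p k p'" "offset K + k \<le> m"
      then have "Par A B u v = fill (ParL A B K v) p \<and>
        head_redex (binders (ParL A B K v) @ \<Gamma>) p k p' \<and> offset (ParL A B K v) + k \<le> m" by simp
      then show ?thesis unfolding redex_below_def by blast
    next
      fix K i s \<sigma>
      assume a: "u = fill K (PBnd (length (binders K) + i) \<bullet> (EArg s # \<sigma>))"
        "i < length (Imp A B # \<Gamma>)" "offset K = m"
      show ?thesis
      proof (cases i)
        case 0
        with a have "comm_occ u K s \<sigma>" by (simp add: comm_occ_def)
        from left[OF this] a show ?thesis unfolding redex_below_def by simp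
      next
        case (Suc j)
        with a have "Par A B u v = fill (ParL A B K v)
            (PBnd (length (binders (ParL A B K v)) + j) \<bullet> (EArg s # \<sigma>)) \<and> j < length \<Gamma> \<and>
          offset (ParL A B K v) = m" by simp
        then show ?thesis unfolding redex_below_def by blast
      qed
    qed
  next
    case 2
    from "1.IH"(2)[OF this(2)] show ?thesis unfolding redex_below_def[of _ v]
    proof (elim disjE exE conjE)
      fix K p k p'
      assume "v = fill K p" "head_redex (binders K @ Imp B A # \<Gamma>) p k p'" "offset K + k \<le> m'"
      with 2 have "Par A B u v = fill (ParR A B u K) p \<and>
        head_redex (binders (ParR A B u K) @ \<Gamma>) p k p' \<and> offset (ParR A B u K) + k \<le> m" by simp
      then show ?thesis unfolding redex_below_def by blast
    next
      fix K i s \<sigma>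
      assume a: "v = fill K (PBnd (length (binders K) + i) \<bullet> (EArg s # \<sigma>))"
        "i < length (Imp B A # \<Gamma>)" "offset K = m'"
      show ?thesis
      proof (cases i)
        case 0
        with a have v: "comm_occ v K s \<sigma>" by (simp add: comm_occ_def)
        show ?thesis
        proof (cases "\<exists>K s \<sigma>. comm_occ u K s \<sigma>")
          \<comment> \<open>A communication from the right is a head redex only if none starts on
            the left. Any occurrence on the left lies at a smaller place, so it serves
            instead.\<close>
          case True
          then obtain K0 s0 \<sigma>0 where u: "comm_occ u K0 s0 \<sigma>0" by blast
          then have "offset K0 \<le> m" using offset_less[of K0] 2 unfolding comm_occ_def
            by (metis le_add1 le_trans less_imp_le)
          from left[OF u this] show ?thesis unfolding redex_below_def by blast
        next
          case False
          from leftmost_comm_exists[OF v] obtain K' s' \<sigma>' where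
            "leftmost_comm v K' s' \<sigma>'" "offset K' \<le> offset K" by metis
          with False a 2 have "Par A B u v = fill Hole (Par A B u v) \<and>
            head_redex (binders Hole @ \<Gamma>) (Par A B u v) (procs u + offset K')
            (Par A B u (fill K' (transmit (length (binders K')) A s' u))) \<and>
            offset Hole + (procs u + offset K') \<le> m"
            by (auto intro: head_redex.intros)
          then show ?thesis unfolding redex_below_def by blast
        qed
      next
        case (Suc j)
        with a 2 have "Par A B u v = fill (ParR A B u K)
            (PBnd (length (binders (ParR A B u K)) + j) \<bullet> (EArg s # \<sigma>)) \<and> j < length \<Gamma> \<and>
          offset (ParR A B u K) = m" by simp
        then show ?thesis unfolding redex_below_def by blast
      qed
    qed
  qed
qed (rule places_redex_nonpar, assumption, simp add: nonpar_def)+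

text \<open>Every occurrence of a communication variable heading a process is a place. Minimality
  therefore forces the contracted occurrence to be the leftmost one, and for a communication from
  the right it rules out occurrences on the left.\<close>

lemma red_minimal_head_redex:
  "red \<Gamma> t n t' \<Longrightarrow> \<forall>m\<in>places \<Gamma> t. n \<le> m \<Longrightarrow>
    \<exists>K p k p'. t = fill K p \<and> head_redex (binders K @ \<Gamma>) p k p' \<and> n = offset K + k \<and> t' = fill K p'"
proof (induction rule: red.induct)
  case (red_basic h h' \<Gamma> \<sigma>)
  then have "head_redex (binders Hole @ \<Gamma>) (h \<bullet> \<sigma>) 0 (h' \<bullet> \<sigma>)"
    by (simp add: head_redex.intros)
  then show ?case by (metis add_0 fill.simps(1) offset.simps(1))
next
  case (red_abort \<Gamma> A B u \<sigma> D)
  then have "head_redex (binders Hole @ \<Gamma>) (Abort A B \<bullet> (EArg u # \<sigma>)) 0 u"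
    using head_redex.intros(2) by simp
  then show ?case by (metis add_0 fill.simps(1) offset.simps(1))
next
  case (red_left A B \<Gamma> u n u' v)
  then obtain K p k p' where "u = fill K p" "head_redex (binders K @ Imp A B # \<Gamma>) p k p'"
    "n = offset K + k" "u' = fill K p'" by auto
  then have "Par A B u v = fill (ParL A B K v) p \<and> head_redex (binders (ParL A B K v) @ \<Gamma>) p k p' \<and>
    n = offset (ParL A B K v) + k \<and> Par A B u' v = fill (ParL A B K v) p'" by simp
  then show ?case by blast
next
  case (red_right B A \<Gamma> v n v' u)
  have "\<forall>m\<in>places (Imp B A # \<Gamma>) v. n \<le> m"
  proof
    fix m assume "m \<in> places (Imp B A # \<Gamma>) v"
    then have "procs u + m \<in> places \<Gamma> (Par A B u v)" by simp
    with red_right.prems have "procs u + n \<le> procs u + m" by blast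
    then show "n \<le> m" by simp
  qed
  with red_right.IH obtain K p k p' where "v = fill K p" "head_redex (binders K @ Imp B A # \<Gamma>) p k p'"
    "n = offset K + k" "v' = fill K p'" by blast
  then have "Par A B u v = fill (ParR A B u K) p \<and> head_redex (binders (ParR A B u K) @ \<Gamma>) p k p' \<and>
    procs u + n = offset (ParR A B u K) + k \<and> Par A B u v' = fill (ParR A B u K) p'" by simp
  then show ?case by blast
next
  case (red_comm_left u K s \<sigma> \<Gamma> A B v)
  then have "leftmost_comm u K s \<sigma>"
    unfolding leftmost_comm_def by (metis UnI1 places.simps(1) places_comm_occ)
  then have "head_redex (binders Hole @ \<Gamma>) (Par A B u v) (offset K)
      (Par A B (fill K (transmit (length (binders K)) B s v)) v)"
    by (simp add: head_redex.intros)
  then show ?case by (metis add_0 fill.simps(1) offset.simps(1))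
next
  case (red_comm_right v K s \<sigma> \<Gamma> A B u)
  have "\<nexists>K s \<sigma>. comm_occ u K s \<sigma>"
  proof
    assume "\<exists>K s \<sigma>. comm_occ u K s \<sigma>"
    then obtain K1 s1 \<sigma>1 where u: "comm_occ u K1 s1 \<sigma>1" by blast
    then have "offset K1 \<in> places \<Gamma> (Par A B u v)" by (simp add: places_comm_occ)
    with red_comm_right have "procs u + offset K \<le> offset K1" by blast
    moreover have "offset K1 < procs u" using u offset_less unfolding comm_occ_def by metis
    ultimately show False by simp
  qed
  moreover have "leftmost_comm v K s \<sigma>"
    unfolding leftmost_comm_def
  proof (intro conjI allI impI)
    fix K1 s1 \<sigma>1
    assume "comm_occ v K1 s1 \<sigma>1"
    then have "procs u + offset K1 \<in> places \<Gamma> (Par A B u v)" by (simp add: places_comm_occ)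
    with red_comm_right show "offset K \<le> offset K1" by fastforce
  qed (fact red_comm_right)
  ultimately have "head_redex (binders Hole @ \<Gamma>) (Par A B u v) (procs u + offset K)
      (Par A B u (fill K (transmit (length (binders K)) A s u)))"
    by (simp add: head_redex.intros)
  then show ?case by (metis add_0 fill.simps(1) offset.simps(1))
qed

text \<open>Comparing with all places is the same as comparing with all head redexes: at or to the
  left of each place there is a head redex by \<open>places_redex\<close>, and each head redex sits
  at a place by \<open>red_places\<close>.\<close>

lemma head_step_iff: "t \<succ> t' \<longleftrightarrow> (\<exists>n. red [] t n t' \<and> (\<forall>m\<in>places [] t. n \<le> m))"
proof
  assume "t \<succ> t'"
  then obtain K p k p' where *: "t = fill K p" "head_redex (binders K) p k p'" "t' = fill K p'"
    and min: "\<And>K1 p1 k1 p1'. t = fill K1 p1 \<Longrightarrow> head_redex (binders K1) p1 k1 p1' \<Longrightarrow>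
      offset K + k \<le> offset K1 + k1"
    unfolding head_step_def by blast
  have "red [] t (offset K + k) t'"
    using red_fill[of K "[]" p k p'] head_redex_red[OF *(2)] * by simp
  moreover have "offset K + k \<le> m" if m: "m \<in> places [] t" for m
  proof -
    obtain K1 p1 k1 p1' where "t = fill K1 p1" "head_redex (binders K1) p1 k1 p1'" "offset K1 + k1 \<le> m"
      using places_redex[OF m] unfolding redex_below_def by auto
    then show ?thesis using min le_trans by blast
  qed
  ultimately show "\<exists>n. red [] t n t' \<and> (\<forall>m\<in>places [] t. n \<le> m)" by blast
next
  assume "\<exists>n. red [] t n t' \<and> (\<forall>m\<in>places [] t. n \<le> m)"
  then obtain n where n: "red [] t n t'" "\<forall>m\<in>places [] t. n \<le> m" by blast
  obtain K p k p' where *: "t = fill K p" "head_redex (binders K) p k p'" "n = offset K + k" "t' = fill K p'"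
    using red_minimal_head_redex[OF n] by auto
  have "offset K + k \<le> offset K1 + k1" if "t = fill K1 p1" "head_redex (binders K1) p1 k1 p1'" for K1 p1 k1 p1'
  proof -
    have "red [] t (offset K1 + k1) (fill K1 p1')" using red_fill[of K1 "[]" p1 k1 p1'] head_redex_red[OF that(2)] that by simp
    then show ?thesis using n(2) red_places * by blast
  qed
  with * show "t \<succ> t'" unfolding head_step_def by blast
qed

section \<open>Subject reduction\<close>

lemma typed_app_head: "typed n \<Gamma> (t \<bullet> \<sigma>) D \<Longrightarrow> \<exists>C. typed n \<Gamma> t C"
  by (induction \<sigma> arbitrary: D rule: rev_induct) (auto elim!: typed_ElimE)

lemma typed_app_replace:
  assumes "\<And>C. typed n \<Gamma> t C \<Longrightarrow> typed n \<Gamma> t' C"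
  shows "typed n \<Gamma> (t \<bullet> \<sigma>) D \<Longrightarrow> typed n \<Gamma> (t' \<bullet> \<sigma>) D"
proof (induction \<sigma> arbitrary: D rule: rev_induct)
  case (snoc \<xi> \<sigma>)
  from snoc.prems have "typed n \<Gamma> (Elim (t \<bullet> \<sigma>) \<xi>) D" by simp
  then obtain C where "typed n \<Gamma> (t \<bullet> \<sigma>) C" "elem_typed n \<Gamma> C \<xi> D" by (rule typed_ElimE)
  with snoc.IH have "typed n \<Gamma> (Elim (t' \<bullet> \<sigma>) \<xi>) D" by (metis typed_elem_typed.intros(12))
  then show ?case by simp
qed (simp add: assms)

lemma typed_basic: "basic h h' \<Longrightarrow> typed n \<Gamma> h C \<Longrightarrow> typed n \<Gamma> h' C"
proof (induction rule: basic.induct)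
  case (1 A u t)
  from "1.prems" show ?case
    by (rule typed_ElimE) (auto elim!: typed_LamE elem_typed_EArgE intro: typed_psub1)
next
  case (2 u m)
  from "2.prems" show ?case
    by (rule typed_ElimE) (auto elim!: typed_TLamE elem_typed_EIndE intro: typed_isub1)
next
  case (3 u v)
  from "3.prems" show ?case
    by (rule typed_ElimE) (auto elim!: typed_PairE elem_typed_EFstE)
next
  case (4 u v)
  from "4.prems" show ?case
    by (rule typed_ElimE) (auto elim!: typed_PairE elem_typed_ESndE)
next
  case (5 B u C t D s)
  from "5.prems" show ?case
    by (rule typed_ElimE) (auto elim!: typed_InlE elem_typed_ECaseE intro: typed_psub1)
next
  case (6 A u C t D s)
  from "6.prems" show ?case
    by (rule typed_ElimE) (auto elim!: typed_InrE elem_typed_ECaseE intro: typed_psub1)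
next
  case (7 A m u B v)
  from "7.prems" obtain E where "typed n \<Gamma> (Wit A m u) E" "elem_typed n \<Gamma> E (EEx B v) C"
    by (rule typed_ElimE)
  then have m: "wf_tm n m" and u: "typed n \<Gamma> u (fsub1 m A)"
    and v: "typed (Suc n) (A # map (fsub shift) \<Gamma>) v (fsub shift C)"
    by (auto elim!: typed_WitE elem_typed_EExE)
  have i: "wf_tm n (case_nat m Bnd i)" if "i < Suc n" for i
    using that m by (cases i) simp_all
  have "typed n (fsub1 m A # \<Gamma>) (isub1 m v) C"
    using typed_isub(1)[where \<rho> = "case_nat m Bnd" and n' = n, OF v i] by (simp add: comp_def)
  from typed_psub1[OF this u] show ?case .
next
  case (8 \<xi> A B u v)
  from "8.prems" obtain E where "typed n \<Gamma> (Par A B u v) E" and \<xi>: "elem_typed n \<Gamma> E \<xi> C"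
    by (rule typed_ElimE)
  then have "wf_fm n A" "wf_fm n B" "typed n (Imp A B # \<Gamma>) u E" "typed n (Imp B A # \<Gamma>) v E"
    by (auto elim!: typed_ParE)
  with elem_typed_weaken[OF \<xi>] show ?case
    by (intro typed_elem_typed.intros(10)) (auto intro: typed_elem_typed.intros(12))
qed

text \<open>In the rule for \<open>Par\<close> both components and the result have one type, so all
  parallel processes share the type of the whole term.\<close>

lemma typed_fill: "typed n \<Gamma> (fill K p) D \<Longrightarrow> typed n (binders K @ \<Gamma>) p D"
  by (induction K arbitrary: \<Gamma>) (auto elim!: typed_ParE)

lemma typed_fill_replace:
  "typed n \<Gamma> (fill K p) D \<Longrightarrow> typed n (binders K @ \<Gamma>) p' D \<Longrightarrow> typed n \<Gamma> (fill K p') D"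
  by (induction K arbitrary: \<Gamma>) (auto elim!: typed_ParE intro: typed_elem_typed.intros(10))

text \<open>Here \<open>Es\<close> lists the binders between that of \<open>a\<close> and the hole,
  and \<open>E\<close> is the type of \<open>a\<close> on the sending side. Index 0 of
  \<open>v\<close> receives the abstraction; the remaining indices refer to \<open>\<Gamma>\<close>
  and have to skip \<open>Es\<close> and \<open>E\<close>, whence the offset
  \<open>Suc (length Es + j)\<close>.\<close>

lemma typed_transmit:
  assumes v: "typed n (Imp B A # \<Gamma>) v D" and s: "typed n (Es @ E # \<Gamma>) s A" and "wf_fm n B"
  shows "typed n (Es @ E # \<Gamma>) (transmit (length Es) B s v) D"
  unfolding transmit_def
proof (rule typed_psub(1)[OF v], unfold sub_ok_def, intro allI impI)
  fix i assume i: "i < length (Imp B A # \<Gamma>)"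
  show "typed n (Es @ E # \<Gamma>)
    (case i of 0 \<Rightarrow> Lam B (pren Suc s) | Suc j \<Rightarrow> PBnd (Suc (length Es + j))) ((Imp B A # \<Gamma>) ! i)"
  proof (cases i)
    case 0
    then show ?thesis using assms by (auto intro!: typed_elem_typed.intros typed_weaken)
  next
    case (Suc j)
    then have "(Es @ E # \<Gamma>) ! (Suc (length Es + j)) = \<Gamma> ! j"
      by (simp add: nth_append)
    with Suc i show ?thesis
      using typed_elem_typed.intros(2)[of "Suc (length Es + j)" "Es @ E # \<Gamma>" n] by simp
  qed
qed

lemma typed_comm_occ:
  assumes "comm_occ u K s \<sigma>" and "typed n (Imp A B # \<Gamma>) u D"
  shows "typed n (binders K @ Imp A B # \<Gamma>) s A"
proof -
  let ?\<Delta> = "binders K @ Imp A B # \<Gamma>"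
  have "typed n ?\<Delta> (Elim (PBnd (length (binders K))) (EArg s) \<bullet> \<sigma>) D"
    using assms typed_fill unfolding comm_occ_def by fastforce
  then obtain C where "typed n ?\<Delta> (Elim (PBnd (length (binders K))) (EArg s)) C"
    using typed_app_head by blast
  then show ?thesis
    by (rule typed_ElimE) (auto elim!: typed_PBndE elem_typed_EArgE)
qed

lemma typed_comm:
  assumes "comm_occ u K s \<sigma>" and u: "typed n (Imp A B # \<Gamma>) u D" and v: "typed n (Imp B A # \<Gamma>) v D"
    and "wf_fm n B"
  shows "typed n (Imp A B # \<Gamma>) (fill K (transmit (length (binders K)) B s v)) D"
proof -
  have "typed n (Imp A B # \<Gamma>) (fill K (PBnd (length (binders K)) \<bullet> (EArg s # \<sigma>))) D"
    using assms unfolding comm_occ_def by simp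
  then show ?thesis
    by (rule typed_fill_replace) (rule typed_transmit[OF v typed_comm_occ[OF assms(1) u] assms(4)])
qed

text \<open>For a constant the side condition of the redex already states the preservation of type,
  once uniqueness identifies the type named there with \<open>D\<close>.\<close>

lemma typed_red: "red \<Gamma> t n t' \<Longrightarrow> typed 0 \<Gamma> t D \<Longrightarrow> typed 0 \<Gamma> t' D"
proof (induction arbitrary: D rule: red.induct)
  case (red_basic h h' \<Gamma> \<sigma>)
  then show ?case using typed_app_replace typed_basic by metis
next
  case (red_abort \<Gamma> A B u \<sigma> E)
  then show ?case using typed_unique(1) by metis
next
  case (red_left A B \<Gamma> u n u' v)
  then show ?case by (auto elim!: typed_ParE intro: typed_elem_typed.intros(10))
next
  case (red_right B A \<Gamma> v n v' u)
  then show ?case by (auto elim!: typed_ParE intro: typed_elem_typed.intros(10))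
next
  case (red_comm_left u K s \<sigma> \<Gamma> A B v)
  then show ?case by (auto elim!: typed_ParE intro: typed_elem_typed.intros(10) typed_comm)
next
  case (red_comm_right v K s \<sigma> \<Gamma> A B u)
  then show ?case by (auto elim!: typed_ParE intro: typed_elem_typed.intros(10) typed_comm)
qed

section \<open>Parallel composition\<close>

text \<open>What the substitution of a closed \<open>t\<close> for index 0 becomes after passing
  under \<open>k\<close> binders of proof variables. Closedness keeps \<open>t\<close> itself
  unchanged on the way.\<close>

definition subst_at :: "nat \<Rightarrow> ('f, 'p) pt \<Rightarrow> nat \<Rightarrow> ('f, 'p) pt" where
  "subst_at k t i = (if i < k then PBnd i else if i = k then t else PBnd (i - 1))"

lemma subst_at_0: "subst_at 0 t = case_nat t PBnd"
  by (auto simp: subst_at_def fun_eq_iff split: nat.split)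

lemma psub_app: "psub \<theta> (t \<bullet> \<sigma>) = psub \<theta> t \<bullet> map (psub_e \<theta>) \<sigma>"
  by (induction \<sigma> arbitrary: t) auto

lemma psub_up_p_pren: "psub (up_p \<theta>) (pren Suc s) = pren Suc (psub \<theta> s)"
  by (simp add: psub_pren pren_psub)

lemma psub_psub1: "psub \<theta> (psub1 t u) = psub1 (psub \<theta> t) (psub (up_p \<theta>) u)"
proof -
  have "(\<lambda>i. psub \<theta> (case_nat t PBnd i)) = (\<lambda>i. psub1 (psub \<theta> t) (up_p \<theta> i))"
    by (auto simp: fun_eq_iff psub_pren split: nat.split)
  then show ?thesis by (simp add: psub_psub)
qed

lemma psub_isub1: "psub \<theta> (isub1 m u) = isub1 m (psub (up_pi \<theta>) u)"
proof -
  have "(\<lambda>i. isub1 m (up_pi \<theta> i)) = \<theta>"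
    by (simp add: fun_eq_iff up_pi_def isub_isub shift_def)
  then show ?thesis by (simp add: isub_psub)
qed

lemma isub_up_p: "(\<lambda>i. isub1 m (up_p (up_pi \<theta>) i)) = up_p \<theta>"
  by (auto simp: fun_eq_iff up_p_def up_pi_def isub_pren isub_isub shift_def split: nat.split)

lemma basic_psub: "basic h h' \<Longrightarrow> basic (psub \<theta> h) (psub \<theta> h')"
proof (induction rule: basic.induct)
  case (2 u m)
  then show ?case by (simp add: psub_isub1 basic.intros)
next
  case (7 A m u B v)
  have "psub \<theta> (psub1 u (isub1 m v)) =
      psub1 (psub \<theta> u) (isub1 m (psub (up_p (up_pi \<theta>)) v))"
    by (simp add: psub_psub1 isub_psub isub_up_p)
  then show ?case by (simp add: basic.intros)
next
  case (8 \<xi> A B u v)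
  have "psub_e (up_p \<theta>) (pren_e Suc \<xi>) = pren_e Suc (psub_e \<theta> \<xi>)"
    by (simp add: psub_pren pren_psub)
  moreover have "\<nexists>m. psub_e \<theta> \<xi> = EInd m" using 8 by (cases \<xi>) auto
  ultimately show ?case by (simp add: basic.intros)
qed (simp_all add: psub_psub1 basic.intros)

text \<open>Whether \<open>Elim r \<xi>\<close> can be contracted depends only on the outermost
  constructors of \<open>r\<close> and \<open>\<xi>\<close>, and substitution alters these only when
  \<open>r\<close> is a variable.\<close>

lemma basic_psub_iff:
  assumes "nonelim r" "\<And>i. r \<noteq> PBnd i"
  shows "(\<exists>h. basic (Elim (psub \<theta> r) (psub_e \<theta> \<xi>)) h) \<longleftrightarrow> (\<exists>h. basic (Elim r \<xi>) h)"
  using assms by (cases r; cases \<xi>) (auto simp: basic_Elim nonelim_def)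

lemma ex_basic:
  "\<not> (\<exists>h. basic (Elim (PBnd i) \<xi>) h)"
  "\<not> (\<exists>h. basic (Elim (Abort A B) \<xi>) h)"
  "(\<exists>h. basic (Elim (Lam A u) \<xi>) h) \<longleftrightarrow> (\<exists>s. \<xi> = EArg s)"
  by (auto simp: basic_Elim)

primrec ksub :: "(nat \<Rightarrow> ('f, 'p) pt) \<Rightarrow> ('f, 'p) pctx \<Rightarrow> ('f, 'p) pctx" where
  "ksub \<theta> Hole = Hole"
| "ksub \<theta> (ParL A B K v) = ParL A B (ksub (up_p \<theta>) K) (psub (up_p \<theta>) v)"
| "ksub \<theta> (ParR A B u K) = ParR A B (psub (up_p \<theta>) u) (ksub (up_p \<theta>) K)"

lemma binders_ksub [simp]: "binders (ksub \<theta> K) = binders K"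
  by (induction K arbitrary: \<theta>) auto

lemma active_spine:
  assumes "nonelim r"
  shows "active \<Gamma> (r \<bullet> \<sigma>) \<longleftrightarrow> (\<exists>\<xi> \<sigma>'. \<sigma> = \<xi> # \<sigma>' \<and> ((\<exists>h. basic (Elim r \<xi>) h) \<or>
    (\<exists>A B u D. r = Abort A B \<and> \<xi> = EArg u \<and> typed 0 \<Gamma> (r \<bullet> \<sigma>) D \<and> typed 0 \<Gamma> u D) \<or>
    (\<exists>i s. i < length \<Gamma> \<and> r = PBnd i \<and> \<xi> = EArg s)))" (is "_ \<longleftrightarrow> ?R")
proof
  assume "active \<Gamma> (r \<bullet> \<sigma>)"
  then consider h h' \<tau> where "basic h h'" "r \<bullet> \<sigma> = h \<bullet> \<tau>"
    | A B u \<tau> D where "r \<bullet> \<sigma> = Abort A B \<bullet> (EArg u # \<tau>)" "typed 0 \<Gamma> (r \<bullet> \<sigma>) D" "typed 0 \<Gamma> u D"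
    | i s \<tau> where "i < length \<Gamma>" "r \<bullet> \<sigma> = PBnd i \<bullet> (EArg s # \<tau>)"
    unfolding active_def by blast
  then show ?R
  proof cases
    case 1
    then obtain r' \<xi> where "h = Elim r' \<xi>" "nonelim r'" by (metis basic_ElimE)
    moreover from this 1 have "r \<bullet> \<sigma> = r' \<bullet> (\<xi> # \<tau>)" by simp
    ultimately show ?thesis using spine_unique assms 1 by blast
  next
    case 2
    have "nonelim (Abort A B)" by (simp add: nonelim_def)
    with 2 assms spine_unique show ?thesis by blast
  next
    case 3
    have "nonelim (PBnd i)" by (simp add: nonelim_def)
    with 3 assms spine_unique show ?thesis by blast
  qed
next
  assume ?R
  then obtain \<xi> \<sigma>' where \<sigma>: "\<sigma> = \<xi> # \<sigma>'" and
    *: "(\<exists>h. basic (Elim r \<xi>) h) \<or>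
    (\<exists>A B u D. r = Abort A B \<and> \<xi> = EArg u \<and> typed 0 \<Gamma> (r \<bullet> \<sigma>) D \<and> typed 0 \<Gamma> u D) \<or>
    (\<exists>i s. i < length \<Gamma> \<and> r = PBnd i \<and> \<xi> = EArg s)" by blast
  have e: "r \<bullet> \<sigma> = Elim r \<xi> \<bullet> \<sigma>'" using \<sigma> by simp
  from * show "active \<Gamma> (r \<bullet> \<sigma>)"
  proof (elim disjE exE conjE)
    fix h assume "basic (Elim r \<xi>) h"
    with e show ?thesis unfolding active_def by blast
  next
    fix A B u D
    assume "r = Abort A B" "\<xi> = EArg u" "typed 0 \<Gamma> (r \<bullet> \<sigma>) D" "typed 0 \<Gamma> u D"
    with \<sigma> show ?thesis unfolding active_def by blast
  next
    fix i s
    assume "i < length \<Gamma>" "r = PBnd i" "\<xi> = EArg s"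
    with \<sigma> show ?thesis unfolding active_def by blast
  qed
qed

section \<open>Replacing the outermost communication variable by a closed abstraction\<close>

context
  fixes A0 B0 :: "('f::symbol, 'p::symbol) fm" and b t :: "('f, 'p) pt"
  assumes t: "t = Lam A0 b" and t_typed: "typed 0 [] t (Imp A0 B0)"
begin

lemma up_p_at: "up_p (subst_at k t) = subst_at (Suc k) t"
  using pren_closed(1)[OF t_typed] by (auto simp: subst_at_def fun_eq_iff up_p_def split: nat.split)

lemma sub_ok_at: "sub_ok 0 (subst_at (length \<Gamma>) t) (\<Gamma> @ [Imp A0 B0]) \<Gamma>"
proof -
  have "typed 0 \<Gamma> (pren (\<lambda>i. i) t) (Imp A0 B0)"
    using t_typed by (rule typed_pren) (simp add: ren_ok_def)
  then have "typed 0 \<Gamma> t (Imp A0 B0)" by (simp add: pren_closed(1)[OF t_typed])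
  then show ?thesis
    by (auto simp: sub_ok_def subst_at_def nth_append less_Suc_eq intro: typed_elem_typed.intros(2))
qed

lemma psub_fill:
  "psub (subst_at k t) (fill K p) = fill (ksub (subst_at k t) K) (psub (subst_at (length (binders K) + k) t) p)"
  by (induction K arbitrary: k) (simp_all add: up_p_at)

lemma nonpar_at: "nonpar p \<Longrightarrow> nonpar (psub (subst_at k t) p)"
  by (cases p) (auto simp: nonpar_def subst_at_def t)

text \<open>A variable counts as one process, and so does the \<open>Lam\<close> that replaces it;
  hence the numbering of processes is unaffected.\<close>

lemma procs_at: "procs (psub (subst_at k t) u) = procs u"
  by (induction u arbitrary: k rule: procs.induct) (simp_all add: up_p_at, simp add: subst_at_def t)

lemma offset_at: "offset (ksub (subst_at k t) K) = offset K"
  by (induction K arbitrary: k) (auto simp: up_p_at procs_at)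

text \<open>A process headed by the replaced variable and applied to a proof term becomes a beta
  redex, so it is active before and after. Other heads keep their kind; for a constant the
  comparison of types has to be carried across the substitution.\<close>

lemma active_at:
  assumes p: "typed 0 (\<Gamma> @ [Imp A0 B0]) p D"
  shows "active \<Gamma> (psub (subst_at (length \<Gamma>) t) p) \<longleftrightarrow> active (\<Gamma> @ [Imp A0 B0]) p"
proof -
  let ?\<theta> = "subst_at (length \<Gamma>) t" and ?\<Delta> = "\<Gamma> @ [Imp A0 B0]"
  obtain r \<sigma> where r: "nonelim r" and p_eq: "p = r \<bullet> \<sigma>" by (rule spine_exists)
  have nr: "nonelim (psub ?\<theta> r)" using r by (cases r) (auto simp: nonelim_def subst_at_def t)
  have q_eq: "psub ?\<theta> p = psub ?\<theta> r \<bullet> map (psub_e ?\<theta>) \<sigma>" by (simp add: p_eq psub_app)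
  have EArg: "(\<exists>s. psub_e ?\<theta> \<xi> = EArg s) \<longleftrightarrow> (\<exists>s. \<xi> = EArg s)" for \<xi> by (cases \<xi>) auto
  consider i where "r = PBnd i" | A B where "r = Abort A B"
    | "\<And>i. r \<noteq> PBnd i" "\<And>A B. r \<noteq> Abort A B" by blast
  then show ?thesis
  proof cases
    case 1
    obtain C where "typed 0 ?\<Delta> (PBnd i) C" using p p_eq 1 typed_app_head by blast
    then have "i < length ?\<Delta>" by (rule typed_PBndE)
    then consider "i < length \<Gamma>" | "i = length \<Gamma>" by fastforce
    then show ?thesis
    proof cases
      case 1
      with \<open>r = PBnd i\<close> have "psub ?\<theta> r = PBnd i" by (simp add: subst_at_def)
      then have "active \<Gamma> (psub ?\<theta> p) \<longleftrightarrow> (\<exists>\<xi> \<sigma>'. \<sigma> = \<xi> # \<sigma>' \<and> (\<exists>s. \<xi> = EArg s))"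
        unfolding q_eq active_spine[OF nr] using EArg 1 by (cases \<sigma>) (simp_all add: ex_basic)
      then show ?thesis
        unfolding p_eq active_spine[OF r] using \<open>r = PBnd i\<close> 1 by (simp add: ex_basic)
    next
      case 2
      with \<open>r = PBnd i\<close> have "psub ?\<theta> r = Lam A0 b" by (simp add: subst_at_def t)
      then have "active \<Gamma> (psub ?\<theta> p) \<longleftrightarrow> (\<exists>\<xi> \<sigma>'. \<sigma> = \<xi> # \<sigma>' \<and> (\<exists>s. \<xi> = EArg s))"
        unfolding q_eq active_spine[OF nr] using EArg by (cases \<sigma>) (simp_all add: ex_basic)
      then show ?thesis
        unfolding p_eq active_spine[OF r] using \<open>r = PBnd i\<close> 2 by (simp add: ex_basic)
    qed
  next
    case 2
    have eq: "(\<exists>E. typed 0 \<Gamma> (psub ?\<theta> p) E \<and> typed 0 \<Gamma> (psub ?\<theta> u) E) \<longleftrightarrow>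
        (\<exists>E. typed 0 ?\<Delta> p E \<and> typed 0 ?\<Delta> u E)" if "\<sigma> = EArg u # \<sigma>'" for u \<sigma>'
    proof
      assume "\<exists>E. typed 0 \<Gamma> (psub ?\<theta> p) E \<and> typed 0 \<Gamma> (psub ?\<theta> u) E"
      then obtain E where E: "typed 0 \<Gamma> (psub ?\<theta> p) E" "typed 0 \<Gamma> (psub ?\<theta> u) E" by blast
      have "typed 0 \<Gamma> (psub ?\<theta> p) D" using p sub_ok_at by (rule typed_psub)
      with E have "E = D" by (metis typed_unique(1))
      \<comment> \<open>The annotation of the constant fixes the type \<open>A\<close> of its
        argument already before the substitution. Afterwards the argument still has type
        \<open>A\<close>, so uniqueness yields \<open>A = D\<close>.\<close>
      have "typed 0 ?\<Delta> (Elim (Abort A B) (EArg u) \<bullet> \<sigma>') D" using p p_eq 2 that by simp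
      then obtain C where "typed 0 ?\<Delta> (Elim (Abort A B) (EArg u)) C" using typed_app_head by blast
      then have u: "typed 0 ?\<Delta> u A"
        by (rule typed_ElimE) (auto elim!: typed_AbortE elem_typed_EArgE)
      then have "typed 0 \<Gamma> (psub ?\<theta> u) A" using sub_ok_at by (rule typed_psub)
      with E \<open>E = D\<close> have "A = D" by (metis typed_unique(1))
      with p u show "\<exists>E. typed 0 ?\<Delta> p E \<and> typed 0 ?\<Delta> u E" by blast
    next
      assume "\<exists>E. typed 0 ?\<Delta> p E \<and> typed 0 ?\<Delta> u E"
      then show "\<exists>E. typed 0 \<Gamma> (psub ?\<theta> p) E \<and> typed 0 \<Gamma> (psub ?\<theta> u) E"
        using typed_psub(1) sub_ok_at by blast
    qed
    have L: "active \<Gamma> (psub ?\<theta> p) \<longleftrightarrow> (\<exists>u \<sigma>' E. map (psub_e ?\<theta>) \<sigma> = EArg u # \<sigma>' \<and>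
        typed 0 \<Gamma> (psub ?\<theta> p) E \<and> typed 0 \<Gamma> u E)"
      unfolding q_eq active_spine[OF nr] using 2 by (auto simp: ex_basic)
    have R: "active ?\<Delta> p \<longleftrightarrow> (\<exists>u \<sigma>' E. \<sigma> = EArg u # \<sigma>' \<and> typed 0 ?\<Delta> p E \<and> typed 0 ?\<Delta> u E)"
      unfolding p_eq active_spine[OF r] using 2 by (auto simp: ex_basic)
    show ?thesis
    proof (cases "\<exists>u \<sigma>'. \<sigma> = EArg u # \<sigma>'")
      case True
      then obtain u \<sigma>' where "\<sigma> = EArg u # \<sigma>'" by blast
      with L R eq[OF this] show ?thesis by simp
    next
      case False
      then have "\<not> (\<exists>u \<sigma>'. map (psub_e ?\<theta>) \<sigma> = EArg u # \<sigma>')" using EArg by (cases \<sigma>) auto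
      then show ?thesis unfolding L R using False by simp
    qed
  next
    case 3
    have n: "psub ?\<theta> r \<noteq> PBnd i" "psub ?\<theta> r \<noteq> Abort A B" for i A B using 3 by (cases r; simp)+
    show ?thesis unfolding q_eq unfolding p_eq active_spine[OF nr] active_spine[OF r]
      using 3 n basic_psub_iff[OF r 3(1), of ?\<theta>] by (cases \<sigma>) auto
  qed
qed

lemma places_at_nonpar:
  "typed 0 (\<Gamma> @ [Imp A0 B0]) X D \<Longrightarrow> nonpar X \<Longrightarrow>
    places \<Gamma> (psub (subst_at (length \<Gamma>) t) X) = places (\<Gamma> @ [Imp A0 B0]) X"
  by (simp add: places_nonpar nonpar_at active_at)

lemma places_at:
  "typed 0 (\<Gamma> @ [Imp A0 B0]) X D \<Longrightarrow> places \<Gamma> (psub (subst_at (length \<Gamma>) t) X) = places (\<Gamma> @ [Imp A0 B0]) X"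
proof (induction X arbitrary: \<Gamma> rule: procs.induct)
  case (1 A B u v)
  from "1.prems" have "typed 0 ((Imp A B # \<Gamma>) @ [Imp A0 B0]) u D" "typed 0 ((Imp B A # \<Gamma>) @ [Imp A0 B0]) v D"
    by (auto elim!: typed_ParE)
  from "1.IH"(1)[OF this(1)] "1.IH"(2)[OF this(2)] show ?case by (simp add: up_p_at procs_at)
qed (rule places_at_nonpar, assumption, simp add: nonpar_def)+

text \<open>The receiver \<open>v\<close> lies under one more binder than the \<open>Par\<close>,
  namely that of \<open>a\<close>, while \<open>s\<close> lies under \<open>d\<close> further ones;
  this explains the two levels of \<open>subst_at\<close>.\<close>

lemma psub_transmit:
  "psub (subst_at (d + Suc k) t) (transmit d B s v) =
    transmit d B (psub (subst_at (d + Suc k) t) s) (psub (subst_at (Suc k) t) v)"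
proof -
  have "psub (subst_at (d + Suc k) t) (case_nat (Lam B (pren Suc s)) (\<lambda>i. PBnd (Suc (d + i))) i) =
    psub (case_nat (Lam B (pren Suc (psub (subst_at (d + Suc k) t) s))) (\<lambda>i. PBnd (Suc (d + i)))) (subst_at (Suc k) t i)"
    for i
  proof (cases i)
    case 0
    then show ?thesis by (simp add: psub_up_p_pren) (simp add: subst_at_def)
  next
    case (Suc j)
    then show ?thesis using psub_closed(1)[OF t_typed] by (auto simp: subst_at_def split: nat.split)
  qed
  then show ?thesis by (simp add: transmit_def psub_psub)
qed

lemma comm_occ_at:
  "comm_occ u K s \<sigma> \<Longrightarrow> comm_occ (psub (subst_at (Suc k) t) u) (ksub (subst_at (Suc k) t) K)
     (psub (subst_at (length (binders K) + Suc k) t) s)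
     (map (psub_e (subst_at (length (binders K) + Suc k) t)) \<sigma>)"
  by (simp add: comm_occ_def psub_fill psub_app subst_at_def[of _ _ "length (binders K)"])

text \<open>The \<open>Par\<close> that binds the replaced variable lies outside \<open>X\<close>,
  so no step of \<open>X\<close> communicates on that variable; all other contractions commute with
  the substitution.\<close>

lemma red_at:
  "red \<Delta> X n X' \<Longrightarrow> \<Delta> = \<Gamma> @ [Imp A0 B0] \<Longrightarrow>
    red \<Gamma> (psub (subst_at (length \<Gamma>) t) X) n (psub (subst_at (length \<Gamma>) t) X')"
proof (induction arbitrary: \<Gamma> rule: red.induct)
  case (red_basic h h' \<Delta> \<sigma>)
  then show ?case by (simp add: psub_app red.red_basic basic_psub)
next
  case (red_abort \<Delta> A B u \<sigma> D)
  have "typed 0 \<Gamma> (psub (subst_at (length \<Gamma>) t) (Abort A B \<bullet> (EArg u # \<sigma>))) D"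
    using red_abort sub_ok_at typed_psub(1) by blast
  moreover have "typed 0 \<Gamma> (psub (subst_at (length \<Gamma>) t) u) D"
    using red_abort sub_ok_at typed_psub(1) by blast
  ultimately show ?case using red.red_abort by (simp add: psub_app)
next
  case (red_left A B \<Delta> u n u' v)
  then show ?case using red_left.IH[of "Imp A B # \<Gamma>"] by (simp add: up_p_at red.red_left)
next
  case (red_right B A \<Delta> v n v' u)
  then show ?case
    using red_right.IH[of "Imp B A # \<Gamma>"] red.red_right[where B = B and A = A and \<Gamma> = \<Gamma> and u = "psub (subst_at (Suc (length \<Gamma>)) t) u"]
    by (simp add: up_p_at procs_at)
next
  case (red_comm_left u K s \<sigma> \<Delta> A B v)
  from red.red_comm_left[OF comm_occ_at[OF red_comm_left(1), of "length \<Gamma>"],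
      where \<Gamma> = \<Gamma> and A = A and B = B and v = "psub (subst_at (Suc (length \<Gamma>)) t) v"]
  show ?case by (simp add: up_p_at offset_at psub_fill psub_transmit[unfolded add_Suc_right])
next
  case (red_comm_right v K s \<sigma> \<Delta> A B u)
  from red.red_comm_right[OF comm_occ_at[OF red_comm_right(1), of "length \<Gamma>"],
      where \<Gamma> = \<Gamma> and A = A and B = B and u = "psub (subst_at (Suc (length \<Gamma>)) t) u"]
  show ?case by (simp add: up_p_at offset_at procs_at psub_fill psub_transmit[unfolded add_Suc_right])
qed

lemma head_step_at:
  assumes "typed 0 [Imp A0 B0] X D" and "red [Imp A0 B0] X n X'"
    and "\<forall>m\<in>places [Imp A0 B0] X. n \<le> m"
  shows "psub1 t X \<succ> psub1 t X'"
  using red_at[OF assms(2), of "[]"] places_at[of "[]" X D] assms(1,3)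
  unfolding head_step_iff by (auto simp: subst_at_0)

end

section \<open>Simulating a communication by a relay\<close>

lemma places_fill_less:
  "nonpar p \<Longrightarrow> nonpar q \<Longrightarrow> m \<in> places \<Gamma> (fill K q) \<Longrightarrow> m < offset K \<Longrightarrow> m \<in> places \<Gamma> (fill K p)"
proof (induction K arbitrary: m \<Gamma>)
  case (ParL A B K v)
  have "offset K < procs (fill K q)" by (rule offset_less)
  with ParL show ?case by auto
next
  case (ParR A B u K)
  then show ?case by auto
qed simp

text \<open>
  The body of \<open>relay A B D Y\<close> performs a communication with \<open>Y\<close>: the constant from \<open>D\<close> to \<open>B\<close>
  discards the stack on which \<open>a\<close> was applied, just as contracting a communication redex does.
\<close>

definition relay ::
    "('f, 'p) fm \<Rightarrow> ('f, 'p) fm \<Rightarrow> ('f, 'p) fm \<Rightarrow> ('f, 'p) pt \<Rightarrow> ('f, 'p) pt" where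
  "relay A B D Y = Lam A (Elim (Abort D B) (EArg (transmit 0 B (PBnd 0) Y)))"

text \<open>The only index of \<open>Y\<close> is the communication variable, so it suffices that
  \<lambda>y. x becomes \<lambda>y. s.\<close>

lemma psub1_relay_body:
  assumes "typed 0 [Imp B A] Y D"
  shows "psub1 s (Elim (Abort D B) (EArg (transmit 0 B (PBnd 0) Y))) =
    Elim (Abort D B) (EArg (psub1 (Lam B (pren Suc s)) Y))"
  using assms by (auto simp: transmit_def psub_psub intro!: psub_cong(1)[OF assms])

lemma typed_relay:
  assumes Y: "typed 0 [Imp B A] Y D" and wf: "wf_fm 0 A" "wf_fm 0 B"
  shows "typed 0 [] (relay A B D Y) (Imp A B)"
proof -
  have "wf_fm 0 D" using typed_wf(1)[OF Y] wf by simp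
  have "sub_ok 0 (case_nat (Lam B (pren Suc (PBnd 0))) (\<lambda>i. PBnd (Suc (0 + i)))) [Imp B A] [A]"
    using wf typed_elem_typed.intros(2)[of 1 "[B, A]" 0]
    by (auto simp: sub_ok_def intro!: typed_elem_typed.intros(5))
  then have "typed 0 [A] (transmit 0 B (PBnd 0) Y) D"
    unfolding transmit_def by (rule typed_psub(1)[OF Y])
  with \<open>wf_fm 0 D\<close> wf show ?thesis
    unfolding relay_def by (auto intro!: typed_elem_typed.intros)
qed

text \<open>The two steps are the beta contraction of the relay and the firing of its constant, both
  at \<open>offset K\<close>. The second is again a head step, because the first changes only the
  process in the hole and so creates no place further left.\<close>

lemma head_step_relay:
  assumes X: "typed 0 [Imp A B] X D" and Y: "typed 0 [Imp B A] Y D"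
    and wf: "wf_fm 0 A" "wf_fm 0 B"
    and occ: "comm_occ X K s \<sigma>" and min: "\<forall>m\<in>places [Imp A B] X. offset K \<le> m"
  obtains Z where "psub1 (relay A B D Y) X \<succ> Z"
    and "Z \<succ> psub1 (relay A B D Y) (fill K (transmit (length (binders K)) B s Y))"
proof -
  define t where "t = relay A B D Y"
  have t_typed: "typed 0 [] t (Imp A B)" unfolding t_def by (rule typed_relay[OF Y wf])
  note t = t_def[unfolded relay_def]
  define d where "d = length (binders K)"
  define K' where "K' = ksub (subst_at 0 t) K"
  define s' where "s' = psub (subst_at d t) s"
  define \<sigma>' where "\<sigma>' = map (psub_e (subst_at d t)) \<sigma>"
  define W where "W = psub1 (Lam B (pren Suc s')) Y"
  define q where "q = Abort D B \<bullet> (EArg W # \<sigma>')"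
  have off: "offset K' = offset K" unfolding K'_def by (rule offset_at[OF t t_typed])
  have bnd: "binders K' = binders K" by (simp add: K'_def)
  have X_eq: "psub1 t X = fill K' (Elim t (EArg s') \<bullet> \<sigma>')"
    using occ unfolding comm_occ_def subst_at_0[symmetric]
    by (simp add: psub_fill[OF t t_typed] K'_def s'_def \<sigma>'_def d_def psub_app)
       (simp add: subst_at_def)
  have places: "places [] (psub1 t X) = places [Imp A B] X"
    using places_at[OF t t_typed, of "[]" X D] X by (simp add: subst_at_0)
  have b: "basic (Elim t (EArg s')) (Elim (Abort D B) (EArg W))"
    using basic.intros(1)[of A _ s'] psub1_relay_body[OF Y, of s'] unfolding t W_def by metis
  have r1: "red [] (psub1 t X) (offset K) (fill K' q)"
    using red_fill[of K' "[]", OF red_basic[OF b, of _ \<sigma>']] by (simp add: X_eq off q_def)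
  with places min have s1: "psub1 t X \<succ> fill K' q" unfolding head_step_iff by metis
  have "typed 0 [] (psub1 t X) D" using X t_typed by (rule typed_psub1)
  then have Z: "typed 0 [] (fill K' q) D" using r1 typed_red by blast
  \<comment> \<open>This prepares the side condition of the constant: as a process of a term of type
    \<open>D\<close>, the term \<open>q\<close> has type \<open>D\<close>, and so has the argument
    \<open>W\<close> by the annotation of \<open>Abort D B\<close>.\<close>
  then have q: "typed 0 (binders K') q D" using typed_fill by fastforce
  then obtain C where "typed 0 (binders K') (Elim (Abort D B) (EArg W)) C"
    unfolding q_def using typed_app_head[of 0 "binders K'" "Elim (Abort D B) (EArg W)" \<sigma>'] by auto
  then have W: "typed 0 (binders K') W D"
    by (rule typed_ElimE) (auto elim!: typed_AbortE elem_typed_EArgE)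
  have "red (binders K' @ []) q 0 W" unfolding q_def
    by (rule red_abort) (use q W in \<open>simp_all add: q_def\<close>)
  then have r2: "red [] (fill K' q) (offset K) (fill K' W)"
    using red_fill off by fastforce
  have "offset K \<le> m" if m: "m \<in> places [] (fill K' q)" for m
  proof (rule ccontr)
    assume "\<not> offset K \<le> m"
    then have "m < offset K'" by (simp add: off)
    moreover have "nonpar q" unfolding q_def by (rule nonpar_app)
    moreover have "nonpar (Elim t (EArg s') \<bullet> \<sigma>')" using nonpar_app[of t "EArg s'" \<sigma>'] by simp
    ultimately have "m \<in> places [] (psub1 t X)" unfolding X_eq using places_fill_less m by blast
    with places min \<open>\<not> offset K \<le> m\<close> show False by blast
  qed
  with r2 have s2: "fill K' q \<succ> fill K' W" unfolding head_step_iff by blast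
  \<comment> \<open>The discarded stack leaves exactly what the communication inserts, up to the
    substitution of the relay; agreement at index 0 is enough, as \<open>Y\<close> has no other
    index.\<close>
  have "psub (subst_at d t) (transmit d B s Y) = W"
  proof -
    have "psub (subst_at d t) (case i of 0 \<Rightarrow> Lam B (pren Suc s) | Suc i \<Rightarrow> PBnd (Suc (d + i))) =
        (case i of 0 \<Rightarrow> Lam B (pren Suc s') | Suc j \<Rightarrow> PBnd j)" if "i < length [Imp B A]" for i
      using that by (simp add: psub_up_p_pren s'_def)
    then show ?thesis unfolding W_def transmit_def psub_psub
      by (intro psub_cong(1)[OF Y]) blast
  qed
  then have "psub1 t (fill K (transmit d B s Y)) = fill K' W"
    unfolding subst_at_0[symmetric] by (simp add: psub_fill[OF t t_typed] K'_def d_def)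
  with s1 s2 that show ?thesis unfolding t_def d_def by metis
qed

section \<open>Halting of a parallel composition\<close>

definition halts :: "('f::symbol, 'p::symbol) pt \<Rightarrow> bool" where
  "halts t \<longleftrightarrow> \<not> (\<exists>s. s 0 = t \<and> (\<forall>i::nat. s i \<succ> s (Suc i)))"

lemma halts_intro: "(\<And>u. t \<succ> u \<Longrightarrow> halts u) \<Longrightarrow> halts t"
  unfolding halts_def
proof (intro notI, elim exE conjE)
  fix s assume *: "\<And>u. t \<succ> u \<Longrightarrow> \<nexists>s. s 0 = u \<and> (\<forall>i. s i \<succ> s (Suc i))"
    and s: "s 0 = t" "\<forall>i. s i \<succ> s (Suc i)"
  from s have "t \<succ> s 1" by (metis One_nat_def)
  moreover from s have "\<exists>s'. s' 0 = s 1 \<and> (\<forall>i. s' i \<succ> s' (Suc i))"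
    by (intro exI[of _ "\<lambda>i. s (Suc i)"]) simp
  ultimately show False using * by blast
qed

lemma halts_step: "halts t \<Longrightarrow> t \<succ> u \<Longrightarrow> halts u"
  unfolding halts_def
proof (intro notI, elim exE conjE)
  fix s assume "\<nexists>s. s 0 = t \<and> (\<forall>i. s i \<succ> s (Suc i))" "t \<succ> u" "s 0 = u" "\<forall>i. s i \<succ> s (Suc i)"
  moreover from this have "\<exists>s'. s' 0 = t \<and> (\<forall>i. s' i \<succ> s' (Suc i))"
    by (intro exI[of _ "case_nat t s"]) (auto split: nat.split)
  ultimately show False by blast
qed

text \<open>A halting counterexample has a head reduct that is again one, so dependent choice would
  produce an infinite head reduction.\<close>

lemma halts_induct [consumes 1]:
  assumes "halts t" and step: "\<And>t. halts t \<Longrightarrow> (\<And>u. t \<succ> u \<Longrightarrow> P u) \<Longrightarrow> P t"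
  shows "P t"
proof (rule ccontr)
  assume "\<not> P t"
  have "\<exists>s. s 0 = t \<and> (\<forall>i. (halts (s i) \<and> \<not> P (s i)) \<and> s i \<succ> s (Suc i))"
  proof -
    \<comment> \<open>The clause about \<open>i = 0\<close> pins the start of the chosen sequence to
      \<open>t\<close>.\<close>
    have "\<exists>s. \<forall>i. (halts (s i) \<and> \<not> P (s i) \<and> (i = 0 \<longrightarrow> s i = t)) \<and> s i \<succ> s (Suc i)"
    proof (rule dependent_nat_choice)
      show "\<exists>x. halts x \<and> \<not> P x \<and> (0 = (0::nat) \<longrightarrow> x = t)" using assms(1) \<open>\<not> P t\<close> by blast
    next
      fix x :: "('a, 'b) pt" and n :: nat
      assume "halts x \<and> \<not> P x \<and> (n = 0 \<longrightarrow> x = t)"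
      then show "\<exists>y. (halts y \<and> \<not> P y \<and> (Suc n = 0 \<longrightarrow> y = t)) \<and> x \<succ> y"
        using step halts_step by blast
    qed
    then show ?thesis by blast
  qed
  with assms(1) show False unfolding halts_def by blast
qed

lemma not_Par_app: "Par A B u v \<noteq> t \<bullet> (\<xi> # \<sigma>)"
  using nonpar_app[of t \<xi> \<sigma>] unfolding nonpar_def by metis

lemma red_Par_cases:
  assumes "red \<Gamma> (Par A B u v) n t"
  obtains u' where "t = Par A B u' v" "red (Imp A B # \<Gamma>) u n u'"
  | v' m where "t = Par A B u v'" "n = procs u + m" "red (Imp B A # \<Gamma>) v m v'"
  | K s \<sigma> where "t = Par A B (fill K (transmit (length (binders K)) B s v)) v" "n = offset K"
      "comm_occ u K s \<sigma>"
  | K s \<sigma> where "t = Par A B u (fill K (transmit (length (binders K)) A s u))"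
      "n = procs u + offset K" "comm_occ v K s \<sigma>"
proof -
  from assms show ?thesis
  proof (cases rule: red.cases)
    case (red_basic h h' \<sigma>)
    then show ?thesis using not_Par_app by (metis basic_ElimE foldl_Cons)
  next
    case red_abort
    then show ?thesis using not_Par_app by metis
  next
    case (red_left u')
    then show ?thesis by (rule that(1))
  next
    case (red_right v')
    then show ?thesis using that(2) by blast
  next
    case (red_comm_left K s \<sigma>)
    then show ?thesis using that(3) by blast
  next
    case (red_comm_right K s \<sigma>)
    then show ?thesis using that(4) by blast
  qed
qed

text \<open>Since \<open>X\<close> has no places, every step of the composition changes
  \<open>Y\<close> alone. The disjunction about \<open>t\<close> is there because a communication
  costs two steps on the simulating side: the induction hypothesis is applied to the intermediate
  term, which is one step ahead of the next substituted \<open>Y\<close>.\<close>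

lemma halts_Par_right:
  assumes X: "typed 0 [Imp A B] X D" "places [Imp A B] X = {}" and wf: "wf_fm 0 A" "wf_fm 0 B"
  shows "halts t \<Longrightarrow> typed 0 [Imp B A] Y D \<Longrightarrow>
    t = psub1 (relay B A D X) Y \<or> t \<succ> psub1 (relay B A D X) Y \<Longrightarrow> halts (Par A B X Y)"
proof (induction t arbitrary: Y rule: halts_induct)
  case (1 t)
  show ?case
  proof (cases "t \<succ> psub1 (relay B A D X) Y")
    case True
    from "1.IH"[OF this "1.prems"(1)] show ?thesis by blast
  next
    case False
    with 1 have t: "t = psub1 (relay B A D X) Y" by blast
    note Y = "1.prems"(1)
    show ?thesis
    proof (rule halts_intro)
      fix Z assume "Par A B X Y \<succ> Z"
      then obtain n where n: "red [] (Par A B X Y) n Z" and min: "\<forall>m\<in>places [] (Par A B X Y). n \<le> m"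
        unfolding head_step_iff by blast
      from n show "halts Z"
      proof (cases rule: red_Par_cases)
        case (1 u')
        then show ?thesis using red_places X(2) by fastforce
      next
        case (3 K s \<sigma>)
        then show ?thesis using places_comm_occ[of X K s \<sigma> "Imp A B" "[]"] X(2) by simp
      next
        case (2 Y' m)
        from min 2(2) have "\<forall>k\<in>places [Imp B A] Y. m \<le> k" by (simp add: ball_Un)
        with 2 Y have "t \<succ> psub1 (relay B A D X) Y'" unfolding t
          using head_step_at[OF relay_def typed_relay[OF X(1)]] wf by blast
        moreover have "typed 0 [Imp B A] Y' D" using typed_red 2 Y by blast
        ultimately show ?thesis using "1.IH" 2(1) by blast
      next
        case (4 K s \<sigma>)
        from min 4(2) have "\<forall>k\<in>places [Imp B A] Y. offset K \<le> k" by (simp add: ball_Un)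
        from head_step_relay[OF Y X(1) wf(2,1) 4(3) this] obtain Z' where
          "t \<succ> Z'" "Z' \<succ> psub1 (relay B A D X) (fill K (transmit (length (binders K)) A s X))"
          unfolding t by blast
        moreover have "typed 0 [Imp B A] (fill K (transmit (length (binders K)) A s X)) D"
          by (rule typed_comm[OF 4(3) Y X(1) wf(1)])
        ultimately show ?thesis using "1.IH" 4(1) by blast
      qed
    qed
  qed
qed

lemma places_less: "m \<in> places \<Gamma> t \<Longrightarrow> m < procs t"
  by (induction t arbitrary: \<Gamma> m rule: procs.induct) (auto split: if_splits simp: trans_less_add1)

text \<open>As long as the left side has a place, the head step happens there and \<open>Y\<close>
  stays fixed. The assumption \<open>right\<close> ranges over all normal \<open>X\<close>, since
  the one reached at the end of this phase is not known beforehand.\<close>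

lemma halts_Par:
  assumes Y: "typed 0 [Imp B A] Y D" and wf: "wf_fm 0 A" "wf_fm 0 B"
    and right: "\<And>X. typed 0 [Imp A B] X D \<Longrightarrow> places [Imp A B] X = {} \<Longrightarrow> halts (psub1 (relay B A D X) Y)"
  shows "halts t \<Longrightarrow> typed 0 [Imp A B] X D \<Longrightarrow>
    t = psub1 (relay A B D Y) X \<or> t \<succ> psub1 (relay A B D Y) X \<Longrightarrow> halts (Par A B X Y)"
proof (induction t arbitrary: X rule: halts_induct)
  case (1 t)
  note X = "1.prems"(1)
  show ?case
  proof (cases "places [Imp A B] X = {}")
    case True
    then show ?thesis using halts_Par_right[OF X True wf right[OF X True] Y] by blast
  next
    case nonempty: False
    show ?thesis
    proof (cases "t \<succ> psub1 (relay A B D Y) X")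
      case True
      from "1.IH"[OF this X] show ?thesis by blast
    next
      case False
      with 1 have t: "t = psub1 (relay A B D Y) X" by blast
      show ?thesis
      proof (rule halts_intro)
        fix Z assume "Par A B X Y \<succ> Z"
        then obtain n where n: "red [] (Par A B X Y) n Z" and min: "\<forall>m\<in>places [] (Par A B X Y). n \<le> m"
          unfolding head_step_iff by blast
        \<comment> \<open>A place on the left bounds \<open>n\<close> below \<open>procs X\<close>,
          which excludes both kinds of contraction on the right.\<close>
        from nonempty obtain m0 where m0: "m0 \<in> places [Imp A B] X" by blast
        with min have "n \<le> m0" by (simp add: ball_Un)
        with places_less[OF m0] have small: "n < procs X" by simp
        from min have min': "\<forall>k\<in>places [Imp A B] X. n \<le> k" by (simp add: ball_Un)
        from n show "halts Z"
        proof (cases rule: red_Par_cases)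
          case (1 X')
          with min' X have "t \<succ> psub1 (relay A B D Y) X'" unfolding t
            using head_step_at[OF relay_def typed_relay[OF Y wf]] by blast
          moreover have "typed 0 [Imp A B] X' D" using typed_red 1 X by blast
          ultimately show ?thesis using "1.IH" 1(1) by blast
        next
          case (3 K s \<sigma>)
          from head_step_relay[OF X Y wf 3(3)] min' 3 obtain Z' where
            "t \<succ> Z'" "Z' \<succ> psub1 (relay A B D Y) (fill K (transmit (length (binders K)) B s Y))"
            unfolding t by blast
          moreover have "typed 0 [Imp A B] (fill K (transmit (length (binders K)) B s Y)) D"
            by (rule typed_comm[OF 3(3) X Y wf(2)])
          ultimately show ?thesis using "1.IH" 3(1) by blast
        qed (use small in simp_all)
      qed
    qed
  qed
qed

section \<open>Realizability\<close>

declare realizes.simps [simp del]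

section \<open>Criteria for halting\<close>

lemma HN_star_iff: "t \<in> HN_star \<longleftrightarrow> (\<exists>A. typed 0 [] t A) \<and> halts t"
  by (simp add: HN_star_def halts_def LC_star_def)

lemma halts_normal: "places [] t = {} \<Longrightarrow> halts t"
  by (rule halts_intro) (auto simp: head_step_iff dest: red_places)

lemma halts_nonelim: "nonelim t \<Longrightarrow> nonpar t \<Longrightarrow> halts t"
  using active_spine[of t "[]" "[]"] by (intro halts_normal) (simp add: places_nonpar)

text \<open>The term is a single process with a deterministic head redex, so contracting
  \<open>h\<close> is its only head step.\<close>

lemma halts_basic:
  assumes b: "basic h h'" and "halts (h' \<bullet> \<sigma>)"
  shows "halts (h \<bullet> \<sigma>)"
proof (rule halts_intro)
  fix u assume "h \<bullet> \<sigma> \<succ> u"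
  then obtain n where n: "red [] (h \<bullet> \<sigma>) n u" unfolding head_step_iff by blast
  obtain r \<xi> where h: "h = Elim r \<xi>" "nonelim r" "\<And>A B. r \<noteq> Abort A B" using basic_ElimE[OF b] by metis
  have np: "h \<bullet> \<sigma> \<noteq> Par A B v w" for A B v w using not_Par_app[of A B v w r \<xi> \<sigma>] h by auto
  from n have "u = h' \<bullet> \<sigma>"
  proof (cases rule: red.cases)
    case (red_basic k k' \<tau>)
    then show ?thesis using basic_app_unique b by blast
  next
    case (red_abort A B \<tau> D)
    have "nonelim (Abort A B)" by (simp add: nonelim_def)
    moreover have "r \<bullet> (\<xi> # \<sigma>) = Abort A B \<bullet> (EArg u # \<tau>)" using red_abort h by simp
    ultimately show ?thesis using spine_unique h by blast
  qed (use np in blast)+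
  with assms show "halts u" by simp
qed

text \<open>If the types agree, the only step discards \<open>\<sigma>\<close> and leaves
  \<open>u\<close>; otherwise there is no step. This makes the body of a relay harmless on every
  stack.\<close>

lemma halts_Abort:
  assumes "halts u"
  shows "halts (Abort A B \<bullet> (EArg u # \<sigma>))"
proof (rule halts_intro)
  let ?t = "Abort A B \<bullet> (EArg u # \<sigma>)"
  fix v assume "?t \<succ> v"
  then obtain n where n: "red [] ?t n v" unfolding head_step_iff by blast
  have ne: "nonelim (Abort A B)" for A B :: "('a, 'b) fm" by (simp add: nonelim_def)
  have np: "?t \<noteq> Par C D w w'" for C D w w' using not_Par_app by metis
  from n have "v = u"
  proof (cases rule: red.cases)
    case (red_basic h h' \<tau>)
    then obtain r \<xi> where h: "h = Elim r \<xi>" "nonelim r" "\<And>A B. r \<noteq> Abort A B"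
      using basic_ElimE by metis
    with red_basic have "r \<bullet> (\<xi> # \<tau>) = ?t" by simp
    with spine_unique[OF h(2) ne] h show ?thesis by blast
  next
    case (red_abort A' B' \<tau> D)
    then show ?thesis using spine_unique[OF ne ne] by blast
  qed (use np in blast)+
  with assms show "halts v" by simp
qed

text \<open>The stack is distributed one element at a time. An individual term is not distributed by
  any reduction; when one is met, the whole application has no head redex and halts at once.\<close>

lemma halts_Par_app:
  "halts (Par A B (u \<bullet> map (pren_e Suc) \<sigma>) (v \<bullet> map (pren_e Suc) \<sigma>)) \<Longrightarrow> halts (Par A B u v \<bullet> \<sigma>)"
proof (induction \<sigma> arbitrary: u v)
  case (Cons \<xi> \<sigma>)
  show ?case
  proof (cases "\<exists>m. \<xi> = EInd m")
    case True
    then obtain m where \<xi>: "\<xi> = EInd m" by blast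
    have "nonelim (Par A B u v)" by (simp add: nonelim_def)
    then have "\<not> active [] (Par A B u v \<bullet> (\<xi> # \<sigma>))"
      by (simp only: active_spine) (auto simp: \<xi> basic_Elim)
    then show ?thesis by (intro halts_normal) (simp add: places_nonpar nonpar_app del: foldl_Cons)
  next
    case False
    then have "basic (Elim (Par A B u v) \<xi>) (Par A B (Elim u (pren_e Suc \<xi>)) (Elim v (pren_e Suc \<xi>)))"
      by (rule basic.intros)
    from halts_basic[OF this] Cons show ?thesis by simp
  qed
qed simp

section \<open>Stacks and realizers\<close>

lemma stacks_Nil: "[] \<in> stacks A"
  by (cases A) simp_all

lemma typed_app_stack:
  "typed 0 [] t A \<Longrightarrow> stack_typed A \<sigma> D \<Longrightarrow> typed 0 [] (t \<bullet> \<sigma>) D"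
  by (induction \<sigma> arbitrary: t A) (auto intro: typed_elem_typed.intros(12))

lemma typed_app_stack_weaken:
  "typed 0 [E] t A \<Longrightarrow> stack_typed A \<sigma> D \<Longrightarrow> typed 0 [E] (t \<bullet> map (pren_e Suc) \<sigma>) D"
  by (induction \<sigma> arbitrary: t A) (auto intro: typed_elem_typed.intros(12) elem_typed_weaken)

lemma realizes_typed: "t \<tturnstile> A \<Longrightarrow> typed 0 [] t A"
  by (simp add: realizes.simps LC_star_def)

lemma realizes_HN: "t \<tturnstile> A \<Longrightarrow> \<sigma> \<in> stacks A \<Longrightarrow> t \<bullet> \<sigma> \<in> HN_star"
  by (simp add: realizes.simps)

lemma realizes_halts: "t \<tturnstile> A \<Longrightarrow> \<sigma> \<in> stacks A \<Longrightarrow> halts (t \<bullet> \<sigma>)"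
  using realizes_HN HN_star_iff by blast

text \<open>The type found here later becomes the domain of the constant in a relay. The induction
  is on size, since \<open>All\<close> leads to an instance of its body and not to a
  subformula.\<close>

lemma stack_typed_stacks: "\<sigma> \<in> stacks A \<Longrightarrow> \<exists>D. stack_typed A \<sigma> D"
proof (induction A arbitrary: \<sigma> rule: measure_induct_rule[where f = fsize])
  case (less A)
  show ?case
  proof (cases A)
    case (And A1 A2)
    with less.prems consider "\<sigma> = []" | \<tau> where "\<sigma> = EFst # \<tau>" "\<tau> \<in> stacks A1"
      | \<tau> where "\<sigma> = ESnd # \<tau>" "\<tau> \<in> stacks A2" by auto
    then show ?thesis
    proof cases
      case 2
      then obtain D where "stack_typed A1 \<tau> D" using less.IH[of A1 \<tau>] And by auto
      with 2 And show ?thesis by (auto intro: typed_elem_typed.intros)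
    next
      case 3
      then obtain D where "stack_typed A2 \<tau> D" using less.IH[of A2 \<tau>] And by auto
      with 3 And show ?thesis by (auto intro: typed_elem_typed.intros)
    qed (simp add: And)
  next
    case (Imp A1 A2)
    with less.prems consider "\<sigma> = []" | u \<tau> where "\<sigma> = EArg u # \<tau>" "u \<tturnstile> A1" "\<tau> \<in> stacks A2" by auto
    then show ?thesis
    proof cases
      case 2
      then obtain D where "stack_typed A2 \<tau> D" using less.IH[of A2 \<tau>] Imp by auto
      with 2 Imp show ?thesis by (auto intro: typed_elem_typed.intros realizes_typed)
    qed (simp add: Imp)
  next
    case (All A1)
    with less.prems consider "\<sigma> = []" | m \<tau> where "\<sigma> = EInd m # \<tau>" "wf_tm 0 m" "\<tau> \<in> stacks (fsub1 m A1)" by auto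
    then show ?thesis
    proof cases
      case 2
      then obtain D where "stack_typed (fsub1 m A1) \<tau> D" using less.IH[of "fsub1 m A1" \<tau>] All by auto
      with 2 All show ?thesis by (auto intro: typed_elem_typed.intros)
    qed (simp add: All)
  qed (use less.prems in auto)
qed

lemma realizesI:
  assumes "typed 0 [] t A" and "\<And>\<sigma>. \<sigma> \<in> stacks A \<Longrightarrow> halts (t \<bullet> \<sigma>)"
  shows "t \<tturnstile> A"
  unfolding realizes.simps[of t A] LC_star_def HN_star_iff
  using assms typed_app_stack stack_typed_stacks by blast

text \<open>The pattern for all introductions: the empty stack leaves a normal term, while any other
  stack exposes a basic redex whose contractum halts by hypothesis.\<close>

lemma realizes_Lam:
  assumes "typed 0 [] (Lam A u) (Imp A B)" and u: "\<And>t. t \<tturnstile> A \<Longrightarrow> psub1 t u \<tturnstile> B"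
  shows "Lam A u \<tturnstile> Imp A B"
proof (rule realizesI[OF assms(1)])
  fix \<sigma> assume "\<sigma> \<in> stacks (Imp A B)"
  then consider "\<sigma> = []" | t \<tau> where "\<sigma> = EArg t # \<tau>" "t \<tturnstile> A" "\<tau> \<in> stacks B" by auto
  then show "halts (Lam A u \<bullet> \<sigma>)"
  proof cases
    case 2
    from halts_basic[OF basic.intros(1) realizes_halts[OF u[OF 2(2)] 2(3)]] 2(1) show ?thesis by simp
  qed (simp add: halts_nonelim nonelim_def nonpar_def)
qed

lemma realizes_TLam:
  assumes "typed 0 [] (TLam u) (All A)" and u: "\<And>m. wf_tm 0 m \<Longrightarrow> isub1 m u \<tturnstile> fsub1 m A"
  shows "TLam u \<tturnstile> All A"
proof (rule realizesI[OF assms(1)])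
  fix \<sigma> assume "\<sigma> \<in> stacks (All A)"
  then consider "\<sigma> = []" | m \<tau> where "\<sigma> = EInd m # \<tau>" "wf_tm 0 m" "\<tau> \<in> stacks (fsub1 m A)" by auto
  then show "halts (TLam u \<bullet> \<sigma>)"
  proof cases
    case 2
    from halts_basic[OF basic.intros(2) realizes_halts[OF u[OF 2(2)] 2(3)]] 2(1) show ?thesis by simp
  qed (simp add: halts_nonelim nonelim_def nonpar_def)
qed

lemma realizes_Pair:
  assumes u: "u \<tturnstile> A" and v: "v \<tturnstile> B"
  shows "Pair u v \<tturnstile> And A B"
proof (rule realizesI)
  show "typed 0 [] (Pair u v) (And A B)" using assms by (auto intro: typed_elem_typed.intros realizes_typed)
next
  fix \<sigma> assume "\<sigma> \<in> stacks (And A B)"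
  then consider "\<sigma> = []" | \<tau> where "\<sigma> = EFst # \<tau>" "\<tau> \<in> stacks A" | \<tau> where "\<sigma> = ESnd # \<tau>" "\<tau> \<in> stacks B"
    by auto
  then show "halts (Pair u v \<bullet> \<sigma>)"
  proof cases
    case 2
    from halts_basic[OF basic.intros(3) realizes_halts[OF u 2(2)]] 2(1) show ?thesis by simp
  next
    case 3
    from halts_basic[OF basic.intros(4) realizes_halts[OF v 3(2)]] 3(1) show ?thesis by simp
  qed (simp add: halts_nonelim nonelim_def nonpar_def)
qed

lemma stacks_Or_cases:
  assumes "\<sigma> \<in> stacks (Or A B)"
  obtains "\<sigma> = []" | u v \<tau> where "\<sigma> = ECase A u B v # \<tau>"
    "\<And>t. t \<tturnstile> A \<Longrightarrow> halts (psub1 t u \<bullet> \<tau>)" "\<And>t. t \<tturnstile> B \<Longrightarrow> halts (psub1 t v \<bullet> \<tau>)"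
  using assms by (auto simp: HN_star_iff)

lemma realizes_Inl:
  assumes u: "u \<tturnstile> A" and "wf_fm 0 B"
  shows "Inl B u \<tturnstile> Or A B"
proof (rule realizesI)
  show "typed 0 [] (Inl B u) (Or A B)" using assms by (auto intro: typed_elem_typed.intros realizes_typed)
next
  fix \<sigma> assume "\<sigma> \<in> stacks (Or A B)"
  then show "halts (Inl B u \<bullet> \<sigma>)"
  proof (cases rule: stacks_Or_cases)
    case (2 w v \<tau>)
    from halts_basic[OF basic.intros(5) 2(2)[OF u]] 2(1) show ?thesis by simp
  qed (simp add: halts_nonelim nonelim_def nonpar_def)
qed

lemma realizes_Inr:
  assumes u: "u \<tturnstile> B" and "wf_fm 0 A"
  shows "Inr A u \<tturnstile> Or A B"
proof (rule realizesI)
  show "typed 0 [] (Inr A u) (Or A B)" using assms by (auto intro: typed_elem_typed.intros realizes_typed)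
next
  fix \<sigma> assume "\<sigma> \<in> stacks (Or A B)"
  then show "halts (Inr A u \<bullet> \<sigma>)"
  proof (cases rule: stacks_Or_cases)
    case (2 w v \<tau>)
    from halts_basic[OF basic.intros(6) 2(3)[OF u]] 2(1) show ?thesis by simp
  qed (simp add: halts_nonelim nonelim_def nonpar_def)
qed

lemma realizes_Wit:
  assumes "typed 0 [] (Wit A m u) (Ex A)" and u: "u \<tturnstile> fsub1 m A" and m: "wf_tm 0 m"
  shows "Wit A m u \<tturnstile> Ex A"
proof (rule realizesI[OF assms(1)])
  fix \<sigma> assume "\<sigma> \<in> stacks (Ex A)"
  then consider "\<sigma> = []" | v \<tau> where "\<sigma> = EEx A v # \<tau>" "halts (psub1 u (isub1 m v) \<bullet> \<tau>)"
    using u m by (auto simp: HN_star_iff)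
  then show "halts (Wit A m u \<bullet> \<sigma>)"
  proof cases
    case 2
    from halts_basic[OF basic.intros(7) 2(2)] 2(1) show ?thesis by simp
  qed (simp add: halts_nonelim nonelim_def nonpar_def)
qed

lemma realizes_Efq:
  assumes "typed 0 [] (Efq P u) P" and "atomic P"
  shows "Efq P u \<tturnstile> P"
proof (rule realizesI[OF assms(1)])
  fix \<sigma> assume "\<sigma> \<in> stacks P"
  with assms(2) have "\<sigma> = []" by (cases P) auto
  then show "halts (Efq P u \<bullet> \<sigma>)" by (simp add: halts_nonelim nonelim_def nonpar_def)
qed

lemma realizes_Abort:
  assumes "wf_fm 0 A" and "wf_fm 0 B"
  shows "Abort A B \<tturnstile> Imp A B"
proof (rule realizesI)
  show "typed 0 [] (Abort A B) (Imp A B)" using assms by (rule typed_elem_typed.intros)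
next
  fix \<sigma> assume "\<sigma> \<in> stacks (Imp A B)"
  then consider "\<sigma> = []" | t \<tau> where "\<sigma> = EArg t # \<tau>" "t \<tturnstile> A" by auto
  then show "halts (Abort A B \<bullet> \<sigma>)"
  proof cases
    case 2
    then have "halts (t \<bullet> [])" using realizes_halts stacks_Nil by blast
    with 2 show ?thesis using halts_Abort by simp
  qed (simp add: halts_nonelim nonelim_def nonpar_def)
qed

lemma realizes_Elim:
  assumes "u \<tturnstile> A" and "elem_typed 0 [] A \<xi> C" and "\<And>\<sigma>. \<sigma> \<in> stacks C \<Longrightarrow> \<xi> # \<sigma> \<in> stacks A"
  shows "Elim u \<xi> \<tturnstile> C"
proof (rule realizesI)
  show "typed 0 [] (Elim u \<xi>) C" using assms by (auto intro: typed_elem_typed.intros realizes_typed)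
next
  fix \<sigma> assume "\<sigma> \<in> stacks C"
  with assms have "halts (u \<bullet> (\<xi> # \<sigma>))" using realizes_halts by blast
  then show "halts (Elim u \<xi> \<bullet> \<sigma>)" by simp
qed

lemma realizes_ECase:
  assumes u: "u \<tturnstile> Or A B" and ty: "elem_typed 0 [] (Or A B) (ECase A v B w) C"
    and v: "\<And>t. t \<tturnstile> A \<Longrightarrow> psub1 t v \<tturnstile> C" and w: "\<And>t. t \<tturnstile> B \<Longrightarrow> psub1 t w \<tturnstile> C"
  shows "Elim u (ECase A v B w) \<tturnstile> C"
proof (rule realizes_Elim[OF u ty])
  fix \<sigma> assume \<sigma>: "\<sigma> \<in> stacks C"
  then have "\<exists>D. stack_typed (Or A B) (ECase A v B w # \<sigma>) D"
    using ty stack_typed_stacks by fastforce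
  with \<sigma> show "ECase A v B w # \<sigma> \<in> stacks (Or A B)" using v w realizes_HN by fastforce
qed

lemma realizes_EEx:
  assumes u: "u \<tturnstile> Ex A" and ty: "elem_typed 0 [] (Ex A) (EEx A v) C"
    and v: "\<And>m t. wf_tm 0 m \<Longrightarrow> t \<tturnstile> fsub1 m A \<Longrightarrow> psub1 t (isub1 m v) \<tturnstile> C"
  shows "Elim u (EEx A v) \<tturnstile> C"
proof (rule realizes_Elim[OF u ty])
  fix \<sigma> assume \<sigma>: "\<sigma> \<in> stacks C"
  then have "\<exists>D. stack_typed (Ex A) (EEx A v # \<sigma>) D"
    using ty stack_typed_stacks by fastforce
  with \<sigma> show "EEx A v # \<sigma> \<in> stacks (Ex A)" using v realizes_HN by fastforce
qed

text \<open>The abstraction passed on in a communication: its variable is a dummy, so applied to any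
  argument it returns \<open>s\<close>.\<close>

lemma realizes_const:
  assumes s: "s \<tturnstile> A" and "wf_fm 0 B"
  shows "Lam B (pren Suc s) \<tturnstile> Imp B A"
proof (rule realizes_Lam)
  show "typed 0 [] (Lam B (pren Suc s)) (Imp B A)"
    using assms by (auto intro!: typed_elem_typed.intros typed_weaken intro: realizes_typed)
  show "psub1 t (pren Suc s) \<tturnstile> A" for t using s by (simp add: psub_pren)
qed

text \<open>After the beta contraction the constant is applied to a halting term, and by
  \<open>halts_Abort\<close> this halts on each stack of \<open>B\<close>, whatever the formula
  \<open>B\<close> is.\<close>

lemma realizes_relay:
  assumes Y: "typed 0 [Imp B A] Y D" and wf: "wf_fm 0 A" "wf_fm 0 B"
    and halts: "\<And>s. s \<tturnstile> A \<Longrightarrow> halts (psub1 (Lam B (pren Suc s)) Y)"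
  shows "relay A B D Y \<tturnstile> Imp A B"
  unfolding relay_def
proof (rule realizes_Lam[OF typed_relay[OF Y wf, unfolded relay_def]])
  fix s assume s: "s \<tturnstile> A"
  let ?W = "psub1 (Lam B (pren Suc s)) Y"
  have "wf_fm 0 D" using typed_wf(1)[OF Y] wf by simp
  moreover have "typed 0 [] ?W D"
    using Y realizes_typed[OF realizes_const[OF s wf(2)]] by (rule typed_psub1)
  ultimately have "typed 0 [] (Elim (Abort D B) (EArg ?W)) B"
    using wf by (auto intro!: typed_elem_typed.intros)
  then have "Elim (Abort D B) (EArg ?W) \<tturnstile> B"
    by (rule realizesI) (use halts_Abort[OF halts[OF s]] in simp)
  then show "psub1 s (Elim (Abort D B) (EArg (transmit 0 B (PBnd 0) Y))) \<tturnstile> B"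
    by (simp only: psub1_relay_body[OF Y])
qed

lemma psub1_app_weaken: "psub1 t (u \<bullet> map (pren_e Suc) \<sigma>) = psub1 t u \<bullet> \<sigma>"
  by (simp add: psub_app comp_def psub_pren)

text \<open>The two relays are justified differently. That of \<open>Y\<close> rests on the
  assumption about \<open>v\<close>, applied to constant functions; that of a normal
  \<open>X'\<close> rests on the absence of places.\<close>

lemma realizes_Par:
  assumes ty: "typed 0 [] (Par A B u v) C"
    and u: "\<And>t. t \<tturnstile> Imp A B \<Longrightarrow> psub1 t u \<tturnstile> C" and v: "\<And>t. t \<tturnstile> Imp B A \<Longrightarrow> psub1 t v \<tturnstile> C"
  shows "Par A B u v \<tturnstile> C"
proof (rule realizesI[OF ty])
  fix \<sigma> assume \<sigma>: "\<sigma> \<in> stacks C"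
  \<comment> \<open>The type after the entire stack has been consumed, hence the common type of all
    processes of \<open>X\<close> and \<open>Y\<close> below.\<close>
  then obtain D where D: "stack_typed C \<sigma> D" using stack_typed_stacks by blast
  from ty have wf: "wf_fm 0 A" "wf_fm 0 B"
    and "typed 0 [Imp A B] u C" "typed 0 [Imp B A] v C" by (auto elim!: typed_ParE)
  define X where "X = u \<bullet> map (pren_e Suc) \<sigma>"
  define Y where "Y = v \<bullet> map (pren_e Suc) \<sigma>"
  have X: "typed 0 [Imp A B] X D" and Y: "typed 0 [Imp B A] Y D"
    unfolding X_def Y_def by (rule typed_app_stack_weaken; fact)+
  have hX: "halts (psub1 t X)" if "t \<tturnstile> Imp A B" for t
    unfolding X_def psub1_app_weaken using u[OF that] \<sigma> by (rule realizes_halts)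
  have hY: "halts (psub1 t Y)" if "t \<tturnstile> Imp B A" for t
    unfolding Y_def psub1_app_weaken using v[OF that] \<sigma> by (rule realizes_halts)
  have "halts (psub1 (relay B A D X') Y)"
    if X': "typed 0 [Imp A B] X' D" and normal: "places [Imp A B] X' = {}" for X'
  proof (rule hY, rule realizes_relay[OF X' wf(2,1)])
    \<comment> \<open>Only the typing of \<lambda>x. s matters here: substituting a closed
      abstraction into \<open>X'\<close> keeps its set of places empty, so the result is
      normal.\<close>
    fix s assume "s \<tturnstile> B"
    then have "typed 0 [] (Lam A (pren Suc s)) (Imp A B)"
      using realizes_typed realizes_const wf by blast
    from places_at[OF refl this, of "[]" X' D] X' normal
    show "halts (psub1 (Lam A (pren Suc s)) X')" by (simp add: subst_at_0 halts_normal)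
  qed
  moreover have "halts (psub1 (relay A B D Y) X)"
    by (rule hX, rule realizes_relay[OF Y wf], rule hY, rule realizes_const) (use wf in auto)
  ultimately have "halts (Par A B X Y)" using halts_Par[OF Y wf _ _ X] by blast
  then show "halts (Par A B u v \<bullet> \<sigma>)" unfolding X_def Y_def by (rule halts_Par_app)
qed

section \<open>Adequacy\<close>

text \<open>Both substitutions are required to be closed at every index, so a change of scope needs
  no bookkeeping of lengths; only the indices listed in \<open>\<Gamma>\<close> must be sent to
  realizers.\<close>

definition closing ::
    "(nat \<Rightarrow> 'f tm) \<Rightarrow> (nat \<Rightarrow> ('f::symbol, 'p::symbol) pt) \<Rightarrow> ('f, 'p) fm list \<Rightarrow> bool" where
  "closing \<rho> \<theta> \<Gamma> \<longleftrightarrow> (\<forall>i. wf_tm 0 (\<rho> i)) \<and> (\<forall>i. \<exists>C. typed 0 [] (\<theta> i) C) \<and>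
     (\<forall>i<length \<Gamma>. \<theta> i \<tturnstile> fsub \<rho> (\<Gamma> ! i))"

lemma closing_Cons: "closing \<rho> \<theta> \<Gamma> \<Longrightarrow> t \<tturnstile> fsub \<rho> A \<Longrightarrow> closing \<rho> (case_nat t \<theta>) (A # \<Gamma>)"
  by (auto simp: closing_def less_Suc_eq_0_disj intro: realizes_typed split: nat.split)

lemma fsub_case_shift: "fsub (case_nat m \<rho>) (fsub shift A) = fsub \<rho> A"
  by (simp add: fsub_fsub shift_def)

lemma tsub1_up: "tsub (case_nat m Bnd) (up_i \<rho> i) = case_nat m \<rho> i"
  by (auto simp: tsub_tsub shift_def split: nat.split)

lemma fsub1_up: "fsub1 m (fsub (up_i \<rho>) A) = fsub (case_nat m \<rho>) A"
  by (simp add: fsub_fsub tsub1_up)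

lemma closing_shift:
  "closing \<rho> \<theta> \<Gamma> \<Longrightarrow> wf_tm 0 m \<Longrightarrow> closing (case_nat m \<rho>) \<theta> (map (fsub shift) \<Gamma>)"
  by (auto simp: closing_def fsub_case_shift split: nat.split)

lemma psub1_up: "psub1 t (psub (up_p \<theta>) u) = psub (case_nat t \<theta>) u"
proof -
  have "(\<lambda>i. psub1 t (up_p \<theta> i)) = case_nat t \<theta>"
    by (auto simp: fun_eq_iff psub_pren split: nat.split)
  then show ?thesis by (simp add: psub_psub)
qed

lemma isub1_up: "isub1 m (isub (up_i \<rho>) u) = isub (case_nat m \<rho>) u"
  by (simp add: isub_isub tsub1_up)

lemma isub1_up_pi: "isub1 m (psub (up_pi \<theta>) (isub (up_i \<rho>) u)) = psub \<theta> (isub (case_nat m \<rho>) u)"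
  by (simp add: isub1_up flip: psub_isub1)

lemma isub1_up_p: "isub1 m (psub (up_p (up_pi \<theta>)) (isub (up_i \<rho>) u)) = psub (up_p \<theta>) (isub (case_nat m \<rho>) u)"
  by (simp add: isub_psub isub1_up isub_up_p)

lemma typed_close:
  assumes "closing \<rho> \<theta> \<Gamma>"
  shows "typed n \<Gamma> t A \<Longrightarrow> typed 0 [] (psub \<theta> (isub \<rho> t)) (fsub \<rho> A)"
    and "elem_typed n \<Gamma> A \<xi> C \<Longrightarrow>
      elem_typed 0 [] (fsub \<rho> A) (psub_e \<theta> (isub_e \<rho> \<xi>)) (fsub \<rho> C)"
proof -
  have ok: "sub_ok 0 \<theta> (map (fsub \<rho>) \<Gamma>) []"
    using assms by (auto simp: sub_ok_def closing_def intro: realizes_typed)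
  have \<rho>: "wf_tm 0 (\<rho> i)" for i using assms by (simp add: closing_def)
  show "typed 0 [] (psub \<theta> (isub \<rho> t)) (fsub \<rho> A)" if "typed n \<Gamma> t A"
    using typed_isub(1)[OF that] \<rho> ok typed_psub(1) by blast
  show "elem_typed 0 [] (fsub \<rho> A) (psub_e \<theta> (isub_e \<rho> \<xi>)) (fsub \<rho> C)" if "elem_typed n \<Gamma> A \<xi> C"
    using typed_isub(2)[OF that] \<rho> ok typed_psub(2) by blast
qed

text \<open>The statement is for open derivations, so that in the binder cases \<open>\<rho>\<close>
  and \<open>\<theta>\<close> can be extended by the individual term and the realizer that a stack
  supplies. Eliminations are treated for an arbitrary realizer \<open>u\<close> of the eliminated
  formula, to which the case of \<open>Elim\<close> supplies the main premise.\<close>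

lemma adequacy:
  fixes \<eta> :: "name \<times> ('f::symbol, 'p::symbol) fm \<rightharpoonup> ('f, 'p) pt"
  assumes \<eta>: "\<And>x A t. \<eta> (x, A) = Some t \<Longrightarrow> t \<tturnstile> A"
  shows "typed n \<Gamma> w A \<Longrightarrow> free_vars w \<subseteq> dom \<eta> \<Longrightarrow> closing \<rho> \<theta> \<Gamma> \<Longrightarrow>
      psub \<theta> (isub \<rho> (pinst \<eta> w)) \<tturnstile> fsub \<rho> A"
    and "elem_typed n \<Gamma> A \<xi> C \<Longrightarrow> free_vars_e \<xi> \<subseteq> dom \<eta> \<Longrightarrow> closing \<rho> \<theta> \<Gamma> \<Longrightarrow> u \<tturnstile> fsub \<rho> A \<Longrightarrow>
      Elim u (psub_e \<theta> (isub_e \<rho> (pinst_e \<eta> \<xi>))) \<tturnstile> fsub \<rho> C"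
proof (induction arbitrary: \<rho> \<theta> and \<rho> \<theta> u rule: typed_induct)
  have ty: "typed 0 [] (psub \<theta> (isub \<rho> (pinst \<eta> t))) (fsub \<rho> A)"
    if "typed n \<Gamma> t A" "closing \<rho> \<theta> \<Gamma>" for n \<Gamma> t A \<rho> \<theta>
    using typed_close(1)[OF that(2)] typed_pinst(1)[OF _ that(1)] \<eta> realizes_typed by blast
  have ty_e: "elem_typed 0 [] (fsub \<rho> A) (psub_e \<theta> (isub_e \<rho> (pinst_e \<eta> \<xi>))) (fsub \<rho> C)"
    if "elem_typed n \<Gamma> A \<xi> C" "closing \<rho> \<theta> \<Gamma>" for n \<Gamma> \<xi> A C \<rho> \<theta>
    using typed_close(2)[OF that(2)] typed_pinst(2)[OF _ that(1)] \<eta> realizes_typed by blast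
  have wf: "wf_fm 0 (fsub \<rho> A)" if "wf_fm n A" "closing \<rho> \<theta> \<Gamma>" for n \<Gamma> A \<rho> \<theta>
    using that by (auto intro: wf_fm_fsub simp: closing_def)
  have wf_t: "wf_tm 0 (tsub \<rho> m)" if "wf_tm n m" "closing \<rho> \<theta> \<Gamma>" for n \<Gamma> m \<rho> \<theta>
    using that by (auto intro: wf_tm_tsub simp: closing_def)
  {
    case (1 A n \<Gamma> x)
    then obtain t where t: "\<eta> (x, A) = Some t" by auto
    with \<eta> have "t \<tturnstile> A" by blast
    \<comment> \<open>A realizer is closed and the type of a free proof variable has no dangling
      index, so \<open>isub\<close>, \<open>psub\<close> and \<open>fsub\<close> leave them
      alone.\<close>
    with t 1 show ?case using isub_closed psub_closed(1) realizes_typed by (fastforce simp: fsub_closed)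
  next
    case (2 i \<Gamma> n)
    then show ?case by (simp add: closing_def)
  next
    case (3 n A B \<Gamma>)
    from realizes_Abort[OF wf[OF 3(1) "3.prems"(2)] wf[OF 3(2) "3.prems"(2)]] show ?case by simp
  next
    case (4 n \<Gamma> u A v B)
    then show ?case by (simp add: realizes_Pair)
  next
    case (5 n A \<Gamma> u B)
    have "Lam (fsub \<rho> A) (psub (up_p \<theta>) (isub \<rho> (pinst \<eta> u))) \<tturnstile> Imp (fsub \<rho> A) (fsub \<rho> B)"
    proof (rule realizes_Lam)
      show "typed 0 [] (Lam (fsub \<rho> A) (psub (up_p \<theta>) (isub \<rho> (pinst \<eta> u)))) (Imp (fsub \<rho> A) (fsub \<rho> B))"
        using ty[OF typed_elem_typed.intros(5)[OF 5(1,2)] "5.prems"(2)] by simp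
    qed (use 5 in \<open>simp add: psub1_up closing_Cons\<close>)
    then show ?case by simp
  next
    case (6 n \<Gamma> u A)
    have "TLam (psub (up_pi \<theta>) (isub (up_i \<rho>) (pinst \<eta> u))) \<tturnstile> All (fsub (up_i \<rho>) A)"
    proof (rule realizes_TLam)
      show "typed 0 [] (TLam (psub (up_pi \<theta>) (isub (up_i \<rho>) (pinst \<eta> u)))) (All (fsub (up_i \<rho>) A))"
        using ty[OF typed_elem_typed.intros(6)[OF 6(1)] "6.prems"(2)] by simp
    qed (use 6 in \<open>simp add: isub1_up_pi fsub1_up closing_shift\<close>)
    then show ?case by simp
  next
    case (7 n \<Gamma> u A B)
    then have "psub \<theta> (isub \<rho> (pinst \<eta> u)) \<tturnstile> fsub \<rho> A" by simp
    from realizes_Inl[OF this wf[OF "7.hyps"(2) "7.prems"(2)]] show ?case by simp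
  next
    case (8 n \<Gamma> u B A)
    then have "psub \<theta> (isub \<rho> (pinst \<eta> u)) \<tturnstile> fsub \<rho> B" by simp
    from realizes_Inr[OF this wf[OF "8.hyps"(2) "8.prems"(2)]] show ?case by simp
  next
    case (9 n A m \<Gamma> u)
    have "Wit (fsub (up_i \<rho>) A) (tsub \<rho> m) (psub \<theta> (isub \<rho> (pinst \<eta> u))) \<tturnstile> Ex (fsub (up_i \<rho>) A)"
    proof (rule realizes_Wit)
      show "typed 0 [] (Wit (fsub (up_i \<rho>) A) (tsub \<rho> m) (psub \<theta> (isub \<rho> (pinst \<eta> u))))
          (Ex (fsub (up_i \<rho>) A))"
        using ty[OF typed_elem_typed.intros(9)[OF 9(1-3)] "9.prems"(2)] by simp
      show "psub \<theta> (isub \<rho> (pinst \<eta> u)) \<tturnstile> fsub1 (tsub \<rho> m) (fsub (up_i \<rho>) A)"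
        using 9 by (simp add: fsub_fsub1)
      show "wf_tm 0 (tsub \<rho> m)" using wf_t[OF 9(2) "9.prems"(2)] .
    qed
    then show ?case by simp
  next
    case (10 n A B \<Gamma> u C v)
    have "Par (fsub \<rho> A) (fsub \<rho> B) (psub (up_p \<theta>) (isub \<rho> (pinst \<eta> u)))
        (psub (up_p \<theta>) (isub \<rho> (pinst \<eta> v))) \<tturnstile> fsub \<rho> C"
    proof (rule realizes_Par)
      show "typed 0 [] (Par (fsub \<rho> A) (fsub \<rho> B) (psub (up_p \<theta>) (isub \<rho> (pinst \<eta> u)))
        (psub (up_p \<theta>) (isub \<rho> (pinst \<eta> v)))) (fsub \<rho> C)"
        using ty[OF typed_elem_typed.intros(10)[OF "10.hyps"] "10.prems"(2)] by simp
    qed (use 10 in \<open>simp_all add: psub1_up closing_Cons\<close>)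
    then show ?case by simp
  next
    case (11 P n \<Gamma> u)
    have "Efq (fsub \<rho> P) (psub \<theta> (isub \<rho> (pinst \<eta> u))) \<tturnstile> fsub \<rho> P"
    proof (rule realizes_Efq)
      show "typed 0 [] (Efq (fsub \<rho> P) (psub \<theta> (isub \<rho> (pinst \<eta> u)))) (fsub \<rho> P)"
        using ty[OF typed_elem_typed.intros(11)[OF "11.hyps"] "11.prems"(2)] by simp
    qed (use 11 in simp)
    then show ?case by simp
  next
    case (12 n \<Gamma> u A \<xi> C)
    then show ?case by simp
  next
    case (13 n \<Gamma> v A B)
    have "elem_typed 0 [] (fsub \<rho> (Imp A B)) (psub_e \<theta> (isub_e \<rho> (pinst_e \<eta> (EArg v)))) (fsub \<rho> B)"
      by (rule ty_e[OF typed_elem_typed.intros(13)[OF "13.hyps"] "13.prems"(2)])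
    with "13.prems"(3) show ?case by (rule realizes_Elim) (use 13 in simp)
  next
    case (14 n m \<Gamma> A)
    have "elem_typed 0 [] (fsub \<rho> (All A)) (psub_e \<theta> (isub_e \<rho> (pinst_e \<eta> (EInd m)))) (fsub \<rho> (fsub1 m A))"
      by (rule ty_e[OF typed_elem_typed.intros(14)[OF "14.hyps"] "14.prems"(2)])
    with "14.prems"(3) show ?case
      by (rule realizes_Elim) (use wf_t[OF "14.hyps" "14.prems"(2)] in \<open>simp add: fsub_fsub1\<close>)
  next
    case (15 n \<Gamma> A B)
    show ?case using "15.prems"(3) by (auto intro!: realizes_Elim[of u] typed_elem_typed.intros)
  next
    case (16 n \<Gamma> A B)
    show ?case using "16.prems"(3) by (auto intro!: realizes_Elim[of u] typed_elem_typed.intros)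
  next
    case (17 n A B \<Gamma> v C w)
    have "Elim u (ECase (fsub \<rho> A) (psub (up_p \<theta>) (isub \<rho> (pinst \<eta> v)))
        (fsub \<rho> B) (psub (up_p \<theta>) (isub \<rho> (pinst \<eta> w)))) \<tturnstile> fsub \<rho> C"
    proof (rule realizes_ECase)
      show "elem_typed 0 [] (Or (fsub \<rho> A) (fsub \<rho> B))
         (ECase (fsub \<rho> A) (psub (up_p \<theta>) (isub \<rho> (pinst \<eta> v)))
        (fsub \<rho> B) (psub (up_p \<theta>) (isub \<rho> (pinst \<eta> w)))) (fsub \<rho> C)"
        using ty_e[OF typed_elem_typed.intros(17)[OF "17.hyps"] "17.prems"(2)] by simp
    qed (use 17 in \<open>simp_all add: psub1_up closing_Cons\<close>)
    then show ?case by simp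
  next
    case (18 n A C \<Gamma> v)
    have "Elim u (EEx (fsub (up_i \<rho>) A) (psub (up_p (up_pi \<theta>)) (isub (up_i \<rho>) (pinst \<eta> v)))) \<tturnstile> fsub \<rho> C"
    proof (rule realizes_EEx)
      show "elem_typed 0 [] (Ex (fsub (up_i \<rho>) A))
         (EEx (fsub (up_i \<rho>) A) (psub (up_p (up_pi \<theta>)) (isub (up_i \<rho>) (pinst \<eta> v)))) (fsub \<rho> C)"
        using ty_e[OF typed_elem_typed.intros(18)[OF "18.hyps"] "18.prems"(2)] by simp
    next
      fix m t
      assume m: "wf_tm 0 m" and t: "t \<tturnstile> fsub1 m (fsub (up_i \<rho>) A)"
      \<comment> \<open>The eigenvariable takes the value \<open>m\<close> and the bound proof
        variable the value \<open>t\<close>; the entries of \<open>\<Gamma>\<close> are shifted and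
        so do not notice \<open>m\<close>.\<close>
      have "closing (case_nat m \<rho>) (case_nat t \<theta>) (A # map (fsub shift) \<Gamma>)"
        using closing_shift[OF "18.prems"(2) m] t by (intro closing_Cons) (simp_all add: fsub1_up)
      with "18.IH" "18.prems"(1)
      have "psub (case_nat t \<theta>) (isub (case_nat m \<rho>) (pinst \<eta> v)) \<tturnstile> fsub (case_nat m \<rho>) (fsub shift C)"
        by simp
      then show "psub1 t (isub1 m (psub (up_p (up_pi \<theta>)) (isub (up_i \<rho>) (pinst \<eta> v)))) \<tturnstile> fsub \<rho> C"
        by (simp add: isub1_up_p psub1_up fsub_case_shift)
    qed (use 18 in simp)
    then show ?case by simp
  }
qed

theorem theorem3p8:
  fixes w :: "('f::symbol, 'p::symbol) pt" and A :: "('f, 'p) fm"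
    and xs :: "name list" and As :: "('f, 'p) fm list" and ts :: "('f, 'p) pt list"
    and \<alpha>s :: "name list" and rs :: "'f tm list"
  assumes "LC w A"
    and "length As = length xs" and "length ts = length xs"
    and "free_vars w \<subseteq> set (zip xs As)"
    and "length rs = length \<alpha>s" and "\<forall>r\<in>set rs. wf_tm 0 r"
    and "\<forall>i<length xs. ts ! i \<tturnstile> finst (map_of (zip \<alpha>s rs)) (As ! i)"
  shows "pinst (map_of (zip (zip xs (map (finst (map_of (zip \<alpha>s rs))) As)) ts))
           (inst (map_of (zip \<alpha>s rs)) w)
         \<tturnstile> finst (map_of (zip \<alpha>s rs)) A"
proof -
  define \<mu> where "\<mu> = map_of (zip \<alpha>s rs)"
  define \<eta> where "\<eta> = map_of (zip (zip xs (map (finst \<mu>) As)) ts)"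
  have \<mu>: "\<forall>r\<in>ran \<mu>. wf_tm 0 r"
    using assms(6) by (auto simp: \<mu>_def ran_def dest!: map_of_SomeD set_zip_rightD)
  \<comment> \<open>Repeated variables do no harm, including those whose types coincide only after
    instantiation: whichever \<open>ts ! i\<close> is selected by \<open>map_of\<close> realizes its
    own type.\<close>
  have \<eta>: "t \<tturnstile> B" if t: "\<eta> (x, B) = Some t" for x B t
  proof -
    have "((x, B), t) \<in> set (zip (zip xs (map (finst \<mu>) As)) ts)"
      using t unfolding \<eta>_def by (rule map_of_SomeD)
    then obtain i where "i < length xs" "B = finst \<mu> (As ! i)" "t = ts ! i"
      using assms(2,3) by (auto simp: set_zip)
    with assms(7) show ?thesis by (simp add: \<mu>_def)
  qed
  have "typed 0 [] w A" using assms(1) by (simp add: LC_def)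
  from typed_inst(1)[OF \<mu> this] have w: "typed 0 [] (inst \<mu> w) (finst \<mu> A)" by simp
  have "set (zip xs (map (finst \<mu>) As)) = map_prod id (finst \<mu>) ` set (zip xs As)"
    by (simp add: zip_map2 map_prod_def id_def flip: set_map)
  moreover have "dom \<eta> = set (zip xs (map (finst \<mu>) As))"
    unfolding \<eta>_def using assms(2,3) by (simp add: dom_map_of_zip)
  ultimately have dom: "free_vars (inst \<mu> w) \<subseteq> dom \<eta>"
    using assms(4) by (auto simp: free_vars_inst)
  \<comment> \<open>The instantiated term has no dangling indices, so any closed default values do;
    \<open>Var 0\<close> is a closed individual term and \<open>Abort Bot Bot\<close> a closed typed
    proof term.\<close>
  define \<rho> :: "nat \<Rightarrow> 'f tm" where "\<rho> = (\<lambda>_. Var 0)"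
  define \<theta> :: "nat \<Rightarrow> ('f, 'p) pt" where "\<theta> = (\<lambda>_. Abort Bot Bot)"
  have "typed 0 [] (Abort Bot Bot :: ('f, 'p) pt) (Imp Bot Bot)"
    by (rule typed_elem_typed.intros) simp_all
  then have "closing \<rho> \<theta> []" by (auto simp: closing_def \<rho>_def \<theta>_def)
  from adequacy(1)[OF \<eta> w dom this]
  have "psub \<theta> (isub \<rho> (pinst \<eta> (inst \<mu> w))) \<tturnstile> fsub \<rho> (finst \<mu> A)" .
  moreover have "typed 0 [] (pinst \<eta> (inst \<mu> w)) (finst \<mu> A)"
    by (rule typed_pinst(1)[OF realizes_typed[OF \<eta>] w])
  moreover have "wf_fm 0 (finst \<mu> A)" using typed_wf(1)[OF w] by simp
  ultimately show ?thesis
    unfolding \<mu>_def[symmetric] \<eta>_def[symmetric] by (simp add: isub_closed psub_closed fsub_closed)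
qed

end
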